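(* Let $r\ge 3$ and let $\mathcal H_r'$ be a set of connected $r$-graphs such that every connected simple $r$-graph can be colored by an element of $\mathcal H_r'$. i) If $r=3$ and the Petersen Coloring Conjecture is false, then $\mathcal H_3'$ is an infinite set. ii) If $r\ge 4$, then $\mathcal H_r'$ is an infinite set.
   Context: All graphs are finite and may have parallel edges but no loops; a graph is simple if it has no parallel edges. Graphs are considered up to isomorphism. For $X\subseteq V(G)$, $\partial_G(X)$ is the set of edges of $G$ with exactly one end in $X$; $\partial_G(v)=\partial_G(\{v\})$. An $r$-regular graph $G$ is an $r$-graph if $|\partial_G(X)|\ge r$ for every $X\subseteq V(G)$ of odd cardinality. An $H$-coloring of $G$ is a mapping $f\colon E(G)\to E(H)$ such that $f(e_1)\ne f(e_2)$ for adjacent edges $e_1,e_2$ of $G$, and for every $v\in V(G)$ there is $u\in V(H)$ with $f(\partial_G(v))=\partial_H(u)$. If such a mapping exists, $H$ is said to color $G$. The Petersen Coloring Conjecture is the assertion that the Petersen graph colors every bridgeless cubic graph (parallel edges allowed), equivalently every $3$-graph. *)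

theory Defs
  imports Main
begin

record ('v, 'e) multigraph =
  vertices :: "'v set"
  edges :: "'e set"
  ends :: "'e \<Rightarrow> 'v set"

text \<open>Parallel edges are distinct edges with the same set of ends. Requiring exactly two ends
  excludes loops.\<close>

definition wf_multigraph :: "('v, 'e) multigraph \<Rightarrow> bool" where
  "wf_multigraph G \<longleftrightarrow> finite (vertices G) \<and> finite (edges G) \<and>
     (\<forall>e\<in>edges G. ends G e \<subseteq> vertices G \<and> card (ends G e) = 2)"

definition simple_multigraph :: "('v, 'e) multigraph \<Rightarrow> bool" where
  "simple_multigraph G \<longleftrightarrow> inj_on (ends G) (edges G)"

definition edge_boundary :: "('v, 'e) multigraph \<Rightarrow> 'v set \<Rightarrow> 'e set" where
  "edge_boundary G X = {e \<in> edges G. card (ends G e \<inter> X) = 1}"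

definition regular_multigraph :: "nat \<Rightarrow> ('v, 'e) multigraph \<Rightarrow> bool" where
  "regular_multigraph r G \<longleftrightarrow>
     wf_multigraph G \<and> (\<forall>v\<in>vertices G. card (edge_boundary G {v}) = r)"

definition r_graph :: "nat \<Rightarrow> ('v, 'e) multigraph \<Rightarrow> bool" where
  "r_graph r G \<longleftrightarrow> regular_multigraph r G \<and>
     (\<forall>X. X \<subseteq> vertices G \<longrightarrow> odd (card X) \<longrightarrow> card (edge_boundary G X) \<ge> r)"

definition vertex_adjacency :: "('v, 'e) multigraph \<Rightarrow> ('v \<times> 'v) set" where
  "vertex_adjacency G = {(u, v). \<exists>e\<in>edges G. ends G e = {u, v}}"

definition connected_multigraph :: "('v, 'e) multigraph \<Rightarrow> bool" where
  "connected_multigraph G \<longleftrightarrow> vertices G \<noteq> {} \<and>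
     (\<forall>u\<in>vertices G. \<forall>v\<in>vertices G. (u, v) \<in> (vertex_adjacency G)\<^sup>*)"

definition adjacent_edges :: "('v, 'e) multigraph \<Rightarrow> 'e \<Rightarrow> 'e \<Rightarrow> bool" where
  "adjacent_edges G e1 e2 \<longleftrightarrow>
     e1 \<in> edges G \<and> e2 \<in> edges G \<and> e1 \<noteq> e2 \<and> ends G e1 \<inter> ends G e2 \<noteq> {}"

definition multigraph_coloring ::
  "('w, 'c) multigraph \<Rightarrow> ('v, 'e) multigraph \<Rightarrow> ('e \<Rightarrow> 'c) \<Rightarrow> bool" where
  "multigraph_coloring H G f \<longleftrightarrow>
     f ` edges G \<subseteq> edges H \<and>
     (\<forall>e1 e2. adjacent_edges G e1 e2 \<longrightarrow> f e1 \<noteq> f e2) \<and>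
     (\<forall>v\<in>vertices G. \<exists>u\<in>vertices H. f ` edge_boundary G {v} = edge_boundary H {u})"

definition colors :: "('w, 'c) multigraph \<Rightarrow> ('v, 'e) multigraph \<Rightarrow> bool" where
  "colors H G \<longleftrightarrow> (\<exists>f. multigraph_coloring H G f)"

text \<open>Restricted to well-formed graphs, since on ill-formed records, whose edges may have ends
  outside the vertex set, the relation would not be symmetric.\<close>

definition multigraph_iso :: "(('v, 'e) multigraph \<times> ('v, 'e) multigraph) set" where
  "multigraph_iso = {(G, H). wf_multigraph G \<and> wf_multigraph H \<and>
     (\<exists>\<phi> \<psi>. bij_betw \<phi> (vertices G) (vertices H) \<and> bij_betw \<psi> (edges G) (edges H) \<and>
        (\<forall>e\<in>edges G. ends H (\<psi> e) = \<phi> ` ends G e))}"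

lemma equiv_multigraph_iso:
  "equiv {G :: ('v, 'e) multigraph. wf_multigraph G} multigraph_iso"
proof (rule equivI)
  show "multigraph_iso \<subseteq> {G :: ('v, 'e) multigraph. wf_multigraph G} \<times> {G. wf_multigraph G}"
    by (auto simp: multigraph_iso_def)
  show "refl_on {G :: ('v, 'e) multigraph. wf_multigraph G} multigraph_iso"
  proof (rule refl_onI)
    fix G :: "('v, 'e) multigraph" assume "G \<in> {G. wf_multigraph G}"
    moreover have "bij_betw id (vertices G) (vertices G) \<and> bij_betw id (edges G) (edges G) \<and>
        (\<forall>e\<in>edges G. ends G (id e) = id ` ends G e)" by simp
    ultimately show "(G, G) \<in> multigraph_iso"
      unfolding multigraph_iso_def by blast
  qed
  show "sym (multigraph_iso :: (('v, 'e) multigraph \<times> _) set)"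
  proof (rule symI)
    fix G H :: "('v, 'e) multigraph" assume "(G, H) \<in> multigraph_iso"
    then obtain \<phi> \<psi> where wf: "wf_multigraph G" "wf_multigraph H"
      and b: "bij_betw \<phi> (vertices G) (vertices H)" "bij_betw \<psi> (edges G) (edges H)"
      and e: "\<And>e. e \<in> edges G \<Longrightarrow> ends H (\<psi> e) = \<phi> ` ends G e"
      by (auto simp: multigraph_iso_def)
    let ?p = "inv_into (vertices G) \<phi>" and ?q = "inv_into (edges G) \<psi>"
    have "ends G (?q d) = ?p ` ends H d" if "d \<in> edges H" for d
    proof -
      have qd: "?q d \<in> edges G" "\<psi> (?q d) = d"
        using b(2) that by (auto simp: bij_betw_def inv_into_into f_inv_into_f)
      then have "ends H d = \<phi> ` ends G (?q d)" using e[of "?q d"] by simp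
      moreover have "ends G (?q d) \<subseteq> vertices G"
        using wf(1) qd(1) by (auto simp: wf_multigraph_def)
      ultimately show ?thesis
        using b(1) by (simp add: bij_betw_def inv_into_image_cancel)
    qed
    then show "(H, G) \<in> multigraph_iso"
      using wf b[THEN bij_betw_inv_into] unfolding multigraph_iso_def by blast
  qed
  show "trans (multigraph_iso :: (('v, 'e) multigraph \<times> _) set)"
  proof (rule transI)
    fix G H K :: "('v, 'e) multigraph"
    assume "(G, H) \<in> multigraph_iso" "(H, K) \<in> multigraph_iso"
    then obtain \<phi> \<psi> \<phi>' \<psi>' where wf: "wf_multigraph G" "wf_multigraph K"
      and b: "bij_betw \<phi> (vertices G) (vertices H)" "bij_betw \<psi> (edges G) (edges H)"
      and b': "bij_betw \<phi>' (vertices H) (vertices K)" "bij_betw \<psi>' (edges H) (edges K)"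
      and e: "\<And>e. e \<in> edges G \<Longrightarrow> ends H (\<psi> e) = \<phi> ` ends G e"
      and e': "\<And>e. e \<in> edges H \<Longrightarrow> ends K (\<psi>' e) = \<phi>' ` ends H e"
      by (auto simp: multigraph_iso_def)
    have "\<forall>d\<in>edges G. ends K ((\<psi>' \<circ> \<psi>) d) = (\<phi>' \<circ> \<phi>) ` ends G d"
      using e e' bij_betwE[OF b(2)] by (simp add: image_comp)
    then show "(G, K) \<in> multigraph_iso"
      using wf bij_betw_trans[OF b(1) b'(1)] bij_betw_trans[OF b(2) b'(2)]
      unfolding multigraph_iso_def by blast
  qed
qed

definition delete_edge :: "('v, 'e) multigraph \<Rightarrow> 'e \<Rightarrow> ('v, 'e) multigraph" where
  "delete_edge G e = G\<lparr>edges := edges G - {e}\<rparr>"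

text \<open>A bridge is an edge whose deletion separates its two ends.\<close>

definition bridge :: "('v, 'e) multigraph \<Rightarrow> 'e \<Rightarrow> bool" where
  "bridge G e \<longleftrightarrow> e \<in> edges G \<and>
     (\<exists>u v. ends G e = {u, v} \<and> (u, v) \<notin> (vertex_adjacency (delete_edge G e))\<^sup>*)"

definition bridgeless :: "('v, 'e) multigraph \<Rightarrow> bool" where
  "bridgeless G \<longleftrightarrow> (\<forall>e. \<not> bridge G e)"

text \<open>The Petersen graph as a Kneser graph: its vertices are the two-element subsets of a
  five-element set, and two of them are joined by an edge if and only if they are disjoint.\<close>

definition petersen_graph :: "(nat set, nat set set) multigraph" where
  "petersen_graph = \<lparr>
     vertices = {A. A \<subseteq> {0..<5} \<and> card A = 2},
     edges = {{A, B} | A B. A \<subseteq> {0..<5} \<and> card A = 2 \<and> B \<subseteq> {0..<5} \<and> card B = 2 \<and> A \<inter> B = {}},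
     ends = id\<rparr>"

text \<open>Every finite graph is isomorphic to one whose vertices and edges are natural
  numbers, so quantifying over graphs on natural numbers covers all finite graphs.\<close>

definition petersen_coloring_conjecture :: bool where
  "petersen_coloring_conjecture \<longleftrightarrow>
     (\<forall>G :: (nat, nat) multigraph.
        regular_multigraph 3 G \<and> bridgeless G \<longrightarrow> colors petersen_graph G)"

end

theory Submission
  imports Defs
begin

text \<open>Weaken colourings so that a star may be mapped to any tight cut, that is, to any odd cut of
  size r. Odd cuts of size r are then mapped to tight cuts as well, so that colourings compose and
  restrict to both parts of a graph glued from two. If a finite family suffices, then by gluing
  counterexamples one of its members colours every r-graph. Take a minimal graft K with this
  property. Identifying the ends of unused edges and splitting off pairs of edges show that K is an
  r-graph all of whose endomorphisms are automorphisms. Gluing an arbitrary r-graph onto K shows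
  that any bijection from one of its stars onto a star of K extends to a colouring. This symmetry
  makes K simple and forces its tight cuts to be stars, since a nontrivial one would produce a
  2-vertex-cut at every vertex. For r at least 4, such a K cannot colour the Petersen graph with
  the edges of a perfect matching multiplied r - 2 times. For r = 3, a colouring of the Petersen
  graph by K is an isomorphism, and so the Petersen graph colours every 3-graph.\<close>

subsection \<open>Grafts and colourings by tight cuts\<close>

text \<open>Identifying two vertices or splitting off two arcs destroys regularity and changes which
  vertex sets are odd. Grafts absorb this: a set is odd if it contains an odd number of terminals,
  and only odd cuts must have at least \<open>r\<close> arcs. Both operations stay in this class, so
  minimality can be used before anything is known about degrees. The price is that a colouring
  promises tight cuts instead of stars; stars return once the minimal object is known to have no
  other tight cuts. Degrees come from splitting off: where no pair of arcs at a vertex can be split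
  off, uncrossing the tight sets that block it fixes the degree. The test graphs rest on one
  observation. In a simple graph two distinct stars share at most one arc, so two parallel spokes
  force both ends of the spoke onto the same star; but pentagon and pentagram are complementary
  5-cycles, and their colours cannot agree at all five spokes. For r = 3 there is only one spoke
  between its ends, and the conclusion has to come from the small diameter and large girth of the
  Petersen graph.\<close>

text \<open>Loops are allowed, since identifying vertices may create them; they belong to no cut.\<close>

record ('v, 'e) graft =
  verts :: "'v set"
  arcs :: "'e set"
  src :: "'e \<Rightarrow> 'v"
  tgt :: "'e \<Rightarrow> 'v"
  terminals :: "'v set"

definition cutset :: "('v, 'e, 'z) graft_scheme \<Rightarrow> 'v set \<Rightarrow> 'e set" where
  "cutset K X = {e \<in> arcs K. (src K e \<in> X) \<noteq> (tgt K e \<in> X)}"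

definition odd_set :: "('v, 'e) graft \<Rightarrow> 'v set \<Rightarrow> bool" where
  "odd_set K X \<longleftrightarrow> X \<subseteq> verts K \<and> odd (card (X \<inter> terminals K))"

text \<open>Odd cuts are T-cuts with T the set of terminals. The last clause gives every odd cut the
  parity of \<open>r\<close> (\<open>cutset_parity\<close>), so an odd cut with more than
  \<open>r\<close> arcs has at least \<open>r + 2\<close> and survives the loss of two arcs in a
  splitting off.\<close>

definition is_graft :: "nat \<Rightarrow> ('v, 'e) graft \<Rightarrow> bool" where
  "is_graft r K \<longleftrightarrow> finite (verts K) \<and> finite (arcs K) \<and>
     (\<forall>e\<in>arcs K. src K e \<in> verts K \<and> tgt K e \<in> verts K) \<and> terminals K \<subseteq> verts K \<and>
     (\<forall>X. odd_set K X \<longrightarrow> r \<le> card (cutset K X)) \<and>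
     (\<forall>v\<in>verts K. odd (card (cutset K {v})) \<longleftrightarrow> odd r \<and> v \<in> terminals K)"

definition tight :: "nat \<Rightarrow> ('v, 'e) graft \<Rightarrow> 'e set \<Rightarrow> bool" where
  "tight r K S \<longleftrightarrow> (\<exists>X. odd_set K X \<and> S = cutset K X \<and> card S = r)"

text \<open>Connectedness is included, as the absence of nontrivial empty cuts; in this form it
  passes through gluing and contraction by looking at cuts alone.\<close>

definition is_rgraph :: "nat \<Rightarrow> ('v, 'e) graft \<Rightarrow> bool" where
  "is_rgraph r G \<longleftrightarrow> is_graft r G \<and> terminals G = verts G \<and> verts G \<noteq> {} \<and>
     (\<forall>v\<in>verts G. card (cutset G {v}) = r) \<and> (\<forall>e\<in>arcs G. src G e \<noteq> tgt G e) \<and>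
     (\<forall>X\<subseteq>verts G. cutset G X = {} \<longrightarrow> X = {} \<or> X = verts G)"

definition cut_coloring :: "nat \<Rightarrow> ('w, 'c) graft \<Rightarrow> ('v, 'e) graft \<Rightarrow> ('e \<Rightarrow> 'c) \<Rightarrow> bool" where
  "cut_coloring r K G f \<longleftrightarrow> (\<forall>v\<in>verts G. inj_on f (cutset G {v}) \<and> tight r K (f ` cutset G {v}))"

lemma is_graftD:
  assumes "is_graft r K"
  shows "finite (verts K)" "finite (arcs K)" "\<And>e. e \<in> arcs K \<Longrightarrow> src K e \<in> verts K"
    "\<And>e. e \<in> arcs K \<Longrightarrow> tgt K e \<in> verts K" "terminals K \<subseteq> verts K"
    "\<And>X. odd_set K X \<Longrightarrow> r \<le> card (cutset K X)"
    "\<And>v. v \<in> verts K \<Longrightarrow> odd (card (cutset K {v})) \<longleftrightarrow> odd r \<and> v \<in> terminals K"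
    "finite (terminals K)"
  using assms unfolding is_graft_def by (auto intro: finite_subset)

lemma is_rgraphD:
  assumes "is_rgraph r G"
  shows "is_graft r G" "terminals G = verts G" "verts G \<noteq> {}" 
    "\<And>v. v \<in> verts G \<Longrightarrow> card (cutset G {v}) = r"
    "\<And>e. e \<in> arcs G \<Longrightarrow> src G e \<noteq> tgt G e"
    "\<And>X. X \<subseteq> verts G \<Longrightarrow> cutset G X = {} \<Longrightarrow> X = {} \<or> X = verts G"
    "finite (verts G)" "finite (arcs G)" "\<And>e. e \<in> arcs G \<Longrightarrow> src G e \<in> verts G"
    "\<And>e. e \<in> arcs G \<Longrightarrow> tgt G e \<in> verts G"
    "\<And>X. X \<subseteq> verts G \<Longrightarrow> odd (card X) \<Longrightarrow> r \<le> card (cutset G X)"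
  using assms unfolding is_rgraph_def is_graft_def odd_set_def by (auto simp: Int_absorb2)

lemma cutset_subset: "cutset K X \<subseteq> arcs K"
  by (auto simp: cutset_def)

lemma finite_cutset: "is_graft r K \<Longrightarrow> finite (cutset K X)"
  using cutset_subset is_graftD(2) finite_subset by metis

lemma cutset_empty [simp]: "cutset K {} = {}"
  by (auto simp: cutset_def)

lemma cutset_compl: "is_graft r K \<Longrightarrow> cutset K (verts K - X) = cutset K X"
  by (auto simp: cutset_def is_graftD(3,4))

lemma cutset_verts: "is_graft r K \<Longrightarrow> cutset K (verts K) = {}"
  by (auto simp: cutset_def is_graftD(3,4))

text \<open>Otherwise the whole vertex set would be odd, although its cut is empty.\<close>

lemma even_terminals:
  assumes "is_graft r K" "0 < r" shows "even (card (terminals K))"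
proof (rule ccontr)
  assume "odd (card (terminals K))"
  then have "odd_set K (verts K)" using is_graftD(5)[OF assms(1)] by (simp add: odd_set_def Int_absorb1)
  then show False using is_graftD(6)[OF assms(1)] cutset_verts[OF assms(1)] assms(2) by fastforce
qed

lemma odd_set_compl:
  assumes "is_graft r K" "0 < r" "odd_set K X" shows "odd_set K (verts K - X)"
proof -
  have "(verts K - X) \<inter> terminals K = terminals K - X" using is_graftD(5)[OF assms(1)] by auto
  then have "card (terminals K) = card (X \<inter> terminals K) + card ((verts K - X) \<inter> terminals K)"
    using card_Int_Diff[OF is_graftD(8)[OF assms(1)], of X] by (simp add: Int_commute)
  then show ?thesis using even_terminals[OF assms(1,2)] assms(3) by (auto simp: odd_set_def)
qed

section \<open>Parity of cuts and images of cuts under colourings\<close>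

lemma odd_card_filter_neq:
  assumes "finite A"
  shows "odd (card {x \<in> A. P x \<noteq> Q x}) \<longleftrightarrow> odd (card {x \<in> A. P x}) \<noteq> odd (card {x \<in> A. Q x})"
  using assms
proof (induction A rule: finite_induct)
  case (insert a A)
  have *: "{x \<in> insert a A. R x} = (if R a then insert a {x \<in> A. R x} else {x \<in> A. R x})" for R
    by auto
  show ?case unfolding * using insert by auto
qed auto

lemma card_filter_sum: "finite A \<Longrightarrow> card {x \<in> A. P x} = (\<Sum>x\<in>A. of_bool (P x))"
  by (simp only: card_eq_sum sum.inter_filter of_bool_def)

lemma odd_sum_iff: "finite A \<Longrightarrow> odd (\<Sum>x\<in>A. f x) \<longleftrightarrow> odd (card {x \<in> A. odd (f x :: nat)})"
  using even_sum_iff[of A f] by simp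

text \<open>An arc with both ends in \<open>X\<close> lies in two of the stars and cancels modulo
  two; a loop lies in none of them.\<close>

lemma odd_star_sum:
  assumes "finite X"
  shows "odd (card {x \<in> X. e \<in> cutset G {x}}) \<longleftrightarrow> e \<in> cutset G X"
proof (cases "e \<in> arcs G")
  case True
  have "{x \<in> X. e \<in> cutset G {x}} = {x \<in> X. (src G e = x) \<noteq> (tgt G e = x)}"
    using True by (auto simp: cutset_def)
  moreover have "odd (card {x \<in> X. a = x}) \<longleftrightarrow> a \<in> X" for a
  proof -
    have "{x \<in> X. a = x} = (if a \<in> X then {a} else {})" by auto
    then show ?thesis by simp
  qed
  ultimately show ?thesis using odd_card_filter_neq[OF assms, of "\<lambda>x. src G e = x" "\<lambda>x. tgt G e = x"] True
    by (simp add: cutset_def)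
qed (auto simp: cutset_def)

lemma double_count_parity:
  assumes "finite A" "finite B"
  shows "odd (card {a \<in> A. odd (card {b \<in> B. R a b})}) \<longleftrightarrow> odd (card {b \<in> B. odd (card {a \<in> A. R a b})})"
proof -
  have "(\<Sum>a\<in>A. card {b \<in> B. R a b}) = (\<Sum>b\<in>B. card {a \<in> A. R a b})"
    by (simp only: card_filter_sum assms) (rule sum.swap)
  then show ?thesis
    unfolding odd_sum_iff[OF assms(1), symmetric] odd_sum_iff[OF assms(2), symmetric] by (rule arg_cong)
qed

text \<open>Modulo two, the image of a cut is the sum of the images of the stars inside it, which is
  again a cut.\<close>

lemma push_parity:
  assumes K: "is_graft r K" and G: "finite (arcs G)" and X: "finite X"
    and inj: "\<And>x. x \<in> X \<Longrightarrow> inj_on f (cutset G {x})"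
    and Y: "\<And>x. x \<in> X \<Longrightarrow> odd_set K (Y x) \<and> f ` cutset G {x} = cutset K (Y x)"
    and c: "c = {w \<in> verts K. odd (card {x \<in> X. w \<in> Y x})}"
  shows "odd (card {d \<in> cutset G X. f d = e}) \<longleftrightarrow> e \<in> cutset K c"
    and "odd (card (c \<inter> terminals K)) \<longleftrightarrow> odd (card X)"
proof -
  have "odd (card {d \<in> cutset G X. f d = e}) \<longleftrightarrow> odd (card {d \<in> {d \<in> arcs G. f d = e}. odd (card {x \<in> X. d \<in> cutset G {x}})})"
    by (rule arg_cong[where f = "\<lambda>A. odd (card A)"]) (auto simp: odd_star_sum[OF X] dest: cutset_subset[THEN subsetD])
  also have "\<dots> \<longleftrightarrow> odd (card {x \<in> X. odd (card {d \<in> {d \<in> arcs G. f d = e}. d \<in> cutset G {x}})})"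
    using G X by (intro double_count_parity) auto
  also have "{x \<in> X. odd (card {d \<in> {d \<in> arcs G. f d = e}. d \<in> cutset G {x}})} = {x \<in> X. e \<in> cutset K (Y x)}"
  proof -
    \<comment> \<open>Injectivity on the star leaves at most one arc of colour \<open>e\<close>
      there, so the parity records whether the colour occurs.\<close>
    have "odd (card {d \<in> {d \<in> arcs G. f d = e}. d \<in> cutset G {x}}) \<longleftrightarrow> e \<in> cutset K (Y x)" if x: "x \<in> X" for x
    proof (cases "e \<in> cutset K (Y x)")
      case True
      then obtain d where "d \<in> cutset G {x}" "f d = e" using Y[OF x] by (metis imageE)
      then have "{d \<in> {d \<in> arcs G. f d = e}. d \<in> cutset G {x}} = {d}"
        using inj[OF x] by (auto simp: inj_on_def dest: cutset_subset[THEN subsetD])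
      then show ?thesis using True by simp
    next
      case False
      then have "{d \<in> {d \<in> arcs G. f d = e}. d \<in> cutset G {x}} = {}" using Y[OF x] by auto
      then show ?thesis using False by (metis card.empty even_zero)
    qed
    then show ?thesis by auto
  qed
  also have "odd (card {x \<in> X. e \<in> cutset K (Y x)}) \<longleftrightarrow> e \<in> cutset K c"
  proof (cases "e \<in> arcs K")
    case True
    then show ?thesis using odd_card_filter_neq[OF X, of "\<lambda>x. src K e \<in> Y x" "\<lambda>x. tgt K e \<in> Y x"] is_graftD(3,4)[OF K True]
      by (auto simp: cutset_def c)
  qed (auto simp: cutset_def)
  finally show "odd (card {d \<in> cutset G X. f d = e}) \<longleftrightarrow> e \<in> cutset K c" .
  have "c \<inter> terminals K = {w \<in> terminals K. odd (card {x \<in> X. w \<in> Y x})}"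
    using is_graftD(5)[OF K] by (auto simp: c)
  then have "odd (card (c \<inter> terminals K)) \<longleftrightarrow> odd (card {x \<in> X. odd (card {w \<in> terminals K. w \<in> Y x})})"
    using double_count_parity[OF is_graftD(8)[OF K] X, of "\<lambda>w x. w \<in> Y x"] by simp
  also have "{x \<in> X. odd (card {w \<in> terminals K. w \<in> Y x})} = X"
    using Y by (auto simp: odd_set_def Int_def conj_commute)
  finally show "odd (card (c \<inter> terminals K)) \<longleftrightarrow> odd (card X)" .
qed

text \<open>The colours that occur an odd number of times on the cut form an odd cut of K, which has
  at least \<open>r\<close> elements. They are among the at most \<open>r\<close> colours of the
  cut, so both sets coincide and no colour is repeated.\<close>

lemma cut_coloring_push:
  assumes K: "is_graft r K" and G: "finite (arcs G)" and w: "cut_coloring r K G f"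
    and X: "X \<subseteq> verts G" "finite X" "odd (card X)" "card (cutset G X) = r"
  shows "inj_on f (cutset G X)" "tight r K (f ` cutset G X)"
proof -
  have "\<forall>x\<in>X. \<exists>Y. odd_set K Y \<and> f ` cutset G {x} = cutset K Y"
    using w X(1) unfolding cut_coloring_def tight_def by blast
  then obtain Y where Y: "\<And>x. x \<in> X \<Longrightarrow> odd_set K (Y x) \<and> f ` cutset G {x} = cutset K (Y x)" by metis
  define c where "c = {w \<in> verts K. odd (card {x \<in> X. w \<in> Y x})}"
  have inj: "\<And>x. x \<in> X \<Longrightarrow> inj_on f (cutset G {x})" using w X(1) by (auto simp: cut_coloring_def)
  note p = push_parity[OF K G X(2) inj Y c_def]
  have c: "odd_set K c" using p(2) X(3) by (auto simp: odd_set_def c_def)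
  have sub: "cutset K c \<subseteq> f ` cutset G X"
  proof
    fix e assume "e \<in> cutset K c"
    then have "card {d \<in> cutset G X. f d = e} \<noteq> 0" using p(1)[of e] by (metis even_zero)
    then show "e \<in> f ` cutset G X" by (auto simp: card_gt_0_iff)
  qed
  have fin: "finite (cutset G X)" using G cutset_subset finite_subset by metis
  have "r \<le> card (cutset K c)" using is_graftD(6)[OF K c] .
  moreover have "card (cutset K c) \<le> card (f ` cutset G X)" using sub fin by (simp add: card_mono)
  moreover have "card (f ` cutset G X) \<le> r" using card_image_le[OF fin] X(4) by metis
  ultimately have eq: "card (f ` cutset G X) = r" "card (cutset K c) = card (f ` cutset G X)" by linarith+
  show "inj_on f (cutset G X)" using eq(1) X(4) fin by (simp add: eq_card_imp_inj_on)
  have "cutset K c = f ` cutset G X" using sub eq(2) fin by (simp add: card_subset_eq)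
  then show "tight r K (f ` cutset G X)" using c eq(1) by (auto simp: tight_def)
qed

lemma cut_coloring_push_tight:
  assumes K: "is_graft r K" and G: "is_rgraph r G" and w: "cut_coloring r K G f" and S: "tight r G S"
  shows "inj_on f S" "tight r K (f ` S)"
proof -
  obtain X where X: "X \<subseteq> verts G" "odd (card X)" "S = cutset G X" "card (cutset G X) = r"
    using S is_rgraphD(2)[OF G] by (auto simp: tight_def odd_set_def Int_absorb2)
  then show "inj_on f S" "tight r K (f ` S)"
    using cut_coloring_push[OF K is_rgraphD(8)[OF G] w] finite_subset[OF X(1) is_rgraphD(7)[OF G]] by blast+
qed

lemma cut_coloring_comp:
  assumes "is_graft r K" "is_rgraph r H" "cut_coloring r K H g" "cut_coloring r H G f"
  shows "cut_coloring r K G (g \<circ> f)"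
  using assms(4) cut_coloring_push_tight[OF assms(1-3)] unfolding cut_coloring_def
  by (metis comp_inj_on image_comp)

lemma star_tight: "is_rgraph r G \<Longrightarrow> v \<in> verts G \<Longrightarrow> tight r G (cutset G {v})"
  unfolding tight_def by (rule exI[of _ "{v}"]) (auto simp: odd_set_def is_rgraphD(2,4))

lemma odd_card_cutset:
  assumes "finite (arcs G)" "finite X"
  shows "odd (card (cutset G X)) \<longleftrightarrow> odd (card {x \<in> X. odd (card (cutset G {x}))})"
proof -
  have "odd (card (cutset G X)) \<longleftrightarrow> odd (card {d \<in> arcs G. odd (card {x \<in> X. d \<in> cutset G {x}})})"
    by (rule arg_cong[where f = "\<lambda>A. odd (card A)"]) (auto simp: odd_star_sum[OF assms(2)] dest: cutset_subset[THEN subsetD])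
  also have "\<dots> \<longleftrightarrow> odd (card {x \<in> X. odd (card {d \<in> arcs G. d \<in> cutset G {x}})})"
    using assms by (rule double_count_parity)
  also have "\<dots> \<longleftrightarrow> odd (card {x \<in> X. odd (card (cutset G {x}))})"
  proof -
    have "{d \<in> arcs G. d \<in> cutset G {x}} = cutset G {x}" for x by (auto simp: cutset_def)
    then show ?thesis by simp
  qed
  finally show ?thesis .
qed

lemma cutset_parity:
  assumes K: "is_graft r K" and X: "X \<subseteq> verts K"
  shows "odd (card (cutset K X)) \<longleftrightarrow> odd r \<and> odd (card (X \<inter> terminals K))"
proof -
  have "{x \<in> X. odd (card (cutset K {x}))} = {x \<in> X. odd r \<and> x \<in> terminals K}"
    using X is_graftD(7)[OF K] by auto
  moreover have fX: "finite X" using X is_graftD(1)[OF K] finite_subset by blast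
  ultimately have "odd (card (cutset K X)) \<longleftrightarrow> odd (card {x \<in> X. odd r \<and> x \<in> terminals K})"
    using odd_card_cutset[OF is_graftD(2)[OF K] fX] by (simp only:)
  then show ?thesis by (cases "odd r") (auto simp: Int_def)
qed

lemma rgraph_even_verts: "is_rgraph r G \<Longrightarrow> 0 < r \<Longrightarrow> even (card (verts G))"
  using even_terminals is_rgraphD(1,2) by metis

lemma rgraph_tight_iff:
  "is_rgraph r G \<Longrightarrow> tight r G S \<longleftrightarrow> (\<exists>X\<subseteq>verts G. odd (card X) \<and> S = cutset G X \<and> card S = r)"
  by (auto simp: tight_def odd_set_def is_rgraphD(2) Int_absorb2)

subsection \<open>Gluing r-graphs at a vertex\<close>

lemma is_rgraphI:
  assumes "finite (verts G)" "finite (arcs G)" "verts G \<noteq> {}" "terminals G = verts G"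
    and "\<And>e. e \<in> arcs G \<Longrightarrow> src G e \<in> verts G \<and> tgt G e \<in> verts G \<and> src G e \<noteq> tgt G e"
    and deg: "\<And>v. v \<in> verts G \<Longrightarrow> card (cutset G {v}) = r"
    and "\<And>X. X \<subseteq> verts G \<Longrightarrow> odd (card X) \<Longrightarrow> r \<le> card (cutset G X)"
    and "\<And>X. X \<subseteq> verts G \<Longrightarrow> cutset G X = {} \<Longrightarrow> X = {} \<or> X = verts G"
  shows "is_rgraph r G"
  using assms unfolding is_rgraph_def is_graft_def odd_set_def by (auto simp: Int_absorb2)

section \<open>Renaming vertices and arcs\<close>

definition relabel :: "('v \<Rightarrow> 'w) \<Rightarrow> ('e \<Rightarrow> 'd) \<Rightarrow> ('v, 'e) graft \<Rightarrow> ('w, 'd) graft" where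
  "relabel \<phi> \<psi> G = \<lparr>verts = \<phi> ` verts G, arcs = \<psi> ` arcs G,
     src = (\<lambda>d. \<phi> (src G (inv_into (arcs G) \<psi> d))),
     tgt = (\<lambda>d. \<phi> (tgt G (inv_into (arcs G) \<psi> d))), terminals = \<phi> ` terminals G\<rparr>"

lemma relabel_cutset:
  assumes "is_rgraph r G" "inj_on \<phi> (verts G)" "inj_on \<psi> (arcs G)" "X \<subseteq> verts G"
  shows "cutset (relabel \<phi> \<psi> G) (\<phi> ` X) = \<psi> ` cutset G X"
proof -
  have "\<phi> a \<in> \<phi> ` X \<longleftrightarrow> a \<in> X" if "a \<in> verts G" for a
    using that assms(2,4) by (auto dest: inj_onD)
  then have "\<psi> d \<in> cutset (relabel \<phi> \<psi> G) (\<phi> ` X) \<longleftrightarrow> d \<in> cutset G X" if "d \<in> arcs G" for d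
    using that is_rgraphD(9,10)[OF assms(1)] assms(3) by (simp add: cutset_def relabel_def)
  moreover have "cutset (relabel \<phi> \<psi> G) (\<phi> ` X) \<subseteq> \<psi> ` arcs G" by (auto simp: cutset_def relabel_def)
  ultimately show ?thesis using cutset_subset[of G X] by blast
qed

lemma relabel_rgraph:
  assumes G: "is_rgraph r G" and i: "inj_on \<phi> (verts G)" "inj_on \<psi> (arcs G)"
  shows "is_rgraph r (relabel \<phi> \<psi> G)"
proof (rule is_rgraphI)
  note c = relabel_cutset[OF assms]
  have cardc: "card (cutset (relabel \<phi> \<psi> G) (\<phi> ` X)) = card (cutset G X)" if "X \<subseteq> verts G" for X
    unfolding c[OF that] using i(2) cutset_subset by (metis card_image inj_on_subset)
  show "card (cutset (relabel \<phi> \<psi> G) {v}) = r" if v: "v \<in> verts (relabel \<phi> \<psi> G)" for v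
  proof -
    obtain u where "u \<in> verts G" "v = \<phi> u" using v by (auto simp: relabel_def)
    then show ?thesis using cardc[of "{u}"] is_rgraphD(4)[OF G] by simp
  qed
  show "r \<le> card (cutset (relabel \<phi> \<psi> G) X)" if X: "X \<subseteq> verts (relabel \<phi> \<psi> G)" "odd (card X)" for X
  proof -
    obtain Z where Z: "Z \<subseteq> verts G" "X = \<phi> ` Z" using X(1) unfolding relabel_def by (metis graft.select_convs(1) subset_imageE)
    then have "card X = card Z" using i(1) by (metis card_image inj_on_subset)
    then show ?thesis using that Z cardc[of Z] is_rgraphD(11)[OF G Z(1)] by simp
  qed
  show "X = {} \<or> X = verts (relabel \<phi> \<psi> G)" if X: "X \<subseteq> verts (relabel \<phi> \<psi> G)" "cutset (relabel \<phi> \<psi> G) X = {}" for X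
  proof -
    obtain Z where Z: "Z \<subseteq> verts G" "X = \<phi> ` Z" using X(1) unfolding relabel_def by (metis graft.select_convs(1) subset_imageE)
    then show ?thesis using that c[of Z] is_rgraphD(6)[OF G Z(1)] by (auto simp: relabel_def)
  qed
  fix e assume "e \<in> arcs (relabel \<phi> \<psi> G)"
  then obtain d where d: "d \<in> arcs G" "e = \<psi> d" by (auto simp: relabel_def)
  then show "src (relabel \<phi> \<psi> G) e \<in> verts (relabel \<phi> \<psi> G) \<and> tgt (relabel \<phi> \<psi> G) e \<in> verts (relabel \<phi> \<psi> G)
    \<and> src (relabel \<phi> \<psi> G) e \<noteq> tgt (relabel \<phi> \<psi> G) e"
    using is_rgraphD(5,9,10)[OF G d(1)] i by (simp add: relabel_def inj_on_eq_iff)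
qed (use is_rgraphD(2,3,7,8)[OF G] in \<open>simp_all add: relabel_def\<close>)

lemma relabel_cut_coloring:
  assumes G: "is_rgraph r G" and i: "inj_on \<phi> (verts G)" "inj_on \<psi> (arcs G)"
    and w: "cut_coloring r K (relabel \<phi> \<psi> G) f"
  shows "cut_coloring r K G (f \<circ> \<psi>)"
  unfolding cut_coloring_def
proof
  fix v assume v: "v \<in> verts G"
  have c: "cutset (relabel \<phi> \<psi> G) {\<phi> v} = \<psi> ` cutset G {v}"
    using relabel_cutset[OF G i, of "{v}"] v by simp
  have "\<phi> v \<in> verts (relabel \<phi> \<psi> G)" using v by (simp add: relabel_def)
  then show "inj_on (f \<circ> \<psi>) (cutset G {v}) \<and> tight r K ((f \<circ> \<psi>) ` cutset G {v})"
    using w c i(2) cutset_subset[of G "{v}"] unfolding cut_coloring_def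
    by (metis comp_inj_on image_comp inj_on_subset)
qed

lemma nat_injections:
  assumes G: "is_rgraph r G"
  obtains \<phi> :: "_ \<Rightarrow> nat" and \<psi> :: "_ \<Rightarrow> nat" where "inj_on \<phi> (verts G)" "inj_on \<psi> (arcs G)"
  using finite_imp_inj_to_nat_seg is_rgraphD(7,8)[OF G] by metis

lemma star_comp:
  assumes "inj_on i S" "inj_on f (i ` S) \<and> tight r K (f ` i ` S)"
  shows "inj_on (f \<circ> i) S \<and> tight r K ((f \<circ> i) ` S)"
  using assms comp_inj_on[of i S f] by (simp only: image_comp simp_thms)

lemma bij_betw_vimage_inv:
  assumes "bij_betw f A B"
  shows "{x \<in> A. f x \<in> S} = inv_into A f ` (B \<inter> S)"
proof (intro equalityI subsetI)
  fix x assume x: "x \<in> {x \<in> A. f x \<in> S}"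
  then have "inv_into A f (f x) = x" using assms by (simp add: bij_betw_def)
  moreover have "f x \<in> B \<inter> S" using x assms by (auto simp: bij_betw_def)
  ultimately show "x \<in> inv_into A f ` (B \<inter> S)" by (metis image_eqI)
next
  fix x assume "x \<in> inv_into A f ` (B \<inter> S)"
  then obtain y where "y \<in> B" "y \<in> S" "x = inv_into A f y" by blast
  then show "x \<in> {x \<in> A. f x \<in> S}" using assms by (simp add: bij_betw_def f_inv_into_f inv_into_into)
qed

section \<open>The glued graph and its cuts\<close>

definition other_end :: "('v, 'e) graft \<Rightarrow> 'v \<Rightarrow> 'e \<Rightarrow> 'v" where
  "other_end G v e = (if src G e = v then tgt G e else src G e)"

lemma other_end_props:
  assumes "is_rgraph r G" "e \<in> cutset G {v}"
  shows "other_end G v e \<in> verts G" "other_end G v e \<noteq> v" "v \<notin> X \<Longrightarrow> e \<in> cutset G X \<longleftrightarrow> other_end G v e \<in> X"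
    "{src G e, tgt G e} = {v, other_end G v e}"
    "v \<in> X \<Longrightarrow> e \<in> cutset G X \<longleftrightarrow> other_end G v e \<notin> X"
  using assms is_rgraphD(9,10)[OF assms(1)] by (auto simp: other_end_def cutset_def)

text \<open>The vertices \<open>v\<close> and \<open>w\<close> are removed, and the arcs that lose
  an end are joined along \<open>\<beta>\<close>. The joined arc keeps the name \<open>Inl e\<close>
  of its half in G and runs from G to H; the name of the half \<open>\<beta> e\<close>
  disappears.\<close>

definition glue :: "('a, 'b) graft \<Rightarrow> 'a \<Rightarrow> ('c, 'd) graft \<Rightarrow> 'c \<Rightarrow> ('b \<Rightarrow> 'd) \<Rightarrow> ('a + 'c, 'b + 'd) graft" where
  "glue G v H w \<beta> = \<lparr>verts = Inl ` (verts G - {v}) \<union> Inr ` (verts H - {w}),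
     arcs = Inl ` arcs G \<union> Inr ` (arcs H - cutset H {w}),
     src = (\<lambda>e. case e of Inl e \<Rightarrow> Inl (if e \<in> cutset G {v} then other_end G v e else src G e) | Inr e \<Rightarrow> Inr (src H e)),
     tgt = (\<lambda>e. case e of Inl e \<Rightarrow> if e \<in> cutset G {v} then Inr (other_end H w (\<beta> e)) else Inl (tgt G e) | Inr e \<Rightarrow> Inr (tgt H e)),
     terminals = Inl ` (verts G - {v}) \<union> Inr ` (verts H - {w})\<rparr>"

lemma glue_simps:
  "verts (glue G v H w \<beta>) = Inl ` (verts G - {v}) \<union> Inr ` (verts H - {w})"
  "terminals (glue G v H w \<beta>) = verts (glue G v H w \<beta>)"
  "arcs (glue G v H w \<beta>) = Inl ` arcs G \<union> Inr ` (arcs H - cutset H {w})"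
  "src (glue G v H w \<beta>) (Inl e) = Inl (if e \<in> cutset G {v} then other_end G v e else src G e)"
  "tgt (glue G v H w \<beta>) (Inl e) = (if e \<in> cutset G {v} then Inr (other_end H w (\<beta> e)) else Inl (tgt G e))"
  "src (glue G v H w \<beta>) (Inr d) = Inr (src H d)"
  "tgt (glue G v H w \<beta>) (Inr d) = Inr (tgt H d)"
  by (simp_all add: glue_def)

text \<open>The counterpart of \<open>Inl\<close> for H: an arc at \<open>w\<close> is known in the
  glued graph under the name of its partner at \<open>v\<close>.\<close>

definition glue_inr :: "('a, 'b) graft \<Rightarrow> 'a \<Rightarrow> ('c, 'd) graft \<Rightarrow> 'c \<Rightarrow> ('b \<Rightarrow> 'd) \<Rightarrow> 'd \<Rightarrow> 'b + 'd" where
  "glue_inr G v H w \<beta> e = (if e \<in> cutset H {w} then Inl (inv_into (cutset G {v}) \<beta> e) else Inr e)"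

context
  fixes r :: nat and G :: "('a, 'b) graft" and v :: 'a and H :: "('c, 'd) graft" and w :: 'c
    and \<beta> :: "'b \<Rightarrow> 'd"
  assumes r: "0 < r" and G: "is_rgraph r G" and H: "is_rgraph r H"
    and v: "v \<in> verts G" and w: "w \<in> verts H"
    and \<beta>: "bij_betw \<beta> (cutset G {v}) (cutset H {w})"
begin

lemma glue_cutset:
  assumes "X \<subseteq> verts G - {v}" "Y \<subseteq> verts H - {w}"
  shows "cutset (glue G v H w \<beta>) (Inl ` X \<union> Inr ` Y) =
     Inl ` (cutset G X - cutset G {v}) \<union> Inr ` (cutset H Y - cutset H {w}) \<union>
     Inl ` {e \<in> cutset G {v}. (e \<in> cutset G X) \<noteq> (\<beta> e \<in> cutset H Y)}"
proof -
  let ?g = "glue G v H w \<beta>" and ?Z = "Inl ` X \<union> Inr ` Y :: ('a + 'c) set"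
  have i: "Inl x \<in> ?Z \<longleftrightarrow> x \<in> X" "Inr y \<in> ?Z \<longleftrightarrow> y \<in> Y" for x y by auto
  have a: "Inl e \<in> arcs ?g \<longleftrightarrow> e \<in> arcs G" "Inr d \<in> arcs ?g \<longleftrightarrow> d \<in> arcs H \<and> d \<notin> cutset H {w}" for e d
    unfolding glue_simps by auto
  have "v \<notin> X" "w \<notin> Y" using assms by auto
  have b: "\<beta> e \<in> cutset H {w}" if "e \<in> cutset G {v}" for e using that \<beta> by (rule bij_betw_apply[rotated])
  have l: "Inl e \<in> cutset ?g ?Z \<longleftrightarrow> (if e \<in> cutset G {v} then (e \<in> cutset G X) \<noteq> (\<beta> e \<in> cutset H Y) else e \<in> cutset G X)" for e
  proof (cases "e \<in> cutset G {v}")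
    case True
    then have "e \<in> arcs G" using cutset_subset by fast
    moreover have "Inl e \<in> cutset ?g ?Z \<longleftrightarrow> Inl e \<in> arcs ?g \<and> (src ?g (Inl e) \<in> ?Z) \<noteq> (tgt ?g (Inl e) \<in> ?Z)"
      by (simp only: cutset_def mem_Collect_eq)
    ultimately have "Inl e \<in> cutset ?g ?Z \<longleftrightarrow> (other_end G v e \<in> X) \<noteq> (other_end H w (\<beta> e) \<in> Y)"
      using True by (simp only: a glue_simps(4-7) i if_True simp_thms)
    then show ?thesis using True other_end_props(3)[OF G True \<open>v \<notin> X\<close>] other_end_props(3)[OF H b[OF True] \<open>w \<notin> Y\<close>] by simp
  next
    case False
    have "Inl e \<in> cutset ?g ?Z \<longleftrightarrow> Inl e \<in> arcs ?g \<and> (src ?g (Inl e) \<in> ?Z) \<noteq> (tgt ?g (Inl e) \<in> ?Z)"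
      by (simp only: cutset_def mem_Collect_eq)
    then have "Inl e \<in> cutset ?g ?Z \<longleftrightarrow> e \<in> arcs G \<and> (src G e \<in> X) \<noteq> (tgt G e \<in> X)"
      using False by (simp only: a glue_simps(4-7) i if_False simp_thms)
    then show ?thesis using False by (simp only: cutset_def[of G X] if_False mem_Collect_eq)
  qed
  have r: "Inr e \<in> cutset ?g ?Z \<longleftrightarrow> e \<in> cutset H Y \<and> e \<notin> cutset H {w}" for e
  proof -
    have "Inr e \<in> cutset ?g ?Z \<longleftrightarrow> Inr e \<in> arcs ?g \<and> (src ?g (Inr e) \<in> ?Z) \<noteq> (tgt ?g (Inr e) \<in> ?Z)"
      by (simp only: cutset_def mem_Collect_eq)
    then show ?thesis by (simp only: a glue_simps(4-7) i cutset_def[of H Y] mem_Collect_eq) blast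
  qed
  show ?thesis
  proof (rule set_eqI)
    fix e show "e \<in> cutset ?g ?Z \<longleftrightarrow> e \<in> Inl ` (cutset G X - cutset G {v}) \<union> Inr ` (cutset H Y - cutset H {w}) \<union>
     Inl ` {e \<in> cutset G {v}. (e \<in> cutset G X) \<noteq> (\<beta> e \<in> cutset H Y)}"
    proof (cases e)
      case (Inl d)
      show ?thesis unfolding Inl l by auto
    next
      case (Inr d)
      show ?thesis unfolding Inr r by auto
    qed
  qed
qed

text \<open>Reduces the cut conditions of the glued graph to linear arithmetic. Here
  \<open>a\<close> and \<open>b\<close> count the arcs of the two cuts off the stars at
  \<open>v\<close> and \<open>w\<close>, \<open>c\<close> and \<open>d\<close> those inside the
  stars, and \<open>m\<close> the joined arcs that are cut. The last two inequalities hold because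
  the latter are the symmetric difference of the former two sets.\<close>

lemma glue_card:
  assumes X: "X \<subseteq> verts G - {v}" and Y: "Y \<subseteq> verts H - {w}"
  obtains a b c d m where "card (cutset (glue G v H w \<beta>) (Inl ` X \<union> Inr ` Y)) = a + b + m"
    "card (cutset G X) = a + c" "card (cutset G (insert v X)) = a + (r - c)" "c \<le> r"
    "card (cutset H Y) = b + d" "card (cutset H (insert w Y)) = b + (r - d)" "d \<le> r"
    "c \<le> m + d" "d \<le> m + c" 
proof -
  let ?A = "cutset G X \<inter> cutset G {v}" and ?B = "cutset H Y \<inter> cutset H {w}"
  let ?B' = "{e \<in> cutset G {v}. \<beta> e \<in> cutset H Y}"
  let ?M = "{e \<in> cutset G {v}. (e \<in> cutset G X) \<noteq> (\<beta> e \<in> cutset H Y)}"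
  let ?a = "card (cutset G X - cutset G {v})" and ?b = "card (cutset H Y - cutset H {w})"
  note fG = finite_cutset[OF is_rgraphD(1)[OF G]] and fH = finite_cutset[OF is_rgraphD(1)[OF H]]
  have inj: "inj_on (Inl :: 'b \<Rightarrow> 'b + 'd) S" "inj_on (Inr :: 'd \<Rightarrow> 'b + 'd) S'" for S S' by auto
  have 1: "card (cutset (glue G v H w \<beta>) (Inl ` X \<union> Inr ` Y)) = ?a + ?b + card ?M"
  proof -
    have "finite ?M" using fG[of "{v}"] by simp
    then have "card (Inl ` (cutset G X - cutset G {v}) \<union> Inr ` (cutset H Y - cutset H {w}) \<union> Inl ` ?M) =
      card (Inl ` (cutset G X - cutset G {v}) \<union> Inr ` (cutset H Y - cutset H {w}) :: ('b + 'd) set) + card ?M"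
      using fG fH by (subst card_Un_disjoint) (auto simp: card_image)
    also have "card (Inl ` (cutset G X - cutset G {v}) \<union> Inr ` (cutset H Y - cutset H {w}) :: ('b + 'd) set) = ?a + ?b"
      using fG fH by (subst card_Un_disjoint) (auto simp: card_image)
    finally show ?thesis unfolding glue_cutset[OF assms] .
  qed
  have 2: "card (cutset G X) = ?a + card ?A" "card (cutset H Y) = ?b + card ?B"
    using card_Int_Diff[OF fG, of X "cutset G {v}"] card_Int_Diff[OF fH, of Y "cutset H {w}"] by linarith+
  have 3: "card (cutset G (insert v X)) = ?a + (r - card ?A)"
  proof -
    have "cutset G (insert v X) = (cutset G X - cutset G {v}) \<union> (cutset G {v} - ?A)"
      using X unfolding cutset_def by blast
    moreover have "card (cutset G {v} - ?A) = r - card ?A"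
      using card_Diff_subset[of ?A "cutset G {v}"] fG is_rgraphD(4)[OF G v] by simp
    moreover have "card ((cutset G X - cutset G {v}) \<union> (cutset G {v} - ?A)) = ?a + card (cutset G {v} - ?A)"
      using fG by (intro card_Un_disjoint) blast+
    ultimately show ?thesis by presburger
  qed
  have 4: "card (cutset H (insert w Y)) = ?b + (r - card ?B)"
  proof -
    have "cutset H (insert w Y) = (cutset H Y - cutset H {w}) \<union> (cutset H {w} - ?B)"
      using Y unfolding cutset_def by blast
    moreover have "card (cutset H {w} - ?B) = r - card ?B"
      using card_Diff_subset[of ?B "cutset H {w}"] fH is_rgraphD(4)[OF H w] by simp
    moreover have "card ((cutset H Y - cutset H {w}) \<union> (cutset H {w} - ?B)) = ?b + card (cutset H {w} - ?B)"
      using fH by (intro card_Un_disjoint) blast+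
    ultimately show ?thesis by presburger
  qed
  have 5: "card ?A \<le> r" "card ?B \<le> r"
    using card_mono[OF fG, of ?A "{v}"] card_mono[OF fH, of ?B "{w}"] is_rgraphD(4)[OF G v] is_rgraphD(4)[OF H w] by auto
  have "\<beta> ` ?B' = ?B" using \<beta> by (auto simp: bij_betw_def)
  moreover have "inj_on \<beta> ?B'" using \<beta> by (auto simp: bij_betw_def inj_on_def)
  ultimately have 6: "card ?B' = card ?B" using card_image[of \<beta> ?B'] by simp
  have "?A \<subseteq> ?M \<union> ?B'" "?B' \<subseteq> ?M \<union> ?A" by auto
  moreover have "finite (?M \<union> ?B')" "finite (?M \<union> ?A)" using fG[of "{v}"] by auto
  ultimately have "card ?A \<le> card (?M \<union> ?B')" "card ?B' \<le> card (?M \<union> ?A)"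
    by (blast intro: card_mono)+
  then have "card ?A \<le> card ?M + card ?B'" "card ?B' \<le> card ?M + card ?A" 
    using card_Un_le[of ?M ?B'] card_Un_le[of ?M ?A] by linarith+
  with 6 show ?thesis using that[OF 1 2(1) 3 5(1) 2(2) 4 5(2)] by simp
qed

lemma glue_subset_verts:
  assumes "Z \<subseteq> verts (glue G v H w \<beta>)"
  obtains X Y where "Z = Inl ` X \<union> Inr ` Y" "X \<subseteq> verts G - {v}" "Y \<subseteq> verts H - {w}"
    "card Z = card X + card Y" "finite X" "finite Y"
proof -
  let ?X = "Inl -` Z" and ?Y = "Inr -` Z"
  have "x \<in> Z \<longleftrightarrow> x \<in> Inl ` ?X \<union> Inr ` ?Y" for x by (cases x) auto
  then have Z: "Z = Inl ` ?X \<union> Inr ` ?Y" by blast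
  have s: "?X \<subseteq> verts G - {v}" "?Y \<subseteq> verts H - {w}" using assms by (auto simp: glue_def)
  have f: "finite ?X" "finite ?Y" using s is_rgraphD(7)[OF G] is_rgraphD(7)[OF H] finite_subset by blast+
  have "card (Inl ` ?X \<union> Inr ` ?Y) = card ?X + card ?Y"
    using f by (subst card_Un_disjoint) (auto simp: card_image simp del: image_vimage_eq)
  then have "card Z = card ?X + card ?Y" using Z by simp
  then show ?thesis using that[OF Z s] f by blast
qed

lemma glue_cutset_inl:
  assumes "x \<in> verts G" "x \<noteq> v"
  shows "cutset (glue G v H w \<beta>) {Inl x} = Inl ` cutset G {x}"
proof -
  have "cutset (glue G v H w \<beta>) (Inl ` {x} \<union> Inr ` {}) = Inl ` cutset G {x}"
    by (subst glue_cutset) (use assms in auto)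
  then show ?thesis by simp
qed

lemma glue_cutset_inr:
  assumes "x \<in> verts H" "x \<noteq> w"
  shows "cutset (glue G v H w \<beta>) {Inr x} = glue_inr G v H w \<beta> ` cutset H {x}"
proof -
  have "cutset (glue G v H w \<beta>) (Inl ` {} \<union> Inr ` {x}) = 
     Inr ` (cutset H {x} - cutset H {w}) \<union> Inl ` {e \<in> cutset G {v}. \<beta> e \<in> cutset H {x}}"
    by (subst glue_cutset) (use assms in auto)
  also have "{e \<in> cutset G {v}. \<beta> e \<in> cutset H {x}} = inv_into (cutset G {v}) \<beta> ` (cutset H {w} \<inter> cutset H {x})"
    by (rule bij_betw_vimage_inv[OF \<beta>])
  also have "Inr ` (cutset H {x} - cutset H {w}) \<union> Inl ` \<dots> = glue_inr G v H w \<beta> ` cutset H {x}"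
    by (auto simp: glue_inr_def)
  finally show ?thesis by simp
qed

text \<open>The cut between the two halves is a copy of both removed stars. It stands in for them
  when a colouring is restricted to one half.\<close>

lemma glue_cutset_middle:
  "cutset (glue G v H w \<beta>) (Inr ` (verts H - {w})) = Inl ` cutset G {v}"
  "cutset (glue G v H w \<beta>) (Inr ` (verts H - {w})) = glue_inr G v H w \<beta> ` cutset H {w}"
proof -
  have "cutset H (verts H - {w}) = cutset H {w}" using cutset_compl[OF is_rgraphD(1)[OF H]] .
  then have "cutset (glue G v H w \<beta>) (Inl ` {} \<union> Inr ` (verts H - {w})) = Inl ` {e \<in> cutset G {v}. \<beta> e \<in> cutset H {w}}"
    by (subst glue_cutset) auto
  also have "{e \<in> cutset G {v}. \<beta> e \<in> cutset H {w}} = cutset G {v}" using \<beta> by (auto simp: bij_betw_def)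
  finally show 1: "cutset (glue G v H w \<beta>) (Inr ` (verts H - {w})) = Inl ` cutset G {v}" by simp
  have "inv_into (cutset G {v}) \<beta> ` cutset H {w} = cutset G {v}"
    using bij_betw_inv_into[OF \<beta>] by (simp add: bij_betw_def)
  then have "Inl ` cutset G {v} = glue_inr G v H w \<beta> ` cutset H {w}"
    by (auto simp: glue_inr_def)
  with 1 show "cutset (glue G v H w \<beta>) (Inr ` (verts H - {w})) = glue_inr G v H w \<beta> ` cutset H {w}" by simp
qed

lemma glue_inr_inj: "inj_on (glue_inr G v H w \<beta>) S"
proof -
  have "inj_on (inv_into (cutset G {v}) \<beta>) (cutset H {w})" using bij_betw_inv_into[OF \<beta>] by (simp add: bij_betw_def)
  then show ?thesis unfolding inj_on_def glue_inr_def by auto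
qed

text \<open>Exactly one of the two parts of an odd set is odd, say \<open>X\<close>. Then
  \<open>X\<close> and \<open>insert w Y\<close> are odd sets of G and H. The first gives
  \<open>r \<le> a + c\<close>, the second \<open>d \<le> b\<close>, and with
  \<open>c \<le> m + d\<close> the glued cut has at least \<open>r\<close> arcs.\<close>

lemma glue_rgraph: "is_rgraph r (glue G v H w \<beta>)"
proof (rule is_rgraphI)
  let ?g = "glue G v H w \<beta>"
  have fin: "finite (cutset G X)" "finite (cutset H Y)" for X Y
    using finite_cutset is_rgraphD(1) G H by blast+
  show "verts ?g \<noteq> {}" 
  proof -
    have "verts G \<noteq> {v}" using cutset_verts[OF is_rgraphD(1)[OF G]] is_rgraphD(4)[OF G v] r by auto
    then have "verts G - {v} \<noteq> {}" using v by auto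
    then show ?thesis by (auto simp: glue_def)
  qed
  show "card (cutset ?g {x}) = r" if "x \<in> verts ?g" for x
  proof (cases x)
    case (Inl y)
    then have y: "y \<in> verts G" "y \<noteq> v" using that by (auto simp: glue_def)
    show ?thesis unfolding Inl glue_cutset_inl[OF y] using is_rgraphD(4)[OF G y(1)] by (simp add: card_image)
  next
    case (Inr y)
    then have y: "y \<in> verts H" "y \<noteq> w" using that by (auto simp: glue_def)
    show ?thesis unfolding Inr glue_cutset_inr[OF y] using is_rgraphD(4)[OF H y(1)] by (simp add: card_image glue_inr_inj)
  qed
  have odds: "r \<le> card (cutset G X)" if "X \<subseteq> verts G - {v}" "odd (card X)" for X
    using is_rgraphD(11)[OF G, of X] that by auto
  have odds': "r \<le> card (cutset H X)" if "X \<subseteq> verts H - {w}" "odd (card X)" for X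
    using is_rgraphD(11)[OF H, of X] that by auto
  have evens: "r \<le> card (cutset G (insert v X))" if "X \<subseteq> verts G - {v}" "finite X" "even (card X)" for X
    using is_rgraphD(11)[OF G, of "insert v X"] that v by (auto simp: card_insert_if subset_Diff_insert)
  have evens': "r \<le> card (cutset H (insert w X))" if "X \<subseteq> verts H - {w}" "finite X" "even (card X)" for X
    using is_rgraphD(11)[OF H, of "insert w X"] that w by (auto simp: card_insert_if subset_Diff_insert)
  show "r \<le> card (cutset ?g Z)" if Z: "Z \<subseteq> verts ?g" "odd (card Z)" for Z
  proof -
    obtain X Y where XY: "Z = Inl ` X \<union> Inr ` Y" "X \<subseteq> verts G - {v}" "Y \<subseteq> verts H - {w}" "card Z = card X + card Y"
      "finite X" "finite Y" using glue_subset_verts[OF Z(1)] by metis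
    obtain a b c d m where *: "card (cutset (glue G v H w \<beta>) (Inl ` X \<union> Inr ` Y)) = a + b + m"
      "card (cutset G X) = a + c" "card (cutset G (insert v X)) = a + (r - c)" "c \<le> r"
      "card (cutset H Y) = b + d" "card (cutset H (insert w Y)) = b + (r - d)" "d \<le> r"
      "c \<le> m + d" "d \<le> m + c" using glue_card[OF XY(2,3)] .
    show ?thesis
    proof (cases "odd (card X)")
      case True
      then have "r \<le> a + c" "r \<le> b + (r - d)" using odds[OF XY(2)] evens'[OF XY(3,6)] Z(2) XY(4) * by simp_all
      then have "r \<le> a + b + m" using *(7-9) by linarith
      then show ?thesis using *(1) XY(1) by simp
    next
      case False
      then have "r \<le> b + d" "r \<le> a + (r - c)" using odds'[OF XY(3)] evens[OF XY(2,5)] Z(2) XY(4) * by simp_all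
      then have "r \<le> a + b + m" using *(4,8,9) by linarith
      then show ?thesis using *(1) XY(1) by simp
    qed
  qed
  show "Z = {} \<or> Z = verts ?g" if Z: "Z \<subseteq> verts ?g" "cutset ?g Z = {}" for Z
  proof -
    obtain X Y where XY: "Z = Inl ` X \<union> Inr ` Y" "X \<subseteq> verts G - {v}" "Y \<subseteq> verts H - {w}" "card Z = card X + card Y"
      "finite X" "finite Y" using glue_subset_verts[OF Z(1)] by metis
    obtain a b c d m where *: "card (cutset (glue G v H w \<beta>) (Inl ` X \<union> Inr ` Y)) = a + b + m"
    "card (cutset G X) = a + c" "card (cutset G (insert v X)) = a + (r - c)" "c \<le> r"
    "card (cutset H Y) = b + d" "card (cutset H (insert w Y)) = b + (r - d)" "d \<le> r"
    "c \<le> m + d" "d \<le> m + c" using glue_card[OF XY(2,3)] .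
    \<comment> \<open>With no arc in the cut, \<open>c\<close> equals \<open>d\<close>. The parity
      of \<open>X\<close> decides which extreme occurs: if odd, both are \<open>r\<close> and the
      set is everything; if even, both are 0 and it is empty.\<close>
    have z: "a = 0" "b = 0" "m = 0" using *(1) Z(2) XY(1) by simp_all
    show ?thesis
    proof (cases "odd (card X)")
      case True
      then have "c = r" "d = r" using odds[OF XY(2)] * z by auto
      then have "cutset G (insert v X) = {}" "cutset H (insert w Y) = {}" using * z fin by auto
      then have "insert v X = verts G" "insert w Y = verts H"
        using is_rgraphD(6)[OF G, of "insert v X"] is_rgraphD(6)[OF H, of "insert w Y"] XY(2,3) v w by (blast+)
      then show ?thesis using XY(1-3) by (auto simp: glue_def)
    next
      case False
      then have "c = 0" "d = 0" using evens[OF XY(2,5)] * z r by auto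
      then have "cutset G X = {}" "cutset H Y = {}" using * z fin by auto
      then have "X = {}" "Y = {}"
        using is_rgraphD(6)[OF G, of X] is_rgraphD(6)[OF H, of Y] XY(2,3) v w by auto
      then show ?thesis using XY(1) by auto
    qed
  qed
  fix e assume e: "e \<in> arcs ?g"
  show "src ?g e \<in> verts ?g \<and> tgt ?g e \<in> verts ?g \<and> src ?g e \<noteq> tgt ?g e"
  proof (cases e)
    case (Inl d)
    then have d: "d \<in> arcs G" using e by (auto simp: glue_def)
    show ?thesis
    proof (cases "d \<in> cutset G {v}")
      case True
      then have "\<beta> d \<in> cutset H {w}" using \<beta> by (auto simp: bij_betw_def)
      then show ?thesis using Inl True other_end_props(1,2)[OF G True] other_end_props(1,2)[OF H] by (simp add: glue_def)
    next
      case False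
      then show ?thesis using Inl d is_rgraphD(5,9,10)[OF G d] by (auto simp: glue_def cutset_def)
    qed
  next
    case (Inr d)
    then show ?thesis using e is_rgraphD(5,9,10)[OF H, of d] by (auto simp: glue_def cutset_def)
  qed
qed (use is_rgraphD(7,8)[OF G] is_rgraphD(7,8)[OF H] in \<open>simp_all add: glue_simps\<close>)

text \<open>Only the stars at \<open>v\<close> and \<open>w\<close> are missing in the glued graph.
  Both are represented by the middle cut, which has \<open>r\<close> arcs and is odd because H has
  an even number of vertices, so colourings push it to a tight cut.\<close>

lemma glue_cut_coloring:
  assumes K: "is_graft r K" and f: "cut_coloring r K (glue G v H w \<beta>) f"
  shows "cut_coloring r K G (f \<circ> Inl)" "cut_coloring r K H (f \<circ> glue_inr G v H w \<beta>)"
proof -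
  let ?g = "glue G v H w \<beta>" and ?X = "Inr ` (verts H - {w}) :: ('a + 'c) set"
  have c: "card ?X = card (verts H) - 1" using w is_rgraphD(7)[OF H] by (simp add: card_image card_Diff_singleton)
  moreover have "card (verts H) > 0" using is_rgraphD(3,7)[OF H] by (simp add: card_gt_0_iff)
  ultimately have odd: "odd (card ?X)" using rgraph_even_verts[OF H r] by presburger
  have X: "?X \<subseteq> verts ?g" "finite ?X" using is_rgraphD(7)[OF H] by (auto simp: glue_def)
  have cX: "card (cutset ?g ?X) = r" using glue_cutset_middle(1) is_rgraphD(4)[OF G v] by (simp add: card_image)
  note p = cut_coloring_push[OF K is_rgraphD(8)[OF glue_rgraph] f X odd cX]
  show "cut_coloring r K G (f \<circ> Inl)" unfolding cut_coloring_def
  proof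
    fix x assume x: "x \<in> verts G"
    show "inj_on (f \<circ> Inl) (cutset G {x}) \<and> tight r K ((f \<circ> Inl) ` cutset G {x})"
    proof (cases "x = v")
      case True
      then show ?thesis using p unfolding glue_cutset_middle(1) by (intro star_comp) auto
    next
      case False
      then have "Inl x \<in> verts ?g" using x by (auto simp: glue_def)
      then have "inj_on f (cutset ?g {Inl x}) \<and> tight r K (f ` cutset ?g {Inl x})" using f by (auto simp: cut_coloring_def)
      then show ?thesis unfolding glue_cutset_inl[OF x False] by (intro star_comp) auto
    qed
  qed
  show "cut_coloring r K H (f \<circ> glue_inr G v H w \<beta>)" unfolding cut_coloring_def
  proof
    fix x assume x: "x \<in> verts H"
    show "inj_on (f \<circ> glue_inr G v H w \<beta>) (cutset H {x}) \<and> tight r K ((f \<circ> glue_inr G v H w \<beta>) ` cutset H {x})"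
    proof (cases "x = w")
      case True
      then show ?thesis using p unfolding glue_cutset_middle(2) by (intro star_comp glue_inr_inj) auto
    next
      case False
      then have "Inr x \<in> verts ?g" using x by (auto simp: glue_def)
      then have "inj_on f (cutset ?g {Inr x}) \<and> tight r K (f ` cutset ?g {Inr x})" using f by (auto simp: cut_coloring_def)
      then show ?thesis unfolding glue_cutset_inr[OF x False] by (intro star_comp glue_inr_inj) auto
    qed
  qed
qed

end

section \<open>Removing parallel arcs and combining r-graphs\<close>

definition covers :: "nat \<Rightarrow> ('w, 'c) graft \<Rightarrow> ('v, 'e) graft \<Rightarrow> bool" where
  "covers r K G \<longleftrightarrow> (\<exists>f. cut_coloring r K G f)"

definition complete_bipartite :: "nat \<Rightarrow> (nat + nat, nat \<times> nat) graft" where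
  "complete_bipartite r = \<lparr>verts = Inl ` {..<r} \<union> Inr ` {..<r}, arcs = {..<r} \<times> {..<r},
     src = Inl \<circ> fst, tgt = Inr \<circ> snd, terminals = Inl ` {..<r} \<union> Inr ` {..<r}\<rparr>"

lemma complete_bipartite_card:
  assumes "A \<subseteq> {..<r}" "B \<subseteq> {..<r}"
  shows "card (cutset (complete_bipartite r) (Inl ` A \<union> Inr ` B)) = card A * (r - card B) + (r - card A) * card B"
proof -
  have f: "finite A" "finite B" using assms finite_subset by blast+
  have "cutset (complete_bipartite r) (Inl ` A \<union> Inr ` B) = A \<times> ({..<r} - B) \<union> ({..<r} - A) \<times> B"
    using assms by (auto simp: cutset_def complete_bipartite_def)
  also have "card \<dots> = card (A \<times> ({..<r} - B)) + card (({..<r} - A) \<times> B)"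
    using f by (intro card_Un_disjoint) auto
  finally show ?thesis using f assms by (simp add: card_cartesian_product card_Diff_subset)
qed

text \<open>The expression is symmetric in \<open>a\<close> and \<open>b\<close>, and parity
  excludes equality. If \<open>a = b + 1 + c\<close> and \<open>r = a + d\<close>, it is at least
  \<open>(b + 1 + c) * (1 + c + d)\<close>, hence at least
  \<open>b + (1 + c + d) = r\<close>.\<close>

lemma complete_bipartite_cut_ineq:
  assumes "a \<le> r" "b \<le> r" "odd (a + b)"
  shows "(r::nat) \<le> a * (r - b) + (r - a) * b"
proof -
  have *: "r \<le> a * (r - b) + (r - a) * b" if ba: "b < a" and ar: "a \<le> r" for a b
  proof -
    obtain c where c: "a = b + 1 + c" using less_imp_Suc_add[OF ba] by auto
    obtain d where d: "r = a + d" using ar le_iff_add by blast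
    have "b * (1 + c + d) \<ge> b" by simp
    then show ?thesis unfolding c d by (simp add: algebra_simps)
  qed
  have "a \<noteq> b" using assms(3) by auto
  then show ?thesis using *[of b a] *[of a b] assms by (cases "b < a") (auto simp: mult.commute add.commute)
qed

text \<open>Supplies a simple r-graph for every positive \<open>r\<close>, both as the piece
  inserted at a vertex to remove parallel arcs and as a witness that r-graphs exist.\<close>

lemma complete_bipartite_rgraph:
  assumes "0 < r"
  shows "is_rgraph r (complete_bipartite r)"
proof (rule is_rgraphI)
  have sub: "\<exists>A B. X = Inl ` A \<union> Inr ` B \<and> A \<subseteq> {..<r} \<and> B \<subseteq> {..<r} \<and> card X = card A + card B"
    if X: "X \<subseteq> verts (complete_bipartite r)" for X
  proof (intro exI conjI)
    let ?A = "Inl -` X" and ?B = "Inr -` X"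
    show s: "?A \<subseteq> {..<r}" "?B \<subseteq> {..<r}" using X by (auto simp: complete_bipartite_def)
    have "x \<in> X \<longleftrightarrow> x \<in> Inl ` ?A \<union> Inr ` ?B" for x by (cases x) auto
    then show 1: "X = Inl ` ?A \<union> Inr ` ?B" by blast
    have "finite ?A" "finite ?B" using s finite_subset by blast+
    then have "card (Inl ` ?A \<union> Inr ` ?B) = card ?A + card ?B"
      by (subst card_Un_disjoint) (auto simp: card_image simp del: image_vimage_eq)
    then show "card X = card ?A + card ?B" using 1 by simp
  qed
  have le: "card A \<le> r" if "A \<subseteq> {..<r}" for A using card_mono[OF _ that] by simp
  show "r \<le> card (cutset (complete_bipartite r) X)" if X: "X \<subseteq> verts (complete_bipartite r)" "odd (card X)" for X
  proof -
    obtain A B where AB: "X = Inl ` A \<union> Inr ` B" "A \<subseteq> {..<r}" "B \<subseteq> {..<r}" "card X = card A + card B"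
      using sub[OF X(1)] by blast
    then show ?thesis using complete_bipartite_card[OF AB(2,3)] complete_bipartite_cut_ineq[OF le[OF AB(2)] le[OF AB(3)]] X(2) by simp
  qed
  show "X = {} \<or> X = verts (complete_bipartite r)" if X: "X \<subseteq> verts (complete_bipartite r)" "cutset (complete_bipartite r) X = {}" for X
  proof -
    obtain A B where AB: "X = Inl ` A \<union> Inr ` B" "A \<subseteq> {..<r}" "B \<subseteq> {..<r}"
      using sub[OF X(1)] by blast
    then have "card A * (r - card B) + (r - card A) * card B = 0" using complete_bipartite_card[OF AB(2,3)] X(2) by simp
    then have "(card A = 0 \<and> card B = 0) \<or> (card A = r \<and> card B = r)"
      using assms le[OF AB(2)] le[OF AB(3)] by auto
    moreover have "finite A" "finite B" using AB finite_subset by blast+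
    ultimately have "(A = {} \<and> B = {}) \<or> (A = {..<r} \<and> B = {..<r})"
      using card_subset_eq[OF _ AB(2)] card_subset_eq[OF _ AB(3)] by auto
    then show ?thesis using AB(1) by (auto simp: complete_bipartite_def)
  qed
  show "card (cutset (complete_bipartite r) {v}) = r" if "v \<in> verts (complete_bipartite r)" for v
    using that complete_bipartite_card[of "{_}" r "{}"] complete_bipartite_card[of "{}" r "{_}"] by (auto simp: complete_bipartite_def)
  show "verts (complete_bipartite r) \<noteq> {}" using assms by (auto simp: complete_bipartite_def)
qed (auto simp: complete_bipartite_def)

definition parallel_arcs :: "('v, 'e) graft \<Rightarrow> 'e set" where
  "parallel_arcs G = {e \<in> arcs G. \<exists>d\<in>arcs G. d \<noteq> e \<and> {src G d, tgt G d} = {src G e, tgt G e}}"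

text \<open>Two parallel joined arcs have the same end in H, so their halves in H would be parallel
  arcs at \<open>w\<close>. Arcs of different origin differ in the sides on which their ends lie.
  Hence only parallel arcs of G away from \<open>v\<close> remain.\<close>

lemma glue_parallel_arcs:
  assumes r: "0 < r" and G: "is_rgraph r G" and H: "is_rgraph r H"
    and v: "v \<in> verts G" and w: "w \<in> verts H"
    and \<beta>: "bij_betw \<beta> (cutset G {v}) (cutset H {w})"
    and simple: "parallel_arcs H = {}"
  shows "parallel_arcs (glue G v H w \<beta>) \<subseteq> Inl ` (parallel_arcs G - cutset G {v})"
proof
  let ?g = "glue G v H w \<beta>"
  fix x assume x: "x \<in> parallel_arcs ?g"
  then obtain y where y: "x \<in> arcs ?g" "y \<in> arcs ?g" "y \<noteq> x" "{src ?g y, tgt ?g y} = {src ?g x, tgt ?g x}"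
    by (auto simp: parallel_arcs_def)
  have arcs: "Inl e \<in> arcs ?g \<longleftrightarrow> e \<in> arcs G" "Inr d \<in> arcs ?g \<longleftrightarrow> d \<in> arcs H \<and> d \<notin> cutset H {w}" for e d
    unfolding glue_simps by auto
  show "x \<in> Inl ` (parallel_arcs G - cutset G {v})"
  proof (cases x)
    case (Inl e)
    then have e: "e \<in> arcs G" using y(1) arcs by simp
    obtain d where d: "y = Inl d" "d \<in> arcs G" 
      using y(2,4) Inl by (cases y) (auto simp: arcs glue_simps doubleton_eq_iff split: if_splits)
    have ne: "d \<noteq> e" using d(1) Inl y(3) by simp
    show ?thesis
    proof (cases "e \<in> cutset G {v}")
      case True
      then have "d \<in> cutset G {v}" "other_end H w (\<beta> d) = other_end H w (\<beta> e)"
        using y(4) unfolding Inl d(1) glue_simps by (auto simp: doubleton_eq_iff split: if_splits)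
      moreover from this have b: "\<beta> d \<in> cutset H {w}" "\<beta> e \<in> cutset H {w}" using True \<beta> by (auto simp: bij_betw_def)
      ultimately have "{src H (\<beta> d), tgt H (\<beta> d)} = {src H (\<beta> e), tgt H (\<beta> e)}"
        using other_end_props(4)[OF H b(1)] other_end_props(4)[OF H b(2)] by simp
      moreover have "\<beta> d \<noteq> \<beta> e" using ne True \<open>d \<in> cutset G {v}\<close> \<beta> by (auto simp: bij_betw_def inj_on_def)
      moreover have "\<beta> d \<in> arcs H" "\<beta> e \<in> arcs H" using b by (auto simp: cutset_def)
      ultimately have "\<beta> e \<in> parallel_arcs H" unfolding parallel_arcs_def by blast
      then show ?thesis using simple by simp
    next
      case False
      then have "{src G d, tgt G d} = {src G e, tgt G e}"
        using y(4) unfolding Inl d(1) glue_simps by (auto simp: doubleton_eq_iff split: if_splits)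
      then have "e \<in> parallel_arcs G" using e d(2) ne unfolding parallel_arcs_def by blast
      then show ?thesis using Inl False by blast
    qed
  next
    case (Inr e)
    then have e: "e \<in> arcs H" using y(1) arcs by simp
    obtain d where d: "y = Inr d" "d \<in> arcs H" 
      using y(2,4) Inr by (cases y) (auto simp: arcs glue_simps doubleton_eq_iff split: if_splits)
    have "{src H d, tgt H d} = {src H e, tgt H e}" using y(4) unfolding Inr d(1) glue_simps by (auto simp: doubleton_eq_iff)
    moreover have "d \<noteq> e" using d(1) Inr y(3) by simp
    ultimately have "e \<in> parallel_arcs H" using e d(2) unfolding parallel_arcs_def by blast
    then show ?thesis using simple by simp
  qed
qed

lemma relabel_parallel_arcs:
  assumes G: "is_rgraph r G" and i: "inj_on \<phi> (verts G)" "inj_on \<psi> (arcs G)"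
  shows "parallel_arcs (relabel \<phi> \<psi> G) \<subseteq> \<psi> ` parallel_arcs G"
proof
  let ?R = "relabel \<phi> \<psi> G"
  fix x assume "x \<in> parallel_arcs ?R"
  then obtain e d where ed: "x = \<psi> e" "e \<in> arcs G" "d \<in> arcs G" "\<psi> d \<noteq> \<psi> e"
    "{src ?R (\<psi> d), tgt ?R (\<psi> d)} = {src ?R (\<psi> e), tgt ?R (\<psi> e)}"
    unfolding parallel_arcs_def relabel_def by auto
  have ends: "{src ?R (\<psi> e), tgt ?R (\<psi> e)} = \<phi> ` {src G e, tgt G e}" if "e \<in> arcs G" for e
    using that i(2) by (simp add: relabel_def)
  have s: "{src G d, tgt G d} \<subseteq> verts G" "{src G e, tgt G e} \<subseteq> verts G"
    using is_rgraphD(9,10)[OF G] ed(2,3) by auto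
  have "{src G d, tgt G d} = {src G e, tgt G e}"
    using ed(5) unfolding ends[OF ed(2)] ends[OF ed(3)] inj_on_image_eq_iff[OF i(1) s] .
  moreover have "d \<noteq> e" using ed(4) by blast
  ultimately have "e \<in> parallel_arcs G" using ed(2,3) unfolding parallel_arcs_def by blast
  then show "x \<in> \<psi> ` parallel_arcs G" using ed(1) by blast
qed

text \<open>Each gluing produces sum types; renaming the result by natural numbers lets gluing be
  iterated in an induction.\<close>

lemma glue_nat:
  fixes G :: "('a, 'b) graft" and H :: "('c, 'd) graft"
  assumes r: "0 < r" and G: "is_rgraph r G" and H: "is_rgraph r H"
    and v: "v \<in> verts G" and w: "w \<in> verts H"
  shows "\<exists>G' :: (nat, nat) graft. is_rgraph r G' \<and>
     (\<forall>K :: ('w, 'e) graft. is_graft r K \<longrightarrow> covers r K G' \<longrightarrow> covers r K G \<and> covers r K H) \<and>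
     (parallel_arcs H = {} \<longrightarrow> card (parallel_arcs G') \<le> card (parallel_arcs G - cutset G {v}))"
proof -
  have "card (cutset G {v}) = card (cutset H {w})"
    using is_rgraphD(4) G H v w by metis
  then obtain \<beta> where \<beta>: "bij_betw \<beta> (cutset G {v}) (cutset H {w})"
    using finite_same_card_bij finite_cutset is_rgraphD(1) G H by metis
  let ?g = "glue G v H w \<beta>"
  note g = glue_rgraph[OF r G H v w \<beta>]
  obtain \<phi> :: "_ \<Rightarrow> nat" and \<psi> :: "_ \<Rightarrow> nat" where i: "inj_on \<phi> (verts ?g)" "inj_on \<psi> (arcs ?g)"
    using nat_injections[OF g] by blast
  let ?R = "relabel \<phi> \<psi> ?g"
  have "covers r K G \<and> covers r K H" if K: "is_graft r K" "covers r K ?R" for K :: "('w, 'e) graft"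
  proof -
    obtain f where "cut_coloring r K ?R f" using K(2) by (auto simp: covers_def)
    from relabel_cut_coloring[OF g i this] show ?thesis
      using glue_cut_coloring[OF r G H v w \<beta> K(1)] unfolding covers_def by blast
  qed
  moreover have "card (parallel_arcs ?R) \<le> card (parallel_arcs G - cutset G {v})" if "parallel_arcs H = {}"
  proof -
    have "finite (parallel_arcs G)" using is_rgraphD(8)[OF G] by (auto simp: parallel_arcs_def)
    then have "card (parallel_arcs ?R) \<le> card (\<psi> ` Inl ` (parallel_arcs G - cutset G {v}))"
      using subset_trans[OF relabel_parallel_arcs[OF g i] image_mono[OF glue_parallel_arcs[OF r G H v w \<beta> that]]]
      by (intro card_mono) auto
    also have "\<dots> \<le> card (parallel_arcs G - cutset G {v})"
      using \<open>finite (parallel_arcs G)\<close> by (metis card_image_le finite_Diff finite_imageI image_image)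
    finally show ?thesis .
  qed
  ultimately show ?thesis using relabel_rgraph[OF g i] by blast
qed

text \<open>Replacing a vertex by a copy of $K_{r,r}$ minus a vertex separates the parallel edges at
  that vertex.\<close>

lemma simplify:
  fixes G :: "(nat, nat) graft"
  assumes r: "0 < r" and G: "is_rgraph r G"
  shows "\<exists>G' :: (nat, nat) graft. is_rgraph r G' \<and> parallel_arcs G' = {} \<and>
     (\<forall>K :: ('w, 'e) graft. is_graft r K \<longrightarrow> covers r K G' \<longrightarrow> covers r K G)"
  using G
proof (induction "card (parallel_arcs G)" arbitrary: G rule: less_induct)
  case less
  note G = less.prems
  have fin: "finite (parallel_arcs G)" using is_rgraphD(8)[OF G] by (auto simp: parallel_arcs_def)
  show ?case
  proof (cases "parallel_arcs G = {}")
    case True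
    then show ?thesis using G by blast
  next
    case False
    then obtain e where e: "e \<in> parallel_arcs G" by blast
    then have ea: "e \<in> arcs G" by (auto simp: parallel_arcs_def)
    then have v: "src G e \<in> verts G" "e \<in> cutset G {src G e}"
      using is_rgraphD(5,9)[OF G ea] by (auto simp: cutset_def)
    have w: "Inl 0 \<in> verts (complete_bipartite r)" using r by (auto simp: complete_bipartite_def)
    have "parallel_arcs (complete_bipartite r) = {}" by (auto simp: parallel_arcs_def complete_bipartite_def)
    then obtain G1 :: "(nat, nat) graft" where G1: "is_rgraph r G1"
      "\<And>K :: ('w, 'e) graft. is_graft r K \<Longrightarrow> covers r K G1 \<Longrightarrow> covers r K G"
      "card (parallel_arcs G1) \<le> card (parallel_arcs G - cutset G {src G e})"
      using glue_nat[OF r G complete_bipartite_rgraph[OF r] v(1) w] by metis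
    have "card (parallel_arcs G - cutset G {src G e}) < card (parallel_arcs G)"
      using e v(2) fin by (intro psubset_card_mono) auto
    then show ?thesis using less.hyps[OF _ G1(1)] G1(2,3) by (meson le_less_trans)
  qed
qed

lemma combine:
  assumes r: "0 < r" and "finite A" "A \<noteq> {}" and "\<forall>G\<in>A. is_rgraph r (G :: (nat, nat) graft)"
  shows "\<exists>G' :: (nat, nat) graft. is_rgraph r G' \<and>
     (\<forall>K :: ('w, 'e) graft. is_graft r K \<longrightarrow> covers r K G' \<longrightarrow> (\<forall>G\<in>A. covers r K G))"
  using assms(2-4)
proof (induction A rule: finite_ne_induct)
  case (singleton x)
  then show ?case by auto
next
  case (insert x F)
  then obtain G1 :: "(nat, nat) graft" where G1: "is_rgraph r G1"
    "\<And>K :: ('w, 'e) graft. is_graft r K \<Longrightarrow> covers r K G1 \<Longrightarrow> \<forall>G\<in>F. covers r K G" by auto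
  have x: "is_rgraph r x" using insert.prems by simp
  obtain v w where "v \<in> verts x" "w \<in> verts G1" using is_rgraphD(3) x G1(1) by blast
  from glue_nat[OF r x G1(1) this] obtain G2 :: "(nat, nat) graft" where "is_rgraph r G2"
    "\<And>K :: ('w, 'e) graft. is_graft r K \<Longrightarrow> covers r K G2 \<Longrightarrow> covers r K x \<and> covers r K G1" by metis
  then show ?case using G1(2) by (metis insert_iff)
qed

text \<open>A definition cannot range over all types, so the graphs to be covered live on natural
  numbers; \<open>universal_covers\<close> removes the restriction by renaming.\<close>

definition universal :: "nat \<Rightarrow> ('v, 'e) graft \<Rightarrow> bool" where
  "universal r K \<longleftrightarrow> is_graft r K \<and> (\<forall>G :: (nat, nat) graft. is_rgraph r G \<longrightarrow> covers r K G)"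

lemma universal_covers:
  assumes "universal r K" "is_rgraph r G" shows "covers r K G"
proof -
  obtain \<phi> :: "_ \<Rightarrow> nat" and \<psi> :: "_ \<Rightarrow> nat" where i: "inj_on \<phi> (verts G)" "inj_on \<psi> (arcs G)"
    using nat_injections[OF assms(2)] by blast
  have "covers r K (relabel \<phi> \<psi> G)" using assms(1) relabel_rgraph[OF assms(2) i] by (auto simp: universal_def)
  then show ?thesis using relabel_cut_coloring[OF assms(2) i] unfolding covers_def by blast
qed

subsection \<open>Members of a finite family that cover all r-graphs\<close>

text \<open>The orientation is an arbitrary choice. This is harmless, since cuts are symmetric in
  the two ends of an arc.\<close>

definition graft_of :: "('v, 'e) multigraph \<Rightarrow> ('v, 'e) graft" where
  "graft_of G = \<lparr>verts = vertices G, arcs = edges G,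
     src = (\<lambda>e. SOME x. x \<in> ends G e), tgt = (\<lambda>e. SOME y. y \<in> ends G e \<and> y \<noteq> (SOME x. x \<in> ends G e)),
     terminals = vertices G\<rparr>"

definition multigraph_of :: "('v, 'e) graft \<Rightarrow> ('v, 'e) multigraph" where
  "multigraph_of G = \<lparr>vertices = verts G, edges = arcs G, ends = (\<lambda>e. {src G e, tgt G e})\<rparr>"

lemma graft_of_simps [simp]:
  "verts (graft_of G) = vertices G" "arcs (graft_of G) = edges G" "terminals (graft_of G) = vertices G"
  by (simp_all add: graft_of_def)

lemma graft_of_ends:
  assumes "wf_multigraph G" "e \<in> edges G"
  shows "ends G e = {src (graft_of G) e, tgt (graft_of G) e}" "src (graft_of G) e \<noteq> tgt (graft_of G) e"
proof -
  have "card (ends G e) = 2" using assms by (simp add: wf_multigraph_def)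
  then obtain a b where ab: "ends G e = {a, b}" "a \<noteq> b" unfolding card_2_iff by blast
  let ?s = "SOME x. x \<in> ends G e"
  have s: "?s \<in> ends G e" by (rule someI[of "\<lambda>x. x \<in> ends G e" a]) (simp add: ab(1))
  have "\<exists>y. y \<in> ends G e \<and> y \<noteq> ?s" by (cases "?s = a") (use ab in blast)+
  then have "(SOME y. y \<in> ends G e \<and> y \<noteq> ?s) \<in> ends G e \<and> (SOME y. y \<in> ends G e \<and> y \<noteq> ?s) \<noteq> ?s"
    by (rule someI_ex)
  with s have "src (graft_of G) e \<in> ends G e" "tgt (graft_of G) e \<in> ends G e" "tgt (graft_of G) e \<noteq> src (graft_of G) e"
    by (simp_all add: graft_of_def)
  then show "src (graft_of G) e \<noteq> tgt (graft_of G) e" "ends G e = {src (graft_of G) e, tgt (graft_of G) e}"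
    unfolding ab(1) by (metis, blast)
qed

lemma card_doubleton_Int: "a \<noteq> b \<Longrightarrow> card ({a, b} \<inter> X) = 1 \<longleftrightarrow> (a \<in> X) \<noteq> (b \<in> X)"
  by (cases "a \<in> X"; cases "b \<in> X") (auto simp: Int_insert_left)

lemma graft_of_cutset:
  assumes "wf_multigraph G" shows "cutset (graft_of G) X = edge_boundary G X"
  unfolding cutset_def edge_boundary_def graft_of_simps
  by (rule Collect_cong) (metis card_doubleton_Int graft_of_ends[OF assms])

lemma multigraph_of_boundary:
  assumes "\<And>e. e \<in> arcs G \<Longrightarrow> src G e \<noteq> tgt G e"
  shows "edge_boundary (multigraph_of G) X = cutset G X"
  using card_doubleton_Int[OF assms] unfolding cutset_def edge_boundary_def multigraph_of_def by auto

lemma graft_of_rgraph: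
  assumes H: "r_graph r H" "connected_multigraph H"
  shows "is_rgraph r (graft_of H)"
proof (rule is_rgraphI)
  have wf: "wf_multigraph H" using H(1) by (simp add: r_graph_def regular_multigraph_def)
  note c = graft_of_cutset[OF wf]
  show "finite (verts (graft_of H))" "finite (arcs (graft_of H))" using wf by (simp_all add: wf_multigraph_def)
  show "verts (graft_of H) \<noteq> {}" using H(2) by (simp add: connected_multigraph_def)
  show "card (cutset (graft_of H) {v}) = r" if "v \<in> verts (graft_of H)" for v
    using that H(1) unfolding c by (simp add: r_graph_def regular_multigraph_def)
  show "r \<le> card (cutset (graft_of H) X)" if "X \<subseteq> verts (graft_of H)" "odd (card X)" for X
    using that H(1) unfolding c by (simp add: r_graph_def)
  show "src (graft_of H) e \<in> verts (graft_of H) \<and> tgt (graft_of H) e \<in> verts (graft_of H) \<and> src (graft_of H) e \<noteq> tgt (graft_of H) e"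
    if e: "e \<in> arcs (graft_of H)" for e
  proof -
    have "ends H e \<subseteq> vertices H" using e wf by (simp add: wf_multigraph_def)
    then show ?thesis using graft_of_ends[OF wf, of e] e by simp
  qed
  show "X = {} \<or> X = verts (graft_of H)" if X: "X \<subseteq> verts (graft_of H)" "cutset (graft_of H) X = {}" for X
  proof (rule ccontr)
    assume "\<not> (X = {} \<or> X = verts (graft_of H))"
    then obtain u v where uv: "u \<in> X" "v \<in> vertices H" "v \<notin> X" using X(1) by auto
    then have "(u, v) \<in> (vertex_adjacency H)\<^sup>*" using H(2) X(1) by (auto simp: connected_multigraph_def)
    then have "v \<in> X"
    proof (induction rule: rtrancl_induct)
      case (step y z)
      then obtain e where e: "e \<in> edges H" "ends H e = {y, z}" by (auto simp: vertex_adjacency_def)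
      have "e \<notin> cutset (graft_of H) X" using X(2) by simp
      then show ?case using e(1) step.IH graft_of_ends(1)[OF wf e(1)] e(2) by (auto simp: cutset_def doubleton_eq_iff)
    qed (use uv in simp)
    then show False using uv by simp
  qed
qed simp

lemma multigraph_of_wf: "is_rgraph r G \<Longrightarrow> wf_multigraph (multigraph_of G)"
  using is_rgraphD[of r G] by (auto simp: wf_multigraph_def multigraph_of_def)

lemma multigraph_of_r_graph:
  assumes G: "is_rgraph r G"
  shows "r_graph r (multigraph_of G)" "connected_multigraph (multigraph_of G)"
    "parallel_arcs G = {} \<Longrightarrow> simple_multigraph (multigraph_of G)"
proof -
  have b: "edge_boundary (multigraph_of G) X = cutset G X" for X
    using multigraph_of_boundary is_rgraphD(5)[OF G] by metis
  show "r_graph r (multigraph_of G)"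
    using is_rgraphD(4,11)[OF G] multigraph_of_wf[OF G] unfolding r_graph_def regular_multigraph_def b
    by (simp add: multigraph_of_def)
  show "connected_multigraph (multigraph_of G)" unfolding connected_multigraph_def
  proof (intro conjI ballI)
    show "vertices (multigraph_of G) \<noteq> {}" using is_rgraphD(3)[OF G] by (simp add: multigraph_of_def)
    fix u v assume uv: "u \<in> vertices (multigraph_of G)" "v \<in> vertices (multigraph_of G)"
    let ?A = "vertex_adjacency (multigraph_of G)"
    let ?X = "{w \<in> verts G. (u, w) \<in> ?A\<^sup>*}"
    have "cutset G ?X = {}"
    proof (rule ccontr)
      assume "cutset G ?X \<noteq> {}"
      then obtain e where e: "e \<in> arcs G" "(src G e \<in> ?X) \<noteq> (tgt G e \<in> ?X)" by (auto simp: cutset_def)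
      have "(src G e, tgt G e) \<in> ?A" "(tgt G e, src G e) \<in> ?A"
        using e(1) by (auto simp: vertex_adjacency_def multigraph_of_def)
      then show False using e(2) is_rgraphD(9,10)[OF G e(1)] by (auto intro: rtrancl.rtrancl_into_rtrancl)
    qed
    moreover have "u \<in> ?X" using uv by (simp add: multigraph_of_def)
    ultimately have "?X = verts G" using is_rgraphD(6)[OF G, of ?X] by blast
    then show "(u, v) \<in> ?A\<^sup>*" using uv by (auto simp: multigraph_of_def)
  qed
  show "simple_multigraph (multigraph_of G)" if "parallel_arcs G = {}"
    using that unfolding simple_multigraph_def inj_on_def parallel_arcs_def multigraph_of_def by auto
qed

text \<open>Stars are tight, so an ordinary colouring is already one of the weaker kind; distinct
  colours on adjacent edges become injectivity on each star.\<close>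

lemma colors_covers:
  assumes H: "is_rgraph r (graft_of H)" "wf_multigraph H" and G: "is_rgraph r G" and c: "colors H (multigraph_of G)"
  shows "covers r (graft_of H) G"
proof -
  obtain f where f: "multigraph_coloring H (multigraph_of G) f" using c by (auto simp: colors_def)
  have "cut_coloring r (graft_of H) G f" unfolding cut_coloring_def
  proof (intro ballI conjI)
    fix v assume v: "v \<in> verts G"
    have b: "edge_boundary (multigraph_of G) X = cutset G X" for X
      using multigraph_of_boundary is_rgraphD(5)[OF G] by metis
    show "inj_on f (cutset G {v})"
    proof (rule inj_onI, rule ccontr)
      fix d e assume de: "d \<in> cutset G {v}" "e \<in> cutset G {v}" "f d = f e" "d \<noteq> e"
      then have "adjacent_edges (multigraph_of G) d e"
        by (auto simp: adjacent_edges_def multigraph_of_def cutset_def)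
      then show False using f de(3) by (simp add: multigraph_coloring_def)
    qed
    obtain u where "u \<in> vertices H" "f ` edge_boundary (multigraph_of G) {v} = edge_boundary H {u}"
      using f v by (auto simp: multigraph_coloring_def multigraph_of_def)
    then show "tight r (graft_of H) (f ` cutset G {v})"
      using star_tight[OF H(1), of u] graft_of_cutset[OF H(2)] unfolding b by simp
  qed
  then show ?thesis by (auto simp: covers_def)
qed

lemma iso_covers:
  assumes iso: "(H, H') \<in> multigraph_iso" and c: "covers r (graft_of H) G"
  shows "covers r (graft_of H') G"
proof -
  obtain \<phi> \<psi> where wf: "wf_multigraph H" "wf_multigraph H'"
    and b: "bij_betw \<phi> (vertices H) (vertices H')" "bij_betw \<psi> (edges H) (edges H')"
    and e: "\<And>e. e \<in> edges H \<Longrightarrow> ends H' (\<psi> e) = \<phi> ` ends H e"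
    using iso by (auto simp: multigraph_iso_def)
  have i: "inj_on \<phi> (vertices H)" "inj_on \<psi> (edges H)" using b by (auto simp: bij_betw_def)
  have bd: "edge_boundary H' (\<phi> ` X) = \<psi> ` edge_boundary H X" if X: "X \<subseteq> vertices H" for X
  proof -
    have "card (ends H' (\<psi> e) \<inter> \<phi> ` X) = card (ends H e \<inter> X)" if d: "e \<in> edges H" for e
    proof -
      have s: "ends H e \<subseteq> vertices H" using wf(1) d by (simp add: wf_multigraph_def)
      have "ends H' (\<psi> e) \<inter> \<phi> ` X = \<phi> ` (ends H e \<inter> X)"
        using inj_on_image_Int[OF i(1) s X] e[OF d] by simp
      then show ?thesis using card_image[OF inj_on_subset[OF i(1)], of "ends H e \<inter> X"] s by auto
    qed
    moreover have "edges H' = \<psi> ` edges H" using b(2) by (simp add: bij_betw_def)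
    ultimately show ?thesis by (auto simp: edge_boundary_def)
  qed
  have t: "tight r (graft_of H') (\<psi> ` S)" if S: "tight r (graft_of H) S" for S
  proof -
    obtain X where X: "X \<subseteq> vertices H" "odd (card X)" "S = edge_boundary H X" "card S = r"
      using S by (auto simp: tight_def odd_set_def graft_of_cutset[OF wf(1)] Int_absorb2)
    have "card (\<phi> ` X) = card X" using i(1) X(1) by (metis card_image inj_on_subset)
    moreover have "\<phi> ` X \<subseteq> vertices H'" using b(1) X(1) by (auto simp: bij_betw_def)
    moreover have "card (\<psi> ` S) = r" using X(3,4) i(2) 
      by (metis (no_types, lifting) card_image edge_boundary_def inj_on_subset mem_Collect_eq subsetI)
    ultimately show ?thesis using X bd[OF X(1)]
      unfolding tight_def odd_set_def graft_of_cutset[OF wf(2)] by (intro exI[of _ "\<phi> ` X"]) (auto simp: Int_absorb2)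
  qed
  obtain f where w: "cut_coloring r (graft_of H) G f" using c by (auto simp: covers_def)
  have "cut_coloring r (graft_of H') G (\<psi> \<circ> f)" unfolding cut_coloring_def
  proof
    fix v assume v: "v \<in> verts G"
    then have f: "inj_on f (cutset G {v})" "tight r (graft_of H) (f ` cutset G {v})" using w unfolding cut_coloring_def by blast+
    then have "f ` cutset G {v} \<subseteq> edges H" unfolding tight_def using cutset_subset[of "graft_of H"] by auto
    then have "inj_on (\<psi> \<circ> f) (cutset G {v})" using i(2) f(1) by (metis comp_inj_on inj_on_subset)
    then show "inj_on (\<psi> \<circ> f) (cutset G {v}) \<and> tight r (graft_of H') ((\<psi> \<circ> f) ` cutset G {v})"
      using t[OF f(2)] by (simp only: image_comp simp_thms)
  qed
  then show ?thesis by (auto simp: covers_def)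
qed

lemma nat_rgraph_exists: "0 < r \<Longrightarrow> \<exists>G :: (nat, nat) graft. is_rgraph r G"
  using nat_injections[OF complete_bipartite_rgraph] relabel_rgraph[OF complete_bipartite_rgraph] by metis

text \<open>If no member of a finite family covers everything, gluing together one uncovered graph for
  each member gives a single graph that no member covers.\<close>

lemma universal_member:
  fixes \<H> :: "('v, 'e) multigraph set"
  assumes r: "0 < r"
    and H: "\<And>H. H \<in> \<H> \<Longrightarrow> r_graph r H \<and> connected_multigraph H"
    and c: "\<And>G :: (nat, nat) multigraph.
           r_graph r G \<Longrightarrow> connected_multigraph G \<Longrightarrow> simple_multigraph G \<Longrightarrow> \<exists>H\<in>\<H>. colors H G"
    and fin: "finite (\<H> // multigraph_iso)"
  shows "\<exists>K :: ('v, 'e) graft. universal r K"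
proof (rule ccontr)
  assume no: "\<not> ?thesis"
  have rg: "is_rgraph r (graft_of H)" if "H \<in> \<H>" for H using graft_of_rgraph H[OF that] by blast
  have wf: "wf_multigraph H" if "H \<in> \<H>" for H using H[OF that] by (simp add: r_graph_def regular_multigraph_def)
  have "\<exists>G :: (nat, nat) graft. is_rgraph r G \<and> \<not> covers r (graft_of H) G" if "H \<in> \<H>" for H
    using no is_rgraphD(1)[OF rg[OF that]] by (auto simp: universal_def)
  then obtain g :: "('v, 'e) multigraph \<Rightarrow> (nat, nat) graft" where
    g: "\<And>H. H \<in> \<H> \<Longrightarrow> is_rgraph r (g H)" "\<And>H. H \<in> \<H> \<Longrightarrow> \<not> covers r (graft_of H) (g H)" by metis
  have "\<exists>h\<in>\<H>. C = multigraph_iso `` {h}" if "C \<in> \<H> // multigraph_iso" for C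
    using that by (auto simp: quotient_def)
  then obtain h where h: "\<And>C. C \<in> \<H> // multigraph_iso \<Longrightarrow> h C \<in> \<H>"
    "\<And>C. C \<in> \<H> // multigraph_iso \<Longrightarrow> C = multigraph_iso `` {h C}" by metis
  have col: "\<exists>H\<in>\<H>. covers r (graft_of H) G" if G: "is_rgraph r G" "parallel_arcs G = {}" for G :: "(nat, nat) graft"
    using c[OF multigraph_of_r_graph(1,2)[OF G(1)] multigraph_of_r_graph(3)[OF G]] colors_covers[OF rg wf G(1)] by blast
  let ?A = "(\<lambda>C. g (h C)) ` (\<H> // multigraph_iso)"
  \<comment> \<open>The set passed to \<open>combine\<close> must be nonempty: an empty family would
    leave even this graph, made simple, without a colouring.\<close>
  obtain G0 :: "(nat, nat) graft" where "is_rgraph r G0" using nat_rgraph_exists[OF r] by blast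
  then have "\<H> \<noteq> {}" using simplify[OF r] col by blast
  then have "finite ?A" "?A \<noteq> {}" "\<forall>G\<in>?A. is_rgraph r G"
    using fin g(1)[OF h(1)] by (auto dest: quotientI)
  from combine[OF r this] obtain G1 :: "(nat, nat) graft" where G1: "is_rgraph r G1"
    "\<And>K :: ('v, 'e) graft. is_graft r K \<Longrightarrow> covers r K G1 \<Longrightarrow> \<forall>G\<in>?A. covers r K G" by blast
  \<comment> \<open>The family is only assumed to colour simple graphs, so the combined graph is
    made simple; whatever covers the result still covers \<open>G1\<close>.\<close>
  obtain G2 :: "(nat, nat) graft" where G2: "is_rgraph r G2" "parallel_arcs G2 = {}"
    "\<And>K :: ('v, 'e) graft. is_graft r K \<Longrightarrow> covers r K G2 \<Longrightarrow> covers r K G1"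
    using simplify[OF r G1(1)] by metis
  obtain H where H: "H \<in> \<H>" "covers r (graft_of H) G2" using col[OF G2(1,2)] by blast
  let ?C = "multigraph_iso `` {H}"
  have C: "?C \<in> \<H> // multigraph_iso" using H(1) by (rule quotientI)
  have "(H, H) \<in> multigraph_iso" using wf[OF H(1)] equiv_multigraph_iso
    by (metis equiv_def mem_Collect_eq refl_onD)
  then have "(h ?C, H) \<in> multigraph_iso" using h(2)[OF C] by blast
  then have "(H, h ?C) \<in> multigraph_iso" using equiv_multigraph_iso by (meson equiv_def symD)
  then have "covers r (graft_of (h ?C)) G2" using iso_covers H(2) by blast
  then have "covers r (graft_of (h ?C)) (g (h ?C))"
    using G1(2) G2(3) is_rgraphD(1)[OF rg[OF h(1)[OF C]]] C by blast
  then show False using g(2)[OF h(1)[OF C]] by blast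
qed

subsection \<open>Minimal universal grafts\<close>

lemma tight_subset: "tight r K S \<Longrightarrow> S \<subseteq> arcs K"
  by (auto simp: tight_def cutset_def)

section \<open>Submodular inequalities for cuts\<close>

lemma card_cutset_sum:
  "finite (arcs K) \<Longrightarrow> card (cutset K X) = (\<Sum>e\<in>arcs K. of_bool ((src K e \<in> X) \<noteq> (tgt K e \<in> X)))"
  unfolding cutset_def by (rule card_filter_sum)

lemma cutset_submodular:
  assumes "finite (arcs K)"
  shows "card (cutset K (X \<inter> Y)) + card (cutset K (X \<union> Y)) \<le> card (cutset K X) + card (cutset K Y)"
  unfolding card_cutset_sum[OF assms] sum.distrib[symmetric] by (rule sum_mono) auto

text \<open>The summand 2 comes from the arc \<open>e\<close>: it joins the intersection to the
  outside of the union, so both cuts on the right contain it and neither cut on the left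
  does.\<close>

lemma cutset_posimodular:
  assumes "finite (arcs K)" and e: "e \<in> arcs K" "{src K e, tgt K e} = {a, b}" "a \<in> X \<inter> Y" "b \<notin> X \<union> Y"
  shows "card (cutset K (X - Y)) + card (cutset K (Y - X)) + 2 \<le> card (cutset K X) + card (cutset K Y)"
proof -
  have "(\<Sum>d\<in>arcs K. if d = e then 2 else 0) = (2 :: nat)" using assms(1) e(1) by simp
  then have "card (cutset K (X - Y)) + card (cutset K (Y - X)) + 2 =
    (\<Sum>d\<in>arcs K. of_bool ((src K d \<in> X - Y) \<noteq> (tgt K d \<in> X - Y)) + of_bool ((src K d \<in> Y - X) \<noteq> (tgt K d \<in> Y - X)) + (if d = e then 2 else 0))"
    unfolding card_cutset_sum[OF assms(1)] sum.distrib by simp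
  also have "\<dots> \<le> (\<Sum>d\<in>arcs K. of_bool ((src K d \<in> X) \<noteq> (tgt K d \<in> X)) + of_bool ((src K d \<in> Y) \<noteq> (tgt K d \<in> Y)))"
  proof (rule sum_mono)
    fix d
    have *: "of_bool ((a \<in> X - Y) \<noteq> (b \<in> X - Y)) + of_bool ((a \<in> Y - X) \<noteq> (b \<in> Y - X))
      \<le> (of_bool ((a \<in> X) \<noteq> (b \<in> X)) + of_bool ((a \<in> Y) \<noteq> (b \<in> Y)) :: nat)" for a b
      by auto
    show "of_bool ((src K d \<in> X - Y) \<noteq> (tgt K d \<in> X - Y)) + of_bool ((src K d \<in> Y - X) \<noteq> (tgt K d \<in> Y - X)) + (if d = e then 2 else 0)
      \<le> (of_bool ((src K d \<in> X) \<noteq> (tgt K d \<in> X)) + of_bool ((src K d \<in> Y) \<noteq> (tgt K d \<in> Y)) :: nat)"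
    proof (cases "d = e")
      case True
      have "src K e = a \<and> tgt K e = b \<or> src K e = b \<and> tgt K e = a" using e(2) by (simp add: doubleton_eq_iff)
      then show ?thesis using e(3,4) True by auto
    qed (use * in simp)
  qed
  finally show ?thesis unfolding card_cutset_sum[OF assms(1)] sum.distrib .
qed

text \<open>The new vertex is a terminal iff exactly one of \<open>x\<close> and \<open>y\<close>
  was. With this choice the odd sets of the result correspond to the odd sets of K that do not
  separate \<open>x\<close> from \<open>y\<close>, with the same cuts.\<close>

definition merge :: "'v \<Rightarrow> 'v \<Rightarrow> ('v, 'e) graft \<Rightarrow> ('v, 'e) graft" where
  "merge x y K = \<lparr>verts = verts K - {y}, arcs = arcs K,
     src = (\<lambda>e. if src K e = y then x else src K e), tgt = (\<lambda>e. if tgt K e = y then x else tgt K e),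
     terminals = terminals K - {x, y} \<union> (if (x \<in> terminals K) \<noteq> (y \<in> terminals K) then {x} else {})\<rparr>"

lemma merge_cutset:
  assumes "x \<noteq> y" "x \<in> X \<longleftrightarrow> y \<in> X"
  shows "cutset (merge x y K) (X - {y}) = cutset K X"
  using assms by (auto simp: cutset_def merge_def)

lemma merge_odd_set:
  assumes K: "is_graft r K" and xy: "x \<in> verts K" "y \<in> verts K" "x \<noteq> y" "x \<in> X \<longleftrightarrow> y \<in> X" and X: "X \<subseteq> verts K"
  shows "odd_set (merge x y K) (X - {y}) \<longleftrightarrow> odd_set K X"
proof -
  let ?Z = "X \<inter> terminals K - {x, y}"
  have f: "finite ?Z" using is_graftD(8)[OF K] by simp
  have "X \<inter> terminals K = ?Z \<union> (X \<inter> terminals K \<inter> {x, y})" by auto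
  then have "card (X \<inter> terminals K) = card (?Z \<union> (X \<inter> terminals K \<inter> {x, y}))" by simp
  also have "\<dots> = card ?Z + card (X \<inter> terminals K \<inter> {x, y})" by (rule card_Un_disjoint) (use f in auto)
  finally have 1: "card (X \<inter> terminals K) = card ?Z + card (X \<inter> terminals K \<inter> {x, y})" .
  have "(X - {y}) \<inter> terminals (merge x y K) = ?Z \<union> (if x \<in> X \<and> (x \<in> terminals K) \<noteq> (y \<in> terminals K) then {x} else {})"
    using xy by (auto simp: merge_def)
  then have 2: "card ((X - {y}) \<inter> terminals (merge x y K)) = card ?Z + (if x \<in> X \<and> (x \<in> terminals K) \<noteq> (y \<in> terminals K) then 1 else 0)"
    using f by auto
  have "odd (card (X \<inter> terminals K \<inter> {x, y})) \<longleftrightarrow> x \<in> X \<and> (x \<in> terminals K) \<noteq> (y \<in> terminals K)"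
    using xy(3,4) by (cases "x \<in> X"; cases "x \<in> terminals K"; cases "y \<in> terminals K") (auto simp: Int_insert_right)
  then have "odd (card ((X - {y}) \<inter> terminals (merge x y K))) \<longleftrightarrow> odd (card (X \<inter> terminals K))"
    unfolding 1 2 by auto
  moreover have "X - {y} \<subseteq> verts (merge x y K)" using X by (auto simp: merge_def)
  ultimately show ?thesis using X by (simp add: odd_set_def)
qed

lemma merge_graft:
  assumes K: "is_graft r K" and xy: "x \<in> verts K" "y \<in> verts K" "x \<noteq> y"
  shows "is_graft r (merge x y K)"
proof -
  \<comment> \<open>Every vertex set of the merged graft comes from one of K that treats
    \<open>x\<close> and \<open>y\<close> alike, so both conditions on cuts are inherited from
    K.\<close>
  have lift: "\<exists>X. X' = X - {y} \<and> X \<subseteq> verts K \<and> (x \<in> X \<longleftrightarrow> y \<in> X)" if X': "X' \<subseteq> verts K - {y}" for X'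
    by (rule exI[of _ "if x \<in> X' then insert y X' else X'"]) (use X' xy in auto)
  have "r \<le> card (cutset (merge x y K) X')" if o: "odd_set (merge x y K) X'" for X'
  proof -
    have "X' \<subseteq> verts K - {y}" using o by (simp add: odd_set_def merge_def)
    from lift[OF this] obtain X where X: "X' = X - {y}" "X \<subseteq> verts K" "x \<in> X \<longleftrightarrow> y \<in> X" by (elim exE conjE)
    then have "odd_set K X" using merge_odd_set[OF K xy X(3,2)] o by simp
    then show ?thesis using is_graftD(6)[OF K] merge_cutset[OF xy(3) X(3), of K] X(1) by simp
  qed
  moreover have "odd (card (cutset (merge x y K) {v})) \<longleftrightarrow> odd r \<and> v \<in> terminals (merge x y K)"
    if v: "v \<in> verts K - {y}" for v
  proof -
    have "{v} \<subseteq> verts K - {y}" using v by simp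
    from lift[OF this] obtain X where X: "{v} = X - {y}" "X \<subseteq> verts K" "x \<in> X \<longleftrightarrow> y \<in> X" by (elim exE conjE)
    have "odd (card (cutset K X)) \<longleftrightarrow> odd r \<and> odd_set K X"
      using cutset_parity[OF K X(2)] X(2) by (simp add: odd_set_def)
    also have "odd_set K X \<longleftrightarrow> odd_set (merge x y K) {v}" using merge_odd_set[OF K xy X(3,2)] X(1) by simp
    also have "\<dots> \<longleftrightarrow> v \<in> terminals (merge x y K)"
    proof -
      have "v \<in> verts (merge x y K)" using v by (simp add: merge_def)
      then show ?thesis by (cases "v \<in> terminals (merge x y K)") (simp_all add: odd_set_def)
    qed
    finally show ?thesis using merge_cutset[OF xy(3) X(3), of K] X(1) by simp
  qed
  ultimately show ?thesis using is_graftD[OF K] xy unfolding is_graft_def by (auto simp: merge_def)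
qed

text \<open>Competitors of the same type suffice, because identifying vertices, deleting loops and
  splitting off all keep the types. Counting vertices and arcs together makes each of these
  operations a decrease.\<close>

definition minimal_universal :: "nat \<Rightarrow> ('v, 'e) graft \<Rightarrow> bool" where
  "minimal_universal r K \<longleftrightarrow> universal r K \<and>
     (\<forall>K' :: ('v, 'e) graft. universal r K' \<longrightarrow> card (verts K) + card (arcs K) \<le> card (verts K') + card (arcs K'))"

lemma minimal_universal_exists: "universal r (K :: ('v, 'e) graft) \<Longrightarrow> \<exists>K :: ('v, 'e) graft. minimal_universal r K"
  using exists_least_iff[of "\<lambda>n. \<exists>K :: ('v, 'e) graft. universal r K \<and> card (verts K) + card (arcs K) = n"]
  unfolding minimal_universal_def by (metis not_le)

text \<open>Otherwise x and y could be identified.\<close>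

lemma minimal_not_mergeable:
  assumes m: "minimal_universal r K" and xy: "x \<in> verts K" "y \<in> verts K" "x \<noteq> y"
    and G: "\<And>G :: (nat, nat) graft. is_rgraph r G \<Longrightarrow> \<exists>f. \<forall>v\<in>verts G. inj_on f (cutset G {v}) \<and>
      (\<exists>X. odd_set K X \<and> (x \<in> X \<longleftrightarrow> y \<in> X) \<and> f ` cutset G {v} = cutset K X \<and> card (cutset K X) = r)"
  shows False
proof -
  have K: "is_graft r K" using m by (simp add: minimal_universal_def universal_def)
  have "covers r (merge x y K) G" if rg: "is_rgraph r G" for G :: "(nat, nat) graft"
  proof -
    obtain f where f: "\<And>v. v \<in> verts G \<Longrightarrow> inj_on f (cutset G {v}) \<and>
      (\<exists>X. odd_set K X \<and> (x \<in> X \<longleftrightarrow> y \<in> X) \<and> f ` cutset G {v} = cutset K X \<and> card (cutset K X) = r)"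
      using G[OF rg] by blast
    have "cut_coloring r (merge x y K) G f" unfolding cut_coloring_def
    proof (intro ballI conjI)
      fix v assume "v \<in> verts G"
      from f[OF this] obtain X where X: "inj_on f (cutset G {v})" "odd_set K X" "x \<in> X \<longleftrightarrow> y \<in> X"
        "f ` cutset G {v} = cutset K X" "card (cutset K X) = r" by blast
      show "inj_on f (cutset G {v})" by fact
      have "X \<subseteq> verts K" using X(2) by (simp add: odd_set_def)
      then show "tight r (merge x y K) (f ` cutset G {v})"
        using X merge_odd_set[OF K xy X(3)] merge_cutset[OF xy(3) X(3), of K] unfolding tight_def by metis
    qed
    then show ?thesis by (auto simp: covers_def)
  qed
  then have "universal r (merge x y K)" using merge_graft[OF K xy] by (simp add: universal_def)
  then have "card (verts K) + card (arcs K) \<le> card (verts K - {y}) + card (arcs K)"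
    using m by (auto simp: minimal_universal_def merge_def)
  moreover have "card (verts K - {y}) < card (verts K)" using xy(2) is_graftD(1)[OF K] by (rule card_Diff1_less[rotated])
  ultimately show False by simp
qed

text \<open>A set with empty cut contains an even number of terminals, so taking the symmetric
  difference with it changes neither the cut nor the parity of an odd set. Thus every tight cut
  comes from a set that does not separate a chosen vertex inside \<open>X\<close> from one outside,
  and the two could be identified.\<close>

lemma minimal_connected:
  assumes r: "0 < r" and m: "minimal_universal r K" and X: "X \<subseteq> verts K" "cutset K X = {}"
  shows "X = {} \<or> X = verts K"
proof (rule ccontr)
  assume "\<not> ?thesis"
  then obtain x y where xy: "x \<in> X" "y \<in> verts K" "y \<notin> X" using X(1) by blast
  have K: "is_graft r K" using m by (simp add: minimal_universal_def universal_def)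
  have ev: "even (card (X \<inter> terminals K))"
    using is_graftD(6)[OF K, of X] X r by (auto simp: odd_set_def)
  show False
  proof (rule minimal_not_mergeable[OF m, of x y])
    show "x \<in> verts K" "y \<in> verts K" "x \<noteq> y" using xy X(1) by auto
    fix G :: "(nat, nat) graft" assume "is_rgraph r G"
    then obtain f where f: "cut_coloring r K G f" using m by (auto simp: minimal_universal_def universal_def covers_def)
    have "\<exists>Z. odd_set K Z \<and> (x \<in> Z \<longleftrightarrow> y \<in> Z) \<and> S = cutset K Z \<and> card (cutset K Z) = r" if S: "tight r K S" for S
    proof -
      obtain Y where Y: "odd_set K Y" "S = cutset K Y" "card S = r" using S by (auto simp: tight_def)
      show ?thesis
      proof (cases "x \<in> Y \<longleftrightarrow> y \<in> Y")
        case True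
        then show ?thesis using Y by blast
      next
        case False
        let ?Z = "{z \<in> verts K. (z \<in> Y) \<noteq> (z \<in> X)}"
        have "cutset K ?Z = cutset K Y"
        proof -
          have "(src K e \<in> X) = (tgt K e \<in> X)" if "e \<in> arcs K" for e using X(2) that by (auto simp: cutset_def)
          then show ?thesis using is_graftD(3,4)[OF K] by (auto simp: cutset_def)
        qed
        moreover have "odd_set K ?Z"
        proof -
          have "odd (card {z \<in> terminals K. (z \<in> Y) \<noteq> (z \<in> X)})"
            using odd_card_filter_neq[OF is_graftD(8)[OF K], of "\<lambda>z. z \<in> Y" "\<lambda>z. z \<in> X"] Y(1) ev
            by (simp add: odd_set_def Int_def conj_commute)
          moreover have "?Z \<inter> terminals K = {z \<in> terminals K. (z \<in> Y) \<noteq> (z \<in> X)}" using is_graftD(5)[OF K] by blast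
          ultimately have "odd (card (?Z \<inter> terminals K))" by simp
          then show ?thesis by (auto simp: odd_set_def)
        qed
        moreover have "x \<in> ?Z \<longleftrightarrow> y \<in> ?Z" using xy X(1) False by auto
        ultimately show ?thesis using Y by (intro exI[of _ ?Z]) simp
      qed
    qed
    then show "\<exists>f. \<forall>v\<in>verts G. inj_on f (cutset G {v}) \<and>
      (\<exists>X. odd_set K X \<and> (x \<in> X \<longleftrightarrow> y \<in> X) \<and> f ` cutset G {v} = cutset K X \<and> card (cutset K X) = r)"
      using f unfolding cut_coloring_def by blast
  qed
qed

text \<open>If an arc were missed by \<open>g\<close>, colourings followed by \<open>g\<close> would
  never use it. The tight cuts that arise would not separate its ends, which could then be
  identified.\<close>

lemma minimal_endo_surj:
  assumes m: "minimal_universal r K" and R: "is_rgraph r K" and g: "cut_coloring r K K g"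
  shows "bij_betw g (arcs K) (arcs K)"
proof -
  have K: "is_graft r K" using m by (simp add: minimal_universal_def universal_def)
  have sub: "g ` arcs K \<subseteq> arcs K"
  proof (rule image_subsetI)
    fix e assume e: "e \<in> arcs K"
    then have "e \<in> cutset K {src K e}" using is_rgraphD(5)[OF R e] by (simp add: cutset_def)
    moreover have "tight r K (g ` cutset K {src K e})" using g is_rgraphD(9)[OF R e] by (simp add: cut_coloring_def)
    ultimately show "g e \<in> arcs K" by (meson imageI subsetD tight_subset)
  qed
  moreover have "arcs K \<subseteq> g ` arcs K"
  proof (rule ccontr)
    assume "\<not> ?thesis"
    then obtain e where e: "e \<in> arcs K" "e \<notin> g ` arcs K" by blast
    show False
    proof (rule minimal_not_mergeable[OF m])
      show "src K e \<in> verts K" "tgt K e \<in> verts K" "src K e \<noteq> tgt K e"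
        using is_rgraphD(5,9,10)[OF R e(1)] by auto
      fix G :: "(nat, nat) graft" assume "is_rgraph r G"
      then obtain f where f: "cut_coloring r K G f" using m by (auto simp: minimal_universal_def universal_def covers_def)
      have w: "cut_coloring r K G (g \<circ> f)" using cut_coloring_comp[OF K R g f] .
      have "\<forall>v\<in>verts G. inj_on (g \<circ> f) (cutset G {v}) \<and> (\<exists>X. odd_set K X \<and> (src K e \<in> X \<longleftrightarrow> tgt K e \<in> X) \<and>
         (g \<circ> f) ` cutset G {v} = cutset K X \<and> card (cutset K X) = r)"
      proof (intro ballI conjI)
        fix v assume v: "v \<in> verts G"
        then show "inj_on (g \<circ> f) (cutset G {v})" using w by (simp add: cut_coloring_def)
        obtain X where X: "odd_set K X" "(g \<circ> f) ` cutset G {v} = cutset K X" "card (cutset K X) = r"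
          using w v unfolding cut_coloring_def tight_def by metis
        have "tight r K (f ` cutset G {v})" using f v by (simp add: cut_coloring_def)
        then have "(g \<circ> f) ` cutset G {v} \<subseteq> g ` arcs K" unfolding image_comp[symmetric] by (intro image_mono tight_subset)
        then have "e \<notin> cutset K X" using e(2) X(2) by blast
        then have "src K e \<in> X \<longleftrightarrow> tgt K e \<in> X" using e(1) by (simp add: cutset_def)
        with X show "\<exists>X. odd_set K X \<and> (src K e \<in> X \<longleftrightarrow> tgt K e \<in> X) \<and>
         (g \<circ> f) ` cutset G {v} = cutset K X \<and> card (cutset K X) = r" by blast
      qed
      then show "\<exists>f. \<forall>v\<in>verts G. inj_on f (cutset G {v}) \<and> (\<exists>X. odd_set K X \<and> (src K e \<in> X \<longleftrightarrow> tgt K e \<in> X) \<and>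
         f ` cutset G {v} = cutset K X \<and> card (cutset K X) = r)" by blast
    qed
  qed
  ultimately have eq: "g ` arcs K = arcs K" by blast
  then show ?thesis using is_rgraphD(8)[OF R] by (simp add: bij_betw_def eq_card_imp_inj_on)
qed

text \<open>A loop lies in no cut, so deleting it would leave a smaller universal graft.\<close>

lemma minimal_loopless:
  assumes m: "minimal_universal r K" and e: "e \<in> arcs K" shows "src K e \<noteq> tgt K e"
proof
  assume l: "src K e = tgt K e"
  have K: "is_graft r K" using m by (simp add: minimal_universal_def universal_def)
  let ?K = "K\<lparr>arcs := arcs K - {e}\<rparr>"
  have c: "cutset ?K X = cutset K X" for X using l by (auto simp: cutset_def)
  have o: "odd_set ?K X = odd_set K X" for X by (simp add: odd_set_def)
  have t: "tight r ?K = tight r K" by (simp add: tight_def[abs_def] c o)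
  have "is_graft r ?K" using K by (auto simp: is_graft_def c o)
  then have "universal r ?K" using m by (simp add: minimal_universal_def universal_def covers_def cut_coloring_def t)
  then have "card (verts ?K) + card (arcs ?K) \<ge> card (verts K) + card (arcs K)" using m unfolding minimal_universal_def by blast
  moreover have "card (arcs K - {e}) < card (arcs K)" using e is_graftD(2)[OF K] by (rule card_Diff1_less[rotated])
  ultimately show False by simp
qed

text \<open>The arcs \<open>d\<close> and \<open>e\<close> at \<open>s\<close> become one arc
  between their other ends, under the name \<open>d\<close>. It is a loop if they were parallel. A
  cut with both arcs loses both; any other cut keeps its size, with \<open>e\<close> renamed to
  \<open>d\<close>.\<close>

definition split_off :: "'v \<Rightarrow> 'e \<Rightarrow> 'e \<Rightarrow> ('v, 'e) graft \<Rightarrow> ('v, 'e) graft" where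
  "split_off s d e K = K\<lparr>arcs := arcs K - {e}, src := (src K)(d := other_end K s d), tgt := (tgt K)(d := other_end K s e)\<rparr>"

lemma cutset_other_end:
  assumes "e \<in> cutset K {s}" shows "e \<in> cutset K X \<longleftrightarrow> (s \<in> X) \<noteq> (other_end K s e \<in> X)"
  using assms by (auto simp: cutset_def other_end_def)

lemma split_off_cutset:
  assumes "d \<in> cutset K {s}" "e \<in> cutset K {s}" "d \<noteq> e"
  shows "cutset (split_off s d e K) X =
    (if d \<in> cutset K X \<and> e \<in> cutset K X then cutset K X - {d, e} else (\<lambda>x. if x = e then d else x) ` cutset K X)"
proof -
  have 1: "d \<in> cutset (split_off s d e K) X \<longleftrightarrow> (d \<in> cutset K X) \<noteq> (e \<in> cutset K X)"
  proof -
    have "d \<in> arcs K" using assms(1) by (simp add: cutset_def)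
    then have "d \<in> cutset (split_off s d e K) X \<longleftrightarrow> (other_end K s d \<in> X) \<noteq> (other_end K s e \<in> X)"
      using assms(3) by (simp add: cutset_def split_off_def)
    then show ?thesis unfolding cutset_other_end[OF assms(1)] cutset_other_end[OF assms(2)] by blast
  qed
  have 2: "x \<in> cutset (split_off s d e K) X \<longleftrightarrow> x \<in> cutset K X \<and> x \<noteq> e" if "x \<noteq> d" for x
    using that by (auto simp: cutset_def split_off_def)
  show ?thesis
  proof (rule set_eqI)
    fix x show "x \<in> cutset (split_off s d e K) X \<longleftrightarrow> x \<in> (if d \<in> cutset K X \<and> e \<in> cutset K X then cutset K X - {d, e} else (\<lambda>x. if x = e then d else x) ` cutset K X)"
      using 1 2[of x] assms(3) by (cases "x = d") (auto simp: image_iff split: if_splits)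
  qed
qed

text \<open>Suppose no tight cut contains both arcs. Odd cuts that contain both then have at least
  \<open>r + 2\<close> arcs by parity and keep at least \<open>r\<close>, while every tight cut
  stays tight after renaming \<open>e\<close> to \<open>d\<close>. The result would be universal
  with one arc fewer.\<close>

lemma split_off_minimal:
  assumes r: "0 < r" and m: "minimal_universal r K" and s: "s \<in> verts K"
    and de: "d \<in> cutset K {s}" "e \<in> cutset K {s}" "d \<noteq> e"
  shows "\<exists>X. odd_set K X \<and> card (cutset K X) = r \<and> d \<in> cutset K X \<and> e \<in> cutset K X"
proof (rule ccontr)
  assume no: "\<not> ?thesis"
  have K: "is_graft r K" using m by (simp add: minimal_universal_def universal_def)
  let ?K = "split_off s d e K" and ?\<rho> = "\<lambda>x. if x = e then d else x"
  note c = split_off_cutset[OF de]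
  have inj: "inj_on ?\<rho> S" if "\<not> (d \<in> S \<and> e \<in> S)" for S using that by (auto simp: inj_on_def)
  have cc: "card (cutset ?K X) = (if d \<in> cutset K X \<and> e \<in> cutset K X then card (cutset K X) - 2 else card (cutset K X))" for X
  proof (cases "d \<in> cutset K X \<and> e \<in> cutset K X")
    case True
    then show ?thesis using de(3) finite_cutset[OF K] unfolding c by (simp add: card_Diff_subset)
  next
    case False
    show ?thesis unfolding c if_not_P[OF False] by (rule card_image[OF inj[OF False]])
  qed
  have two: "2 \<le> card (cutset K X)" if "d \<in> cutset K X" "e \<in> cutset K X" for X
    using card_mono[OF finite_cutset[OF K], of "{d, e}" X] that de(3) by simp
  have o: "odd_set ?K X = odd_set K X" for X by (simp add: odd_set_def split_off_def)
  have oc: "odd (card (cutset ?K X)) = odd (card (cutset K X))" for X using cc[of X] two[of X] by auto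
  have "r \<le> card (cutset ?K X)" if X: "odd_set K X" for X
  proof -
    have "r \<le> card (cutset K X)" using is_graftD(6)[OF K X] .
    moreover have "card (cutset K X) \<noteq> r" if "d \<in> cutset K X" "e \<in> cutset K X" using no X that by blast
    moreover have "odd (card (cutset K X)) = odd r" using X cutset_parity[OF K, of X] by (auto simp: odd_set_def)
    ultimately show ?thesis unfolding cc by (auto; presburger)
  qed
  moreover have "src ?K x \<in> verts K \<and> tgt ?K x \<in> verts K" if "x \<in> arcs ?K" for x
  proof -
    have "d \<in> arcs K" "e \<in> arcs K" using de by (auto simp: cutset_def)
    then show ?thesis using that is_graftD(3,4)[OF K] by (auto simp: split_off_def other_end_def)
  qed
  ultimately have gr: "is_graft r ?K"
    using K unfolding is_graft_def o oc by (auto simp: split_off_def)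
  have t: "inj_on ?\<rho> S \<and> tight r ?K (?\<rho> ` S)" if S: "tight r K S" for S
  proof -
    obtain X where X: "odd_set K X" "S = cutset K X" "card S = r" using S by (auto simp: tight_def)
    have nb: "\<not> (d \<in> S \<and> e \<in> S)" using no X by blast
    have "?\<rho> ` S = cutset ?K X" unfolding c X(2)[symmetric] if_not_P[OF nb] ..
    moreover have "card (?\<rho> ` S) = r" using card_image[OF inj[OF nb]] X(3) by simp
    ultimately show ?thesis using inj[OF nb] X(1) o unfolding tight_def by blast
  qed
  have "covers r ?K G" if G: "is_rgraph r G" for G :: "(nat, nat) graft"
  proof -
    obtain f where f: "cut_coloring r K G f" using m G by (auto simp: minimal_universal_def universal_def covers_def)
    have "cut_coloring r ?K G (?\<rho> \<circ> f)" unfolding cut_coloring_def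
    proof
      fix v assume "v \<in> verts G"
      then have "inj_on f (cutset G {v})" "tight r K (f ` cutset G {v})" using f by (auto simp: cut_coloring_def)
      then show "inj_on (?\<rho> \<circ> f) (cutset G {v}) \<and> tight r ?K ((?\<rho> \<circ> f) ` cutset G {v})"
        using t[of "f ` cutset G {v}"] comp_inj_on[of f "cutset G {v}" ?\<rho>] unfolding image_comp by blast
    qed
    then show ?thesis by (auto simp: covers_def)
  qed
  then have "universal r ?K" using gr by (simp add: universal_def)
  then have "card (verts ?K) + card (arcs ?K) \<ge> card (verts K) + card (arcs K)" using m unfolding minimal_universal_def by blast
  moreover have "card (arcs K - {e}) < card (arcs K)"
    using de(2) is_graftD(2)[OF K] by (intro card_Diff1_less) (auto simp: cutset_def)
  ultimately show False by (simp add: split_off_def)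
qed

text \<open>Fix an arc \<open>d\<close> at \<open>s\<close>. For each further arc at
  \<open>s\<close>, splitting off is blocked by a tight set that avoids \<open>s\<close> and
  contains the far ends of both arcs. Uncrossing shows that a maximal tight set containing the far
  end of \<open>d\<close> and avoiding \<open>s\<close> contains all these sets, hence all
  neighbours of \<open>s\<close>. Adding \<open>s\<close> to it removes the whole star from the cut,
  which makes \<open>s\<close> a terminal and bounds its degree by \<open>r\<close>.\<close>

lemma minimal_rgraph:
  assumes r: "3 \<le> r" and m: "minimal_universal r K"
  shows "is_rgraph r K"
proof -
  have K: "is_graft r K" using m by (simp add: minimal_universal_def universal_def)
  have r0: "0 < r" using r by simp
  note fin = is_graftD(2)[OF K]
  obtain G :: "(nat, nat) graft" where G: "is_rgraph r G" using nat_rgraph_exists[OF r0] by blast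
  then obtain f where "cut_coloring r K G f" using m unfolding minimal_universal_def universal_def covers_def by blast
  moreover obtain v where "v \<in> verts G" using is_rgraphD(3)[OF G] by blast
  ultimately have "\<exists>X. odd_set K X" by (auto simp: cut_coloring_def tight_def)
  then have ne: "terminals K \<noteq> {}" by (auto simp: odd_set_def)
  have main: "s \<in> terminals K \<and> card (cutset K {s}) = r" if s: "s \<in> verts K" for s
  proof -
    let ?D = "cutset K {s}"
    have D0: "?D \<noteq> {}"
    proof
      assume e: "?D = {}"
      then have "{s} = verts K" using minimal_connected[OF r0 m, of "{s}"] s by auto
      then have "terminals K = {s}" using ne is_graftD(5)[OF K] by (simp add: subset_singleton_iff flip: \<open>{s} = verts K\<close>)
      then have "odd_set K {s}" using s by (simp add: odd_set_def)
      then show False using is_graftD(6)[OF K] e r by fastforce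
    qed
    have ge: "r \<le> card ?D" if "s \<in> terminals K"
      using is_graftD(6)[OF K, of "{s}"] s that by (simp add: odd_set_def)
    \<comment> \<open>A vertex of odd degree is a terminal and so has degree at least
      \<open>r\<close>, which is at least 3.\<close>
    have "card ?D \<noteq> 1"
    proof
      assume "card ?D = 1"
      then show False using is_graftD(7)[OF K s] ge r by auto
    qed
    obtain d where d: "d \<in> ?D" using D0 by blast
    have "?D \<noteq> {d}" using \<open>card ?D \<noteq> 1\<close> by auto
    then obtain d' where d': "d' \<in> ?D" "d' \<noteq> d" using d by blast
    have bad: "\<exists>X. odd_set K X \<and> card (cutset K X) = r \<and> s \<notin> X \<and> other_end K s d \<in> X \<and> other_end K s e \<in> X"
      if e: "e \<in> ?D" "e \<noteq> d" for e
    proof -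
      obtain X where X: "odd_set K X" "card (cutset K X) = r" "d \<in> cutset K X" "e \<in> cutset K X"
        using split_off_minimal[OF r0 m s d e(1)] e(2) by metis
      have o: "other_end K s d \<in> verts K" "other_end K s e \<in> verts K"
        using d e(1) is_graftD(3,4)[OF K] by (auto simp: cutset_def other_end_def)
      show ?thesis
      proof (cases "s \<in> X")
        case True
        then have "odd_set K (verts K - X)" "card (cutset K (verts K - X)) = r" "s \<notin> verts K - X"
          "other_end K s d \<in> verts K - X" "other_end K s e \<in> verts K - X"
          using odd_set_compl[OF K r0 X(1)] cutset_compl[OF K] X(2) cutset_other_end[OF d, of X] cutset_other_end[OF e(1), of X] X(3,4) o by auto
        then show ?thesis by blast
      next
        case False
        then show ?thesis using X cutset_other_end[OF d, of X] cutset_other_end[OF e(1), of X] by blast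
      qed
    qed
    let ?P = "\<lambda>X. odd_set K X \<and> card (cutset K X) = r \<and> s \<notin> X \<and> other_end K s d \<in> X"
    have "finite {X. ?P X}" by (rule finite_subset[of _ "Pow (verts K)"]) (auto simp: odd_set_def is_graftD(1)[OF K])
    moreover have "{X. ?P X} \<noteq> {}" using bad[OF d'] by blast
    ultimately obtain X where X: "?P X" and max: "\<And>Y. ?P Y \<Longrightarrow> X \<subseteq> Y \<Longrightarrow> Y = X"
      using finite_has_maximal[of "{X. ?P X}"] by (metis (mono_tags, lifting) mem_Collect_eq)
    have all: "other_end K s e \<in> X" if e: "e \<in> ?D" for e
    proof (cases "e = d")
      case False
      obtain Y where Y: "odd_set K Y" "card (cutset K Y) = r" "s \<notin> Y" "other_end K s d \<in> Y" "other_end K s e \<in> Y"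
        using bad[OF e False] by blast
      have par: "odd (card (A \<inter> terminals K)) = (odd (card (B \<inter> terminals K)) \<noteq> odd (card (C \<inter> terminals K)))"
        if "\<And>z. z \<in> A \<longleftrightarrow> (z \<in> B) \<noteq> (z \<in> C)" for A B C
        using odd_card_filter_neq[OF is_graftD(8)[OF K], of "\<lambda>z. z \<in> B" "\<lambda>z. z \<in> C"] that
        by (simp add: Int_def conj_commute)
      have sub: "X \<subseteq> verts K" "Y \<subseteq> verts K" using X Y(1) by (auto simp: odd_set_def)
      have oX: "odd (card (X \<inter> terminals K))" "odd (card (Y \<inter> terminals K))" using X Y(1) by (auto simp: odd_set_def)
      have xmy: "odd (card ((X - Y) \<inter> terminals K)) \<longleftrightarrow> even (card (X \<inter> Y \<inter> terminals K))" using par[of "X - Y" X "X \<inter> Y"] oX by auto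
      have ymx: "odd (card ((Y - X) \<inter> terminals K)) \<longleftrightarrow> even (card (X \<inter> Y \<inter> terminals K))" using par[of "Y - X" Y "X \<inter> Y"] oX by auto
      have un: "odd (card ((X \<union> Y) \<inter> terminals K)) \<longleftrightarrow> odd (card (X \<inter> Y \<inter> terminals K))" using par[of "X \<union> Y" X "Y - X"] oX ymx by auto
      \<comment> \<open>If the intersection were even, both differences would be odd sets with cuts
        of at least \<open>r\<close> arcs each; but \<open>d\<close> runs from the intersection to
        \<open>s\<close> outside the union, so the two cuts have at most \<open>2 * r - 2\<close>
        arcs together.\<close>
      have odd: "odd (card (X \<inter> Y \<inter> terminals K))"
      proof (rule ccontr)
        assume "\<not> ?thesis"
        then have "odd_set K (X - Y)" "odd_set K (Y - X)" using xmy ymx sub by (auto simp: odd_set_def)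
        then have "r + r \<le> card (cutset K (X - Y)) + card (cutset K (Y - X))"
          using is_graftD(6)[OF K] by (meson add_mono)
        moreover have "d \<in> arcs K" "{src K d, tgt K d} = {other_end K s d, s}" using d by (auto simp: cutset_def other_end_def)
        then have "card (cutset K (X - Y)) + card (cutset K (Y - X)) + 2 \<le> card (cutset K X) + card (cutset K Y)"
          using X Y by (intro cutset_posimodular[OF fin, of d]) auto
        ultimately show False using X Y(2) by simp
      qed
      have o: "odd_set K (X \<inter> Y)" "odd_set K (X \<union> Y)" using odd un sub by (auto simp: odd_set_def)
      have "card (cutset K (X \<union> Y)) = r"
        using cutset_submodular[OF fin, of X Y] is_graftD(6)[OF K o(1)] is_graftD(6)[OF K o(2)] X Y(2) by simp
      then have "X \<union> Y = X" using max[of "X \<union> Y"] o(2) X Y by blast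
      then show ?thesis using Y(5) by blast
    qed (use X in simp)
    have sX: "s \<notin> X" using X by simp
    have sub: "?D \<subseteq> cutset K X" using all cutset_other_end[of _ K s X] sX by blast
    have "cutset K (insert s X) = cutset K X - ?D"
    proof -
      have "e \<notin> cutset K (insert s X)" if "e \<in> ?D" for e using cutset_other_end[OF that, of "insert s X"] all[OF that] by simp
      moreover have "e \<in> cutset K (insert s X) \<longleftrightarrow> e \<in> cutset K X" if "e \<notin> ?D" for e
        using that by (auto simp: cutset_def)
      ultimately show ?thesis by blast
    qed
    then have c: "card (cutset K (insert s X)) = r - card ?D" "card ?D \<le> r"
      using sub X finite_cutset[OF K] card_mono[OF finite_cutset[OF K] sub] by (auto simp: card_Diff_subset)
    \<comment> \<open>Adding a nonterminal to \<open>X\<close> would give an odd set whose cut has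
      fewer than \<open>r\<close> arcs.\<close>
    have "s \<in> terminals K"
    proof (rule ccontr)
      assume "s \<notin> terminals K"
      then have "odd_set K (insert s X)" using X s by (auto simp: odd_set_def)
      then have "r \<le> r - card ?D" using is_graftD(6)[OF K] c by metis
      then have "card ?D = 0" using r by simp
      then show False using D0 finite_cutset[OF K, of "{s}"] by simp
    qed
    then show ?thesis using ge c(2) by simp
  qed
  show ?thesis unfolding is_rgraph_def
  proof (intro conjI ballI allI impI)
    show "is_graft r K" by (fact K)
    show "terminals K = verts K" using main is_graftD(5)[OF K] by blast
    show "verts K \<noteq> {}" using ne is_graftD(5)[OF K] by blast
  qed (use main minimal_loopless[OF m] minimal_connected[OF r0 m] in auto)
qed

subsection \<open>Separating pairs and automorphisms\<close>

definition adj :: "('v, 'e) graft \<Rightarrow> 'v \<Rightarrow> 'v \<Rightarrow> bool" where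
  "adj K p q \<longleftrightarrow> (\<exists>e\<in>arcs K. {src K e, tgt K e} = {p, q})"

lemma adj_sym: "adj K p q \<Longrightarrow> adj K q p"
  unfolding adj_def by (metis insert_commute)

lemma adjD:
  assumes "is_rgraph r K" "adj K p q" shows "p \<in> verts K" "q \<in> verts K" "p \<noteq> q"
proof -
  obtain e where "e \<in> arcs K" "{src K e, tgt K e} = {p, q}" using assms(2) by (auto simp: adj_def)
  then show "p \<in> verts K" "q \<in> verts K" "p \<noteq> q"
    using is_rgraphD(5,9,10)[OF assms(1), of e] by (auto simp: doubleton_eq_iff)
qed

lemma cutset_adj:
  assumes "is_rgraph r K" "e \<in> cutset K X"
  obtains p q where "p \<in> X" "q \<notin> X" "adj K p q" "{src K e, tgt K e} = {p, q}" "p \<in> verts K" "q \<in> verts K"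
proof (cases "src K e \<in> X")
  case True
  then show ?thesis using that[of "src K e" "tgt K e"] assms is_rgraphD(9,10)[OF assms(1), of e]
    by (auto simp: cutset_def adj_def)
next
  case False
  then show ?thesis using that[of "tgt K e" "src K e"] assms is_rgraphD(9,10)[OF assms(1), of e]
    by (auto simp: cutset_def adj_def)
qed

text \<open>One side of a cut vertex would be odd and hence use up all the edges at the vertex.\<close>

lemma no_cut_vertex:
  assumes r: "0 < r" and K: "is_rgraph r K" and c: "c \<in> verts K" and A: "A \<subseteq> verts K - {c}"
    and sep: "\<And>p q. p \<in> A \<Longrightarrow> adj K p q \<Longrightarrow> q \<in> A \<or> q = c"
  shows "A = {} \<or> A = verts K - {c}"
proof -
  let ?B = "verts K - {c} - A"
  have main: "insert c X = verts K" if X: "X \<subseteq> verts K - {c}" "odd (card X)" 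
    and s: "\<And>p q. p \<in> X \<Longrightarrow> adj K p q \<Longrightarrow> q \<in> X \<or> q = c" for X
  proof -
    have sub: "cutset K X \<subseteq> cutset K {c}"
    proof
      fix e assume e: "e \<in> cutset K X"
      then obtain p q where pq: "p \<in> X" "q \<notin> X" "adj K p q" "{src K e, tgt K e} = {p, q}" using cutset_adj[OF K] by metis
      then have "q = c" using s by blast
      then show "e \<in> cutset K {c}" using pq e X(1) by (auto simp: cutset_def doubleton_eq_iff)
    qed
    have "card (cutset K {c}) \<le> card (cutset K X)" using is_rgraphD(11)[OF K _ X(2)] X(1) is_rgraphD(4)[OF K c] by auto
    then have eq: "cutset K X = cutset K {c}"
      using sub finite_cutset[OF is_rgraphD(1)[OF K]] by (metis card_seteq)
    have "cutset K (insert c X) = {}"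
    proof (rule ccontr)
      assume "cutset K (insert c X) \<noteq> {}"
      then obtain e where e: "e \<in> cutset K (insert c X)" by blast
      then have "e \<notin> cutset K X \<or> e \<notin> cutset K {c}" using X(1) by (auto simp: cutset_def)
      moreover have "e \<in> cutset K X \<or> e \<in> cutset K {c}" using e by (auto simp: cutset_def)
      ultimately show False using eq by blast
    qed
    then show ?thesis using is_rgraphD(6)[OF K, of "insert c X"] X(1) c by auto
  qed
  have f: "finite A" using A is_rgraphD(7)[OF K] finite_subset by blast
  have "card (verts K) > 0" using c is_rgraphD(7)[OF K] by (auto simp: card_gt_0_iff)
  moreover have "card (verts K - {c}) = card (verts K) - 1" using c by simp
  moreover have "card ?B = card (verts K - {c}) - card A" using A f by (simp add: card_Diff_subset)
  moreover have "card A \<le> card (verts K - {c})" using A is_rgraphD(7)[OF K] by (intro card_mono) auto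
  moreover have "even (card (verts K))" using rgraph_even_verts[OF K r] .
  ultimately have "odd (card A) \<or> odd (card ?B)" by presburger
  then show ?thesis
  proof
    assume "odd (card A)"
    then have "insert c A = verts K" using main[of A] A sep by blast
    then show ?thesis using A by blast
  next
    assume o: "odd (card ?B)"
    have "insert c ?B = verts K"
    proof (rule main[OF _ o])
      fix p q assume pq: "p \<in> ?B" "adj K p q"
      then have "q \<notin> A" using sep[of q p] adj_sym[of K p q] by blast
      then show "q \<in> ?B \<or> q = c" using adjD(2)[OF K pq(2)] by blast
    qed blast
    then show ?thesis using A by blast
  qed
qed

text \<open>A 2-vertex-cut together with one side: \<open>A\<close> is a union of components of the
  graph without \<open>u\<close> and \<open>v\<close>, neither empty nor all of it.\<close>

definition sep_pair :: "('v, 'e) graft \<Rightarrow> 'v \<Rightarrow> 'v \<Rightarrow> 'v set \<Rightarrow> bool" where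
  "sep_pair K u v A \<longleftrightarrow> u \<in> verts K \<and> v \<in> verts K \<and> u \<noteq> v \<and> A \<noteq> {} \<and> A \<subseteq> verts K - {u, v} \<and>
     verts K - {u, v} - A \<noteq> {} \<and> (\<forall>p\<in>A. \<forall>q. adj K p q \<longrightarrow> q \<in> A \<or> q = u \<or> q = v)"

lemma sep_pair_compl:
  assumes K: "is_rgraph r K" and s: "sep_pair K u v A" shows "sep_pair K u v (verts K - {u, v} - A)"
proof -
  have "q \<in> verts K - {u, v} - A \<or> q = u \<or> q = v" if "p \<in> verts K - {u, v} - A" "adj K p q" for p q
    using s that adj_sym[OF that(2)] adjD(2)[OF K that(2)] unfolding sep_pair_def by blast
  then show ?thesis using s unfolding sep_pair_def by auto
qed

lemma simple_star_le:
  assumes K: "is_rgraph r K" and simple: "parallel_arcs K = {}" and z: "z \<in> verts K"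
    and N: "\<And>q. adj K z q \<Longrightarrow> q \<in> N" "finite N"
  shows "r \<le> card N"
proof -
  have "inj_on (other_end K z) (cutset K {z})"
  proof (rule inj_onI, rule ccontr)
    fix d e assume de: "d \<in> cutset K {z}" "e \<in> cutset K {z}" "other_end K z d = other_end K z e" "d \<noteq> e"
    then have "{src K d, tgt K d} = {src K e, tgt K e}" using other_end_props(4)[OF K] by metis
    moreover have "d \<in> arcs K" "e \<in> arcs K" using de by (auto simp: cutset_def)
    ultimately have "e \<in> parallel_arcs K" using de(4) unfolding parallel_arcs_def by blast
    then show False using simple by simp
  qed
  moreover have "other_end K z ` cutset K {z} \<subseteq> N"
  proof (rule image_subsetI)
    fix e assume e: "e \<in> cutset K {z}"
    then have "e \<in> arcs K" by (simp add: cutset_def)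
    then have "adj K z (other_end K z e)" using other_end_props(4)[OF K e] unfolding adj_def by blast
    then show "other_end K z e \<in> N" by (rule N(1))
  qed
  ultimately show ?thesis using card_inj_on_le[OF _ _ N(2)] is_rgraphD(4)[OF K z] by metis
qed

text \<open>Take a 2-vertex-cut with a smallest side \<open>Z\<close>, and a second one through a
  vertex \<open>z\<close> of \<open>Z\<close>. Wherever the two cross, a corner is a smaller side
  inside \<open>Z\<close>, or is cut off by a single vertex, or \<open>Z\<close> shrinks to
  \<open>z\<close> alone, which then has only two possible neighbours.\<close>

lemma sep_pair_vertex_free:
  assumes r: "3 \<le> r" and K: "is_rgraph r K" and simple: "parallel_arcs K = {}"
    and all: "\<And>v. v \<in> verts K \<Longrightarrow> \<exists>u A. sep_pair K v u A"
  shows False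
proof -
  have r0: "0 < r" using r by simp
  obtain v0 where "v0 \<in> verts K" using is_rgraphD(3)[OF K] by blast
  then have ex: "\<exists>n u v Z. sep_pair K u v Z \<and> card Z = n" using all by blast
  define n where "n = (LEAST n. \<exists>u v Z. sep_pair K u v Z \<and> card Z = n)"
  obtain u v Z where uvZ: "sep_pair K u v Z" "card Z = n" using LeastI_ex[OF ex] unfolding n_def by blast
  have min: "n \<le> card Z'" if "sep_pair K u' v' Z'" for u' v' Z'
    unfolding n_def by (rule Least_le) (use that in blast)
  let ?O = "verts K - {u, v} - Z"
  have Zf: "finite Z" using uvZ(1) is_rgraphD(7)[OF K] by (auto simp: sep_pair_def intro: finite_subset)
  obtain z where z: "z \<in> Z" using uvZ(1) by (auto simp: sep_pair_def)
  then have zV: "z \<in> verts K" "z \<noteq> u" "z \<noteq> v" using uvZ(1) by (auto simp: sep_pair_def)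
  obtain z' A where A: "sep_pair K z z' A" using all[OF zV(1)] by blast
  let ?B = "verts K - {z, z'} - A"
  have B: "sep_pair K z z' ?B" using sep_pair_compl[OF K A] .
  have ZO: "\<not> adj K p q" if "p \<in> Z" "q \<in> ?O" for p q using uvZ(1) that unfolding sep_pair_def by blast
  have OZ: "\<not> adj K p q" if "q \<in> Z" "p \<in> ?O" for p q using ZO that adj_sym by metis
  have small: "S = {}" if "sep_pair K a b S \<or> S = {}" "S \<subseteq> Z - {z}" for a b S
  proof (rule ccontr)
    assume "S \<noteq> {}"
    then have "n \<le> card S" using min that(1) by blast
    moreover have "card S < card Z" using that(2) z Zf by (intro psubset_card_mono) auto
    ultimately show False using uvZ(2) by simp
  qed
  \<comment> \<open>A side \<open>R\<close> that avoids \<open>u\<close> and \<open>v\<close> meets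
    \<open>Z\<close> in a smaller side, hence not at all. So it lies beyond \<open>Z\<close>, where
    \<open>z\<close> has no neighbours, and \<open>z'\<close> alone cuts it off.\<close>
  have case1: False if R: "sep_pair K z z' R" "u \<notin> R" "v \<notin> R" for R
  proof -
    have nb: "q \<in> R \<or> q = z \<or> q = z'" if "p \<in> R" "adj K p q" for p q using R(1) that unfolding sep_pair_def by blast
    have RV: "R \<subseteq> verts K" "z \<notin> R" "z' \<notin> R" using R(1) unfolding sep_pair_def by auto
    have "sep_pair K z z' (R \<inter> Z) \<or> R \<inter> Z = {}"
    proof -
      have "q \<in> R \<inter> Z \<or> q = z \<or> q = z'" if "p \<in> R \<inter> Z" "adj K p q" for p q
        using nb[of p q] ZO[of p q] that R(2,3) RV(1) by blast
      then show ?thesis using R(1) unfolding sep_pair_def by blast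
    qed
    then have e: "R \<inter> Z = {}" using small RV(2) by blast
    have "R = {} \<or> R = verts K - {z'}"
    proof (rule no_cut_vertex[OF r0 K])
      show "z' \<in> verts K" "R \<subseteq> verts K - {z'}" using R(1) unfolding sep_pair_def by auto
      fix p q assume pq: "p \<in> R" "adj K p q"
      then have "p \<in> ?O" using e R(2,3) RV(1) by blast
      then have "q \<noteq> z" using OZ[OF z] pq(2) by blast
      then show "q \<in> R \<or> q = z'" using nb[OF pq] by blast
    qed
    then show False using R(1) zV(1) RV(2) unfolding sep_pair_def by blast
  qed
  \<comment> \<open>The two pairs cross: \<open>u\<close> lies on one side of the second pair and
    \<open>v\<close> on the other.\<close>
  have case2: False if R: "sep_pair K z z' R" "sep_pair K z z' (verts K - {z, z'} - R)" "u \<in> R" "v \<notin> R" "v \<noteq> z'" for R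
  proof -
    let ?S = "verts K - {z, z'} - R"
    have nb: "q \<in> R \<or> q = z \<or> q = z'" if "p \<in> R" "adj K p q" for p q using R(1) that unfolding sep_pair_def by blast
    have nb': "q \<in> ?S \<or> q = z \<or> q = z'" if "p \<in> ?S" "adj K p q" for p q using R(2) that unfolding sep_pair_def by blast
    have RV: "R \<subseteq> verts K" "z \<notin> R" "z' \<notin> R" "z \<noteq> z'" "z' \<in> verts K" using R(1) unfolding sep_pair_def by auto
    have uv: "u \<in> verts K" "v \<in> verts K" "u \<noteq> v" "u \<notin> Z" "v \<notin> Z" using uvZ(1) unfolding sep_pair_def by auto
    have vS: "v \<in> ?S" using uv zV R by blast
    show False
    proof (cases "z' \<in> Z")
      case False
      \<comment> \<open>With \<open>z'\<close> beyond \<open>Z\<close>, the two parts of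
        \<open>Z\<close> are cut off by \<open>z, u\<close> and by \<open>z, v\<close>; both are
        smaller than \<open>Z\<close>, hence empty.\<close>
      then have z'O: "z' \<in> ?O" using RV uv R(3,5) by blast
      have "sep_pair K z u (R \<inter> Z) \<or> R \<inter> Z = {}"
      proof -
        have "q \<in> R \<inter> Z \<or> q = z \<or> q = u" if "p \<in> R \<inter> Z" "adj K p q" for p q
          using nb[of p q] ZO[of p q] ZO[of p z'] z'O that R(3,4) RV(1) by blast
        moreover have "v \<in> verts K - {z, u} - R \<inter> Z" using uv zV by blast
        ultimately show ?thesis using uv zV RV unfolding sep_pair_def by blast
      qed
      then have e1: "R \<inter> Z = {}" using small RV(2) by blast
      have "sep_pair K z v (?S \<inter> Z) \<or> ?S \<inter> Z = {}"
      proof -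
        have "q \<in> ?S \<inter> Z \<or> q = z \<or> q = v" if "p \<in> ?S \<inter> Z" "adj K p q" for p q
          using nb'[of p q] ZO[of p q] ZO[of p z'] z'O that R(3,4) RV(1) by blast
        moreover have "u \<in> verts K - {z, v} - ?S \<inter> Z" using uv zV by blast
        ultimately show ?thesis using uv zV RV unfolding sep_pair_def by blast
      qed
      then have e2: "?S \<inter> Z = {}" using small by blast
      have "Z \<subseteq> verts K" using uvZ(1) unfolding sep_pair_def by blast
      then have "Z = {z}" using e1 e2 False z by blast
      then have "\<And>q. adj K z q \<Longrightarrow> q \<in> {u, v}" using uvZ(1) adjD(3)[OF K, of z] unfolding sep_pair_def by blast
      then have "r \<le> card {u, v}" using simple_star_le[OF K simple zV(1)] by blast
      then show False using r uv by simp
    next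
      case True
      \<comment> \<open>With both \<open>z\<close> and \<open>z'\<close> in \<open>Z\<close>, the
        two parts of the outside are cut off by the single vertices \<open>u\<close> and
        \<open>v\<close>, so both are empty.\<close>
      have "R \<inter> ?O = {} \<or> R \<inter> ?O = verts K - {u}"
      proof (rule no_cut_vertex[OF r0 K uv(1)])
        fix p q assume pq: "p \<in> R \<inter> ?O" "adj K p q"
        then show "q \<in> R \<inter> ?O \<or> q = u"
          using nb[of p q] OZ[of q p] OZ[OF z, of p] OZ[OF True, of p] R(4) RV(1) by blast
      qed blast
      then have e1: "R \<inter> ?O = {}" using zV z by blast
      have "?S \<inter> ?O = {} \<or> ?S \<inter> ?O = verts K - {v}"
      proof (rule no_cut_vertex[OF r0 K uv(2)])
        fix p q assume pq: "p \<in> ?S \<inter> ?O" "adj K p q"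
        then show "q \<in> ?S \<inter> ?O \<or> q = v"
          using nb'[of p q] OZ[of q p] OZ[OF z, of p] OZ[OF True, of p] R(3) RV(1) by blast
      qed blast
      then have e2: "?S \<inter> ?O = {}" using zV z by blast
      have "?O \<subseteq> R \<union> ?S" using z True by blast
      then have "?O = {}" using e1 e2 by blast
      then show False using uvZ(1) unfolding sep_pair_def by blast
    qed
  qed
  have AB: "verts K - {z, z'} - ?B = A" using A unfolding sep_pair_def by blast
  have uvV: "u \<in> verts K" "v \<in> verts K" using uvZ(1) unfolding sep_pair_def by auto
  consider "u \<notin> A \<and> v \<notin> A" | "u \<notin> ?B \<and> v \<notin> ?B" | "u \<in> A \<and> v \<notin> A \<and> v \<noteq> z'" | "u \<in> ?B \<and> v \<notin> ?B \<and> v \<noteq> z'"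
    using uvV zV A unfolding sep_pair_def by blast
  then show False
  proof cases
    case 1 then show False using case1[OF A] by blast
  next
    case 2 then show False using case1[OF B] by blast
  next
    case 3 then show False using case2[OF A B] by blast
  next
    case 4
    have "sep_pair K z z' (verts K - {z, z'} - ?B)" unfolding AB by (rule A)
    then show False using case2[OF B] 4 by blast
  qed
qed

text \<open>There are finitely many tight cuts, and an arc-bijective endomorphism maps them
  injectively into themselves, hence onto.\<close>

lemma endo_tight_preimage:
  assumes K: "is_rgraph r K" and g: "cut_coloring r K K g" and b: "bij_betw g (arcs K) (arcs K)" and S: "tight r K S"
  shows "\<exists>S'. tight r K S' \<and> g ` S' = S"
proof -
  let ?Y = "{S. tight r K S}"
  have sub: "?Y \<subseteq> Pow (arcs K)" using tight_subset by blast
  have fin: "finite ?Y" using sub is_rgraphD(8)[OF K] by (meson finite_Pow_iff finite_subset)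
  have "inj_on g (arcs K)" using b by (simp add: bij_betw_def)
  then have "inj_on ((`) g) ?Y" by (rule inj_on_subset[OF inj_on_image_Pow sub])
  moreover have "(`) g ` ?Y \<subseteq> ?Y" using cut_coloring_push_tight(2)[OF is_rgraphD(1)[OF K] K g] by (intro image_subsetI) simp
  ultimately have "(`) g ` ?Y = ?Y" using endo_inj_surj[OF fin] by simp
  then have "S \<in> (`) g ` ?Y" using S by simp
  then show ?thesis by (elim imageE) auto
qed

text \<open>The inverse must map stars to tight cuts; the star is the image of some tight cut, which
  is its image under the inverse. So bijective endomorphisms are automorphisms.\<close>

lemma endo_inverse:
  assumes K: "is_rgraph r K" and g: "cut_coloring r K K g" and b: "bij_betw g (arcs K) (arcs K)"
  shows "cut_coloring r K K (inv_into (arcs K) g)"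
  unfolding cut_coloring_def
proof
  fix x assume x: "x \<in> verts K"
  obtain S where S: "tight r K S" "g ` S = cutset K {x}" using endo_tight_preimage[OF K g b star_tight[OF K x]] by blast
  have "inv_into (arcs K) g ` cutset K {x} = S"
    unfolding S(2)[symmetric] using b tight_subset[OF S(1)] by (simp add: bij_betw_def inv_into_image_cancel)
  moreover have "inj_on (inv_into (arcs K) g) (cutset K {x})"
    using b cutset_subset by (intro inj_on_inv_into) (simp add: bij_betw_def)
  ultimately show "inj_on (inv_into (arcs K) g) (cutset K {x}) \<and> tight r K (inv_into (arcs K) g ` cutset K {x})"
    using S(1) by simp
qed

text \<open>Glue G onto K at v. A colouring of the result restricts to an automorphism of K, which can be
  undone.\<close>

lemma homogeneous:
  assumes r: "3 \<le> r" and m: "minimal_universal r K" and G: "is_rgraph r G" and w: "w \<in> verts G" and v: "v \<in> verts K"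
    and \<beta>: "bij_betw \<beta> (cutset G {w}) (cutset K {v})"
  shows "\<exists>f. cut_coloring r K G f \<and> (\<forall>e\<in>cutset G {w}. f e = \<beta> e)"
proof -
  have r0: "0 < r" using r by simp
  note K = minimal_rgraph[OF r m]
  note gr = is_rgraphD(1)[OF K]
  let ?\<gamma> = "inv_into (cutset G {w}) \<beta>"
  have \<gamma>: "bij_betw ?\<gamma> (cutset K {v}) (cutset G {w})" using bij_betw_inv_into[OF \<beta>] .
  have "covers r K (glue K v G w ?\<gamma>)"
    using universal_covers m glue_rgraph[OF r0 K G v w \<gamma>] unfolding minimal_universal_def by blast
  then obtain f where f: "cut_coloring r K (glue K v G w ?\<gamma>) f" by (auto simp: covers_def)
  let ?\<sigma> = "f \<circ> Inl" and ?h = "f \<circ> glue_inr K v G w ?\<gamma>"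
  have \<sigma>: "cut_coloring r K K ?\<sigma>" and h: "cut_coloring r K G ?h" using glue_cut_coloring[OF r0 K G v w \<gamma> gr f] by auto
  have b: "bij_betw ?\<sigma> (arcs K) (arcs K)" using minimal_endo_surj[OF m K \<sigma>] .
  let ?\<tau> = "inv_into (arcs K) ?\<sigma>"
  have "cut_coloring r K G (?\<tau> \<circ> ?h)" using cut_coloring_comp[OF gr K endo_inverse[OF K \<sigma> b] h] .
  moreover have "(?\<tau> \<circ> ?h) e = \<beta> e" if e: "e \<in> cutset G {w}" for e
  proof -
    have be: "\<beta> e \<in> cutset K {v}" using e \<beta> by (auto simp: bij_betw_def)
    have "inv_into (cutset K {v}) ?\<gamma> e = \<beta> e"
      by (rule inv_into_f_eq) (use \<gamma> be e \<beta> in \<open>auto simp: bij_betw_def\<close>)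
    then have "?h e = ?\<sigma> (\<beta> e)" using e by (simp add: glue_inr_def)
    moreover have "?\<tau> (?\<sigma> (\<beta> e)) = \<beta> e" using b be by (intro inv_into_f_f) (auto simp: bij_betw_def cutset_def)
    ultimately show ?thesis by simp
  qed
  ultimately show ?thesis by blast
qed

subsection \<open>Tight cuts of the minimal universal graft\<close>

text \<open>Parallel arcs lie in the same cuts. Given another arc \<open>x\<close> at
  \<open>v\<close>, homogeneity yields an automorphism that swaps \<open>d\<close> with
  \<open>x\<close> and fixes \<open>e\<close>. The tight cut that it maps to the star of
  \<open>w\<close> contains \<open>e\<close>, hence \<open>d\<close>, so \<open>x\<close> also ends
  in \<open>w\<close>. Thus all arcs at \<open>v\<close> go to \<open>w\<close>, and connectedness
  leaves only these two vertices.\<close>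

lemma minimal_parallel:
  assumes r: "3 \<le> r" and m: "minimal_universal r K" and p: "parallel_arcs K \<noteq> {}"
  shows "\<exists>a b. verts K = {a, b} \<and> a \<noteq> b"
proof -
  note K = minimal_rgraph[OF r m]
  note gr = is_rgraphD(1)[OF K]
  obtain e d where ed: "e \<in> arcs K" "d \<in> arcs K" "d \<noteq> e" "{src K d, tgt K d} = {src K e, tgt K e}"
    using p by (auto simp: parallel_arcs_def)
  define v w where "v = src K e" and "w = tgt K e"
  have vw: "v \<in> verts K" "w \<in> verts K" "v \<noteq> w" using is_rgraphD(5,9,10)[OF K ed(1)] by (auto simp: v_def w_def)
  have same: "d \<in> cutset K X \<longleftrightarrow> e \<in> cutset K X" for X
    using ed by (auto simp: cutset_def doubleton_eq_iff)
  have ev: "e \<in> cutset K {v}" "e \<in> cutset K {w}" using ed(1) vw by (auto simp: cutset_def v_def w_def)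
  have "x \<in> cutset K {w}" if x: "x \<in> cutset K {v}" for x
  proof (cases "x = e")
    case False
    define \<beta> where "\<beta> = (\<lambda>y. if y = d then x else if y = x then d else y)"
    have dv: "d \<in> cutset K {v}" using same ev by simp
    have inv: "\<beta> (\<beta> y) = y" for y by (auto simp: \<beta>_def)
    have "bij_betw \<beta> (cutset K {v}) (cutset K {v})"
      by (rule bij_betw_byWitness[where f' = \<beta>]) (use inv x dv in \<open>auto simp: \<beta>_def\<close>)
    then obtain \<sigma> where \<sigma>: "cut_coloring r K K \<sigma>" "\<And>y. y \<in> cutset K {v} \<Longrightarrow> \<sigma> y = \<beta> y"
      using homogeneous[OF r m K vw(1) vw(1)] by blast
    have b: "bij_betw \<sigma> (arcs K) (arcs K)" using minimal_endo_surj[OF m K \<sigma>(1)] .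
    have im: "\<sigma> d = x" "\<sigma> e = e" using \<sigma>(2) dv ev(1) ed(3) False by (auto simp: \<beta>_def)
    obtain S where S: "tight r K S" "\<sigma> ` S = cutset K {w}"
      using endo_tight_preimage[OF K \<sigma>(1) b star_tight[OF K vw(2)]] by blast
    have sub: "S \<subseteq> arcs K" using tight_subset[OF S(1)] .
    have "e \<in> S"
    proof -
      have "\<sigma> e \<in> \<sigma> ` S" using S(2) ev(2) im(2) by simp
      then show ?thesis using b ed(1) sub by (auto simp: bij_betw_def dest: inj_onD)
    qed
    then have "d \<in> S" using S(1) same unfolding tight_def by blast
    then show ?thesis using S(2) im(1) by blast
  qed (use ev in simp)
  then have "cutset K {v} \<subseteq> cutset K {w}" by blast
  then have eq: "cutset K {v} = cutset K {w}"
    using finite_cutset[OF gr] is_rgraphD(4)[OF K] vw by (metis card_subset_eq)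
  have "cutset K {v, w} = {}"
  proof (rule ccontr)
    assume "cutset K {v, w} \<noteq> {}"
    then obtain y where y: "y \<in> cutset K {v, w}" by blast
    then have "(y \<in> cutset K {v}) \<noteq> (y \<in> cutset K {w})" using vw(3) by (auto simp: cutset_def)
    then show False using eq by simp
  qed
  then have "verts K = {v, w}" using is_rgraphD(6)[OF K, of "{v, w}"] vw by auto
  then show ?thesis using vw(3) by blast
qed

text \<open>The contracted set is represented by its member \<open>y\<close>, which avoids a new
  vertex type. Every vertex is a terminal, in agreement with K because only odd sets
  \<open>Y\<close> are contracted.\<close>

definition contract :: "('v, 'e) graft \<Rightarrow> 'v set \<Rightarrow> 'v \<Rightarrow> ('v, 'e) graft" where
  "contract K Y y = \<lparr>verts = verts K - (Y - {y}), arcs = {e \<in> arcs K. \<not> (src K e \<in> Y \<and> tgt K e \<in> Y)},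
     src = (\<lambda>e. if src K e \<in> Y then y else src K e), tgt = (\<lambda>e. if tgt K e \<in> Y then y else tgt K e),
     terminals = verts K - (Y - {y})\<rparr>"

lemma contract_cutset:
  assumes "y \<in> Y" "X \<subseteq> verts (contract K Y y)"
  shows "cutset (contract K Y y) X = cutset K (if y \<in> X then X \<union> Y else X)"
proof -
  define Z where "Z = (if y \<in> X then X \<union> Y else X)"
  have u: "z = y" if "z \<in> X" "z \<in> Y" for z using assms(2) that by (auto simp: contract_def)
  have *: "(if z \<in> Y then y else z) \<in> X \<longleftrightarrow> z \<in> Z" for z
    using u[of z] unfolding Z_def by (cases "z \<in> Y"; cases "y \<in> X") auto
  have Y: "a \<in> Y \<Longrightarrow> b \<in> Y \<Longrightarrow> a \<in> Z \<longleftrightarrow> b \<in> Z" for a b using *[of a] *[of b] by (simp only: if_True)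
  have "e \<in> cutset (contract K Y y) X \<longleftrightarrow> e \<in> arcs K \<and> \<not> (src K e \<in> Y \<and> tgt K e \<in> Y) \<and> (src K e \<in> Z) \<noteq> (tgt K e \<in> Z)" for e
    by (simp add: cutset_def contract_def *)
  then have "cutset (contract K Y y) X = cutset K Z" using Y by (auto simp: cutset_def)
  then show ?thesis by (simp only: Z_def)
qed

lemma contract_rgraph:
  assumes K: "is_rgraph r K" and Y: "Y \<subseteq> verts K" "odd (card Y)" "card (cutset K Y) = r" and y: "y \<in> Y"
  shows "is_rgraph r (contract K Y y)"
proof (rule is_rgraphI)
  let ?C = "contract K Y y"
  note c = contract_cutset[OF y]
  have fin: "finite Y" using Y(1) is_rgraphD(7)[OF K] finite_subset by blast
  have vs: "verts ?C = verts K - (Y - {y})" by (simp add: contract_def)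
  show "finite (verts ?C)" "finite (arcs ?C)" using is_rgraphD(7,8)[OF K] by (auto simp: contract_def)
  show "verts ?C \<noteq> {}" using y Y(1) vs by blast
  show "terminals ?C = verts ?C" by (simp add: contract_def)
  show "src ?C e \<in> verts ?C \<and> tgt ?C e \<in> verts ?C \<and> src ?C e \<noteq> tgt ?C e" if "e \<in> arcs ?C" for e
  proof -
    have e: "e \<in> arcs K" "\<not> (src K e \<in> Y \<and> tgt K e \<in> Y)" using that by (auto simp: contract_def)
    then show ?thesis using is_rgraphD(5,9,10)[OF K e(1)] y Y(1) by (auto simp: contract_def)
  qed
  show "card (cutset ?C {v}) = r" if v: "v \<in> verts ?C" for v
  proof -
    have "{v} \<subseteq> verts ?C" using v by simp
    then show ?thesis using c[of "{v}" K] Y(1,3) y is_rgraphD(4)[OF K, of v] v vs by (auto simp: insert_absorb)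
  qed
  show "r \<le> card (cutset ?C X)" if X: "X \<subseteq> verts ?C" "odd (card X)" for X
  proof (cases "y \<in> X")
    case True
    have "card (X \<union> Y) + card (X \<inter> Y) = card X + card Y"
      using card_Un_Int[of X Y] fin finite_subset[OF X(1)] is_rgraphD(7)[OF K] vs by simp
    moreover have "X \<inter> Y = {y}" using X(1) vs True y by blast
    ultimately have "odd (card (X \<union> Y))" using X(2) Y(2) by simp presburger
    then show ?thesis using c[OF X(1)] True is_rgraphD(11)[OF K, of "X \<union> Y"] X(1) Y(1) vs by auto
  next
    case False
    then show ?thesis using c[OF X(1)] is_rgraphD(11)[OF K, of X] X vs by auto
  qed
  show "X = {} \<or> X = verts ?C" if X: "X \<subseteq> verts ?C" "cutset ?C X = {}" for X
  proof (cases "y \<in> X")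
    case True
    then have "cutset K (X \<union> Y) = {}" using c[OF X(1)] X(2) by simp
    then have "X \<union> Y = verts K" using is_rgraphD(6)[OF K, of "X \<union> Y"] X(1) Y(1) vs True by auto
    then show ?thesis using X(1) True vs by blast
  next
    case False
    then have "cutset K X = {}" using c[OF X(1)] X(2) by simp
    then have "X = {} \<or> X = verts K" using is_rgraphD(6)[OF K, of X] X(1) vs by auto
    then show ?thesis using False y Y(1) by blast
  qed
qed

text \<open>The two sides of the tight cut are coloured separately, with the same colours on the cut.\<close>

lemma tight_to_star:
  fixes K :: "('v, 'e) graft"
  assumes r: "3 \<le> r" and m: "minimal_universal r K" and Y: "Y \<subseteq> verts K" "odd (card Y)" "card (cutset K Y) = r"
    and v: "v \<in> verts K"
  obtains g where "cut_coloring r K K g" "bij_betw g (arcs K) (arcs K)" "g ` cutset K Y = cutset K {v}"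
proof -
  note K = minimal_rgraph[OF r m]
  note gr = is_rgraphD(1)[OF K]
  let ?Z = "verts K - Y"
  have r0: "0 < r" using r by simp
  have cZ: "cutset K ?Z = cutset K Y" using cutset_compl[OF gr] .
  have fY: "finite Y" using Y(1) is_rgraphD(7)[OF K] finite_subset by blast
  have Z: "?Z \<subseteq> verts K" "odd (card ?Z)" "card (cutset K ?Z) = r"
    using Y rgraph_even_verts[OF K r0] card_Diff_subset[OF fY Y(1)] card_mono[OF is_rgraphD(7)[OF K] Y(1)] cZ by auto
  have ne: "X \<noteq> {}" if "odd (card X)" for X :: "'v set" using that by (metis card.empty even_zero)
  obtain y where y: "y \<in> Y" using ne[OF Y(2)] by blast
  obtain z where z: "z \<in> ?Z" using ne[OF Z(2)] by blast
  let ?G = "contract K ?Z z" and ?H = "contract K Y y"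
  have G: "is_rgraph r ?G" and H: "is_rgraph r ?H" using contract_rgraph[OF K Z z] contract_rgraph[OF K Y y] by auto
  have zG: "z \<in> verts ?G" and yH: "y \<in> verts ?H" using z y Y(1) by (auto simp: contract_def)
  have stars: "cutset ?G {z} = cutset K Y" "cutset ?H {y} = cutset K Y"
    using contract_cutset[OF z, of "{z}" K] contract_cutset[OF y, of "{y}" K] zG yH z y cZ by (auto simp: insert_absorb)
  have "card (cutset K Y) = card (cutset K {v})" using Y(3) is_rgraphD(4)[OF K v] by simp
  then obtain \<beta> where \<beta>: "bij_betw \<beta> (cutset K Y) (cutset K {v})"
    using finite_same_card_bij finite_cutset[OF gr] by metis
  obtain f where f: "cut_coloring r K ?G f" "\<And>e. e \<in> cutset K Y \<Longrightarrow> f e = \<beta> e"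
    using homogeneous[OF r m G zG v] \<beta> unfolding stars by blast
  obtain h where h: "cut_coloring r K ?H h" "\<And>e. e \<in> cutset K Y \<Longrightarrow> h e = \<beta> e"
    using homogeneous[OF r m H yH v] \<beta> unfolding stars by blast
  \<comment> \<open>Arcs of the cut receive \<open>f\<close>, but \<open>h\<close> agrees with
    \<open>f\<close> there, so the star of a vertex on either side is coloured by one of the two
    maps throughout.\<close>
  define g where "g = (\<lambda>e. if src K e \<in> Y \<or> tgt K e \<in> Y then f e else h e)"
  have "cut_coloring r K K g" unfolding cut_coloring_def
  proof
    fix x assume x: "x \<in> verts K"
    show "inj_on g (cutset K {x}) \<and> tight r K (g ` cutset K {x})"
    proof (cases "x \<in> Y")
      case True
      have xG: "x \<in> verts ?G" using x True by (auto simp: contract_def)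
      then have "cutset ?G {x} = cutset K {x}" using contract_cutset[OF z, of "{x}" K] z True by auto
      then have "inj_on f (cutset K {x}) \<and> tight r K (f ` cutset K {x})" using f(1) xG unfolding cut_coloring_def by metis
      moreover have "\<And>e. e \<in> cutset K {x} \<Longrightarrow> g e = f e" using True by (auto simp: g_def cutset_def)
      ultimately show ?thesis using inj_on_cong[of "cutset K {x}" g f] image_cong[of "cutset K {x}" _ g f] by auto
    next
      case False
      have xH: "x \<in> verts ?H" using x False by (auto simp: contract_def)
      then have "cutset ?H {x} = cutset K {x}" using contract_cutset[OF y, of "{x}" K] y False by auto
      then have "inj_on h (cutset K {x}) \<and> tight r K (h ` cutset K {x})" using h(1) xH unfolding cut_coloring_def by metis
      moreover have "g e = h e" if e: "e \<in> cutset K {x}" for e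
      proof (cases "e \<in> cutset K Y")
        case True then show ?thesis using f(2) h(2) by (auto simp: g_def)
      next
        case c: False
        then have "src K e \<notin> Y \<and> tgt K e \<notin> Y" using e False by (auto simp: cutset_def)
        then show ?thesis by (simp add: g_def)
      qed
      ultimately show ?thesis using inj_on_cong[of "cutset K {x}" g h] image_cong[of "cutset K {x}" _ g h] by auto
    qed
  qed
  moreover have "g ` cutset K Y = cutset K {v}"
  proof -
    have "g e = \<beta> e" if "e \<in> cutset K Y" for e using that f(2) h(2) by (auto simp: g_def)
    then show ?thesis using \<beta> by (simp add: bij_betw_def)
  qed
  ultimately show ?thesis using that minimal_endo_surj[OF m K] by blast
qed

text \<open>Without inner arcs, the star of each vertex of \<open>Y\<close> is contained in the cut
  of \<open>Y\<close> and has the same size, so all these stars are equal; an arc common to two of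
  them would be an inner arc.\<close>

lemma inner_arc_exists:
  assumes r0: "0 < r" and K: "is_rgraph r K" and Y: "Y \<subseteq> verts K" "card (cutset K Y) = r" "card Y \<ge> 2"
  shows "\<exists>e\<in>arcs K. src K e \<in> Y \<and> tgt K e \<in> Y"
proof (rule ccontr)
  assume no: "\<not> ?thesis"
  have "cutset K {y} = cutset K Y" if y: "y \<in> Y" for y
  proof (rule card_subset_eq[OF finite_cutset[OF is_rgraphD(1)[OF K]]])
    show "cutset K {y} \<subseteq> cutset K Y" using no y by (auto simp: cutset_def)
    show "card (cutset K {y}) = card (cutset K Y)" using Y(1,2) y is_rgraphD(4)[OF K, of y] by auto
  qed
  moreover obtain a b where ab: "a \<in> Y" "b \<in> Y" "a \<noteq> b"
  proof -
    have "\<not> is_singleton Y" "Y \<noteq> {}" using Y(3) by (auto simp: is_singleton_altdef)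
    then show ?thesis using that by (metis is_singletonI' )
  qed
  ultimately have eq: "cutset K {a} = cutset K Y" "cutset K {b} = cutset K Y" by auto
  have "cutset K Y \<noteq> {}" using Y(2) r0 by auto
  then obtain e where "e \<in> cutset K Y" by blast
  then have "e \<in> cutset K {a}" "e \<in> cutset K {b}" using eq by auto
  then have "e \<in> arcs K" "src K e \<in> Y \<and> tgt K e \<in> Y" using ab by (auto simp: cutset_def)
  then show False using no by blast
qed

text \<open>An automorphism \<open>g\<close> carries the cut of \<open>Y\<close> to the star of
  \<open>v\<close>, and the arcs inside and outside \<open>Y\<close> to two classes that partition
  the arcs away from \<open>v\<close>. Some vertex \<open>u\<close> meets both classes. Uncrossing
  the preimage of its star with \<open>Y\<close> gives a tight cut that keeps the inside part of
  this preimage and drops the outside part. Its image is the cut of a set \<open>Q\<close> whose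
  boundary arcs all end in \<open>u\<close> or \<open>v\<close>.\<close>

lemma tight_nontrivial_sep_pair:
  assumes r: "3 \<le> r" and m: "minimal_universal r K" and Y: "Y \<subseteq> verts K" "odd (card Y)" "card (cutset K Y) = r"
    and nt: "card Y \<noteq> 1" "card (verts K - Y) \<noteq> 1" and v: "v \<in> verts K"
  shows "\<exists>u A. sep_pair K v u A"
proof -
  note K = minimal_rgraph[OF r m]
  note gr = is_rgraphD(1)[OF K]
  have r0: "0 < r" using r by simp
  have even: "even (card (verts K))" using rgraph_even_verts[OF K r0] .
  have fY: "finite Y" using Y(1) is_rgraphD(7)[OF K] finite_subset by blast
  obtain g where g: "cut_coloring r K K g" "bij_betw g (arcs K) (arcs K)" "g ` cutset K Y = cutset K {v}"
    using tight_to_star[OF r m Y v] .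
  have inj: "inj_on g (arcs K)" and surj: "g ` arcs K = arcs K" using g(2) by (auto simp: bij_betw_def)
  define E1 where "E1 = {e \<in> arcs K. src K e \<in> Y \<and> tgt K e \<in> Y}"
  define E2 where "E2 = {e \<in> arcs K. src K e \<notin> Y \<and> tgt K e \<notin> Y}"
  have part: "e \<in> E1 \<or> e \<in> E2 \<or> e \<in> cutset K Y" if "e \<in> arcs K" for e using that by (auto simp: E1_def E2_def cutset_def)
  have disj: "e \<notin> cutset K Y" if "e \<in> E1 \<or> e \<in> E2" for e using that by (auto simp: E1_def E2_def cutset_def)
  have sub: "E1 \<subseteq> arcs K" "E2 \<subseteq> arcs K" by (auto simp: E1_def E2_def)
  have gmem: "g d \<in> g ` S \<longleftrightarrow> d \<in> S" if "d \<in> arcs K" "S \<subseteq> arcs K" for d S using that inj by (auto dest: inj_onD)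
  have "card Y \<noteq> 0" using Y(2) by presburger
  then have "card Y \<ge> 2" using nt(1) by simp
  then have E1: "E1 \<noteq> {}" using inner_arc_exists[OF r0 K Y(1,3)] by (auto simp: E1_def)
  have oddZ: "odd (card (verts K - Y))"
    using card_Diff_subset[OF fY Y(1)] card_mono[OF is_rgraphD(7)[OF K] Y(1)] even Y(2) by simp
  then have "card (verts K - Y) \<noteq> 0" by presburger
  then have "card (verts K - Y) \<ge> 2" using nt(2) by simp
  then have "\<exists>e\<in>arcs K. src K e \<in> verts K - Y \<and> tgt K e \<in> verts K - Y"
    using inner_arc_exists[OF r0 K, of "verts K - Y"] cutset_compl[OF gr] Y(3) by auto
  then have E2: "E2 \<noteq> {}" by (auto simp: E2_def)
  have gE: "e \<in> g ` E1 \<or> e \<in> g ` E2 \<or> e \<in> cutset K {v}" if "e \<in> arcs K" for e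
    using that surj part g(3) by blast
  have gv: "g d \<notin> cutset K {v}" if "d \<in> E1 \<or> d \<in> E2" for d
    using gmem[of d "cutset K Y"] that disj[OF that] sub cutset_subset[of K Y] g(3) by auto
  have other_end_end: "\<exists>u\<in>verts K - {v}. g d \<in> cutset K {u}" if "d \<in> E1 \<or> d \<in> E2" for d
  proof -
    have e: "g d \<in> arcs K" using that sub surj by blast
    then have "src K (g d) \<noteq> v" "g d \<in> cutset K {src K (g d)}"
      using gv[OF that] is_rgraphD(5)[OF K e] by (auto simp: cutset_def)
    then show ?thesis using is_rgraphD(9)[OF K e] by blast
  qed
  \<comment> \<open>If every other vertex met one class only, no arc could join vertices of
    different classes, and \<open>v\<close> would be a cut vertex.\<close>
  have "\<exists>u\<in>verts K - {v}. cutset K {u} \<inter> g ` E1 \<noteq> {} \<and> cutset K {u} \<inter> g ` E2 \<noteq> {}"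
  proof (rule ccontr)
    assume pure: "\<not> ?thesis"
    let ?U = "{u \<in> verts K - {v}. cutset K {u} \<inter> g ` E2 = {}}"
    have "?U = {} \<or> ?U = verts K - {v}"
    proof (rule no_cut_vertex[OF r0 K v])
      fix p q assume pq: "p \<in> ?U" "adj K p q"
      show "q \<in> ?U \<or> q = v"
      proof (rule ccontr)
        assume c: "\<not> (q \<in> ?U \<or> q = v)"
        have qV: "q \<in> verts K" "p \<noteq> q" using adjD[OF K pq(2)] by auto
        then have "cutset K {q} \<inter> g ` E1 = {}" using c pure by blast
        moreover have "cutset K {p} \<inter> g ` E2 = {}" using pq(1) by blast
        moreover obtain e where e: "e \<in> arcs K" "{src K e, tgt K e} = {p, q}" using pq(2) by (auto simp: adj_def)
        then have "e \<in> cutset K {p}" "e \<in> cutset K {q}" using qV(2) by (auto simp: cutset_def doubleton_eq_iff)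
        moreover have "e \<notin> cutset K {v}" using e pq(1) c by (auto simp: cutset_def doubleton_eq_iff)
        ultimately show False using gE[OF e(1)] by blast
      qed
    qed blast
    then show False
    proof
      assume U: "?U = {}"
      obtain d where d: "d \<in> E1" using E1 by blast
      then obtain u where u: "u \<in> verts K - {v}" "g d \<in> cutset K {u}" using other_end_end by blast
      have "cutset K {u} \<inter> g ` E2 \<noteq> {}" using U u(1) by blast
      moreover have "cutset K {u} \<inter> g ` E1 \<noteq> {}" using u(2) d by blast
      ultimately show False using pure u(1) by blast
    next
      assume U: "?U = verts K - {v}"
      obtain d where d: "d \<in> E2" using E2 by blast
      then obtain u where u: "u \<in> verts K - {v}" "g d \<in> cutset K {u}" using other_end_end by blast
      then have "u \<in> ?U" using U by simp
      then show False using u(2) d by blast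
    qed
  qed
  then obtain u where u: "u \<in> verts K" "u \<noteq> v" and m1: "cutset K {u} \<inter> g ` E1 \<noteq> {}" and m2: "cutset K {u} \<inter> g ` E2 \<noteq> {}" by blast
  obtain S where S: "tight r K S" "g ` S = cutset K {u}" using endo_tight_preimage[OF K g(1,2) star_tight[OF K u(1)]] by blast
  obtain W0 where W0: "W0 \<subseteq> verts K" "odd (card W0)" "S = cutset K W0" "card S = r"
    using S(1) unfolding rgraph_tight_iff[OF K] by blast
  have fin: "finite X" if "X \<subseteq> verts K" for X using that is_rgraphD(7)[OF K] finite_subset by blast
  have oddc: "odd (card (verts K - X))" if "X \<subseteq> verts K" "odd (card X)" for X
    using card_Diff_subset[OF fin[OF that(1)] that(1)] card_mono[OF is_rgraphD(7)[OF K] that(1)] even that(2) by simp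
  \<comment> \<open>Passing to the complement of \<open>W0\<close> if necessary makes the
    intersection with \<open>Y\<close> odd, so that submodularity applies to two odd sets.\<close>
  obtain W where W: "W \<subseteq> verts K" "odd (card W)" "S = cutset K W" "odd (card (W \<inter> Y))"
  proof (cases "odd (card (W0 \<inter> Y))")
    case True then show ?thesis using that[of W0] W0 by blast
  next
    case False
    have "(verts K - W0) \<inter> Y = Y - W0" using Y(1) by blast
    moreover have "card Y = card (Y \<inter> W0) + card (Y - W0)" using card_Int_Diff[OF fY] .
    ultimately have "odd (card ((verts K - W0) \<inter> Y))" using False Y(2) by (simp add: Int_commute)
    then show ?thesis using that[of "verts K - W0"] oddc[OF W0(1,2)] W0(3) cutset_compl[OF gr] by blast
  qed
  have "card (W \<union> Y) + card (W \<inter> Y) = card W + card Y" using card_Un_Int[OF fin[OF W(1)] fY] by simp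
  then have "odd (card (W \<union> Y))" using W(2,4) Y(2) by presburger
  then have "r \<le> card (cutset K (W \<union> Y))" "r \<le> card (cutset K (W \<inter> Y))"
    using is_rgraphD(11)[OF K, of "W \<union> Y"] is_rgraphD(11)[OF K, of "W \<inter> Y"] W(1,4) Y(1) by blast+
  then have cD: "card (cutset K (W \<inter> Y)) = r"
    using cutset_submodular[OF is_rgraphD(8)[OF K], of W Y] Y(3) W0(4) W(3) by simp
  let ?D = "cutset K (W \<inter> Y)"
  have "tight r K ?D" unfolding rgraph_tight_iff[OF K] using W(1,4) cD by blast
  then have "tight r K (g ` ?D)" using cut_coloring_push_tight(2)[OF gr K g(1)] by blast
  then obtain Q0 where Q0: "Q0 \<subseteq> verts K" "odd (card Q0)" "g ` ?D = cutset K Q0"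
    unfolding rgraph_tight_iff[OF K] by blast
  obtain Q where Q: "Q \<subseteq> verts K" "odd (card Q)" "g ` ?D = cutset K Q" "v \<notin> Q"
  proof (cases "v \<in> Q0")
    case True then show ?thesis using that[of "verts K - Q0"] oddc[OF Q0(1,2)] Q0(3) cutset_compl[OF gr] by blast
  qed (use Q0 in blast)
  \<comment> \<open>Intersecting with \<open>Y\<close> changes nothing for arcs inside
    \<open>Y\<close> and removes all arcs outside it from the cut.\<close>
  have D1: "d \<in> ?D \<longleftrightarrow> d \<in> S" if "d \<in> E1" for d using that unfolding W(3) by (auto simp: E1_def cutset_def)
  have D2: "d \<notin> ?D" if "d \<in> E2" for d using that by (auto simp: E2_def cutset_def)
  have Ssub: "S \<subseteq> arcs K" using tight_subset[OF S(1)] .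
  have g1: "g d \<in> cutset K Q \<longleftrightarrow> g d \<in> cutset K {u}" if "d \<in> E1" for d
    using gmem[of d ?D] gmem[of d S] D1[OF that] that sub(1) cutset_subset[of K "W \<inter> Y"] Ssub Q(3) S(2) by auto
  have g2: "g d \<notin> cutset K Q" if "d \<in> E2" for d
    using gmem[of d ?D] D2[OF that] that sub(2) cutset_subset[of K "W \<inter> Y"] Q(3) by auto
  let ?A = "Q - {u}"
  have sepA: "q \<in> ?A \<or> q = v \<or> q = u" if pq: "p \<in> ?A" "adj K p q" for p q
  proof (rule ccontr)
    assume c: "\<not> ?thesis"
    obtain e where e: "e \<in> arcs K" "{src K e, tgt K e} = {p, q}" using pq(2) by (auto simp: adj_def)
    have "e \<in> cutset K Q" "e \<notin> cutset K {v}" "e \<notin> cutset K {u}"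
      using e pq(1) c Q(4) by (auto simp: cutset_def doubleton_eq_iff)
    then show False using gE[OF e(1)] g1 g2 by blast
  qed
  have ne1: "?A \<noteq> {}"
  proof
    assume "?A = {}"
    moreover have "Q \<noteq> {}" using Q(2) by auto
    ultimately have "Q = {u}" by blast
    then show False using m2 g2 by auto
  qed
  \<comment> \<open>\<open>Q\<close> is odd and the number of vertices is even, so \<open>Q\<close>
    cannot miss exactly \<open>u\<close> and \<open>v\<close>. If it missed only \<open>v\<close>,
    its cut would be the star of \<open>v\<close>, which contains no arc of the first class,
    although \<open>u\<close> meets that class.\<close>
  have ne2: "verts K - {v, u} - ?A \<noteq> {}"
  proof
    assume e: "verts K - {v, u} - ?A = {}"
    have "Q \<noteq> verts K - {v, u}"
    proof
      assume "Q = verts K - {v, u}"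
      then have "card Q = card (verts K) - 2" using u v by (simp add: card_Diff_subset)
      then show False using Q(2) even by simp
    qed
    then have "Q = verts K - {v}" using e Q(1,4) by blast
    then have "cutset K Q = cutset K {v}" using cutset_compl[OF gr] by simp
    moreover obtain d where d: "d \<in> E1" "g d \<in> cutset K {u}" using m1 by blast
    ultimately have "g d \<in> cutset K {v}" using g1 by blast
    then show False using gv d(1) by blast
  qed
  have "\<forall>p\<in>?A. \<forall>q. adj K p q \<longrightarrow> q \<in> ?A \<or> q = v \<or> q = u" using sepA by blast
  moreover have "?A \<subseteq> verts K - {v, u}" using Q(1,4) by blast
  ultimately have "sep_pair K v u ?A" unfolding sep_pair_def using ne1 ne2 u v by simp
  then show ?thesis by blast
qed

theorem minimal_tight_trivial:
  assumes r: "3 \<le> r" and m: "minimal_universal r K" and simple: "parallel_arcs K = {}" and S: "tight r K S"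
  shows "\<exists>u\<in>verts K. S = cutset K {u}"
proof -
  note K = minimal_rgraph[OF r m]
  obtain Y where Y: "Y \<subseteq> verts K" "odd (card Y)" "S = cutset K Y" "card S = r"
    using S unfolding rgraph_tight_iff[OF K] by blast
  have "card Y = 1 \<or> card (verts K - Y) = 1"
  proof (rule ccontr)
    assume "\<not> ?thesis"
    then show False using sep_pair_vertex_free[OF r K simple] tight_nontrivial_sep_pair[OF r m Y(1,2)] Y(3,4) by blast
  qed
  then show ?thesis
  proof
    assume "card Y = 1"
    then obtain u where "Y = {u}" by (rule card_1_singletonE)
    then show ?thesis using Y by auto
  next
    assume "card (verts K - Y) = 1"
    then obtain u where "verts K - Y = {u}" by (rule card_1_singletonE)
    then show ?thesis using Y(3) cutset_compl[OF is_rgraphD(1)[OF K], of Y] by auto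
  qed
qed

subsection \<open>The Petersen graph with multiplied spokes\<close>

text \<open>The vertices \<open>(True, i)\<close> and \<open>(False, i)\<close> form an outer pentagon and an inner pentagram. The
  arcs with second component 0 and 1 are the edges of these two cycles; all the others are
  spokes, so that there are r - 2 parallel spokes for each i.\<close>

definition fat_petersen :: "nat \<Rightarrow> (bool \<times> nat, nat \<times> nat) graft" where
  "fat_petersen r = \<lparr>verts = UNIV \<times> {..<5}, arcs = {..<5} \<times> {..<r},
     src = (\<lambda>(i, j). (j \<noteq> 1, i)),
     tgt = (\<lambda>(i, j). if j = 0 then (True, (i + 1) mod 5) else if j = 1 then (False, (i + 2) mod 5) else (False, i)),
     terminals = UNIV \<times> {..<5}\<rparr>"

text \<open>Sums of indicators must stay sums here, so that they can be split and expanded term by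
  term.\<close>

declare sum_of_bool_eq [simp del]

lemma sum_lessThan_5: "(\<Sum>i<5. f i) = f 0 + f 1 + f 2 + f 3 + f (4::nat)"
  by (simp add: eval_nat_numeral)

lemma fat_petersen_card_cutset:
  assumes r: "3 \<le> r"
  shows "card (cutset (fat_petersen r) X) = (\<Sum>i<5. of_bool (((True, i) \<in> X) \<noteq> ((True, (i + 1) mod 5) \<in> X)))
     + (\<Sum>i<5. of_bool (((False, i) \<in> X) \<noteq> ((False, (i + 2) mod 5) \<in> X)))
     + (r - 2) * (\<Sum>i<5. of_bool (((True, i) \<in> X) \<noteq> ((False, i) \<in> X)))"
proof -
  let ?P = "fat_petersen r"
  have fin: "finite (arcs ?P)" by (simp add: fat_petersen_def)
  let ?h = "\<lambda>i j. of_bool ((src ?P (i, j) \<in> X) \<noteq> (tgt ?P (i, j) \<in> X)) :: nat"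
  have "arcs ?P = {..<5} \<times> {..<r}" by (simp add: fat_petersen_def)
  then have eq: "card (cutset ?P X) = (\<Sum>i<5. \<Sum>j<r. ?h i j)"
    unfolding card_cutset_sum[OF fin] by (simp only: sum.cartesian_product')
  have inner: "(\<Sum>j<r. ?h i j) = of_bool (((True, i) \<in> X) \<noteq> ((True, (i + 1) mod 5) \<in> X))
     + of_bool (((False, i) \<in> X) \<noteq> ((False, (i + 2) mod 5) \<in> X)) + (r - 2) * of_bool (((True, i) \<in> X) \<noteq> ((False, i) \<in> X))" for i
  proof -
    have "{..<r} = insert 0 (insert 1 {2..<r})" using r by auto
    then have "(\<Sum>j<r. ?h i j) = ?h i 0 + ?h i 1 + (\<Sum>j\<in>{2..<r}. ?h i j)" by simp
    also have "(\<Sum>j\<in>{2..<r}. ?h i j) = (\<Sum>j\<in>{2..<r}. of_bool (((True, i) \<in> X) \<noteq> ((False, i) \<in> X)))"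
      by (rule sum.cong) (auto simp: fat_petersen_def)
    finally show ?thesis by (simp add: fat_petersen_def)
  qed
  show ?thesis unfolding eq inner sum.distrib sum_distrib_left ..
qed

lemma cycle5_boundary:
  fixes a b c d e :: bool
  assumes "\<not> (a = b \<and> b = c \<and> c = d \<and> d = e)"
  shows "(2::nat) \<le> of_bool (a \<noteq> b) + of_bool (b \<noteq> c) + of_bool (c \<noteq> d) + of_bool (d \<noteq> e) + of_bool (e \<noteq> a)"
  using assms by (cases a; cases b; cases c; cases d; cases e) simp_all

text \<open>For an odd set, the number \<open>s\<close> of positions whose spokes are cut is odd. If
  it is at least 3, the spokes alone contribute \<open>3 * (r - 2) \<ge> r\<close> arcs. If it is 1,
  the \<open>r - 2\<close> spokes are joined by two arcs of a cycle: were neither cycle cut, each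
  would lie entirely inside or outside, and \<open>s\<close> would be 0 or 5.\<close>

lemma fat_petersen_rgraph:
  assumes r: "3 \<le> r"
  shows "is_rgraph r (fat_petersen r)"
proof (rule is_rgraphI)
  let ?P = "fat_petersen r"
  note card = fat_petersen_card_cutset[OF r]
  have vP: "verts ?P = UNIV \<times> {..<5}" by (simp add: fat_petersen_def)
  show "finite (verts ?P)" "finite (arcs ?P)" "verts ?P \<noteq> {}" "terminals ?P = verts ?P"
    by (auto simp: fat_petersen_def lessThan_empty_iff)
  show "src ?P e \<in> verts ?P \<and> tgt ?P e \<in> verts ?P \<and> src ?P e \<noteq> tgt ?P e" if "e \<in> arcs ?P" for e
  proof -
    obtain i j where e: "e = (i, j)" by fastforce
    have i: "i < 5" using that e by (simp add: fat_petersen_def)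
    have "(i + 1) mod 5 \<noteq> i" "(i + 2) mod 5 \<noteq> i" using i by presburger+
    then show ?thesis using i by (auto simp: fat_petersen_def e)
  qed
  show "card (cutset ?P {v}) = r" if v: "v \<in> verts ?P" for v
  proof -
    obtain b i where bi: "v = (b, i)" "i < 5" using v vP by blast
    then have "i = 0 \<or> i = 1 \<or> i = 2 \<or> i = 3 \<or> i = 4" by auto
    then show ?thesis unfolding bi(1) card sum_lessThan_5 using r by (cases b) auto
  qed
  show "r \<le> card (cutset ?P X)" if X: "X \<subseteq> verts ?P" "odd (card X)" for X
  proof -
    define a b where "a = (\<lambda>i. (True, i) \<in> X)" and "b = (\<lambda>i. (False, i) \<in> X)"
    have "X = {v \<in> verts ?P. v \<in> X}" using X(1) by blast
    then have "card X = (\<Sum>v\<in>verts ?P. of_bool (v \<in> X))"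
      using card_filter_sum[of "verts ?P" "\<lambda>v. v \<in> X"] vP by simp
    also have "\<dots> = (\<Sum>i<5. of_bool (a i) + of_bool (b i))"
      unfolding vP sum.cartesian_product' UNIV_bool by (simp add: a_def b_def sum.distrib add.commute)
    finally have cX: "card X = (\<Sum>i<5. of_bool (a i) + of_bool (b i))" .
    define s where "s = (\<Sum>i<5. of_bool (a i \<noteq> b i) :: nat)"
    have "odd s"
    proof -
      have *: "odd (of_bool p + of_bool q :: nat) \<longleftrightarrow> odd (of_bool (p \<noteq> q) :: nat)" for p q by auto
      show ?thesis using X(2) * unfolding cX s_def odd_sum_iff[OF finite_lessThan] by simp
    qed
    define co cn where "co = (\<Sum>i<5. of_bool (a i \<noteq> a ((i + 1) mod 5)) :: nat)"
      and "cn = (\<Sum>i<5. of_bool (b i \<noteq> b ((i + 2) mod 5)) :: nat)"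
    have c: "card (cutset ?P X) = co + cn + (r - 2) * s" unfolding card co_def cn_def s_def a_def b_def ..
    show ?thesis
    proof (cases "s = 1")
      case True
      have "2 \<le> co \<or> 2 \<le> cn"
      proof (rule ccontr)
        assume n: "\<not> ?thesis"
        have mods: "(0 + 1) mod 5 = (1::nat)" "(1 + 1) mod 5 = (2::nat)" "(2 + 1) mod 5 = (3::nat)"
          "(3 + 1) mod 5 = (4::nat)" "(4 + 1) mod 5 = (0::nat)" "(0 + 2) mod 5 = (2::nat)" "(1 + 2) mod 5 = (3::nat)"
          "(2 + 2) mod 5 = (4::nat)" "(3 + 2) mod 5 = (0::nat)" "(4 + 2) mod 5 = (1::nat)" by simp_all
        have "co = of_bool (a 0 \<noteq> a 1) + of_bool (a 1 \<noteq> a 2) + of_bool (a 2 \<noteq> a 3) + of_bool (a 3 \<noteq> a 4) + of_bool (a 4 \<noteq> a 0)"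
          unfolding co_def sum_lessThan_5 mods ..
        then have A: "a 0 = a 1 \<and> a 1 = a 2 \<and> a 2 = a 3 \<and> a 3 = a 4" using cycle5_boundary[of "a 0" "a 1" "a 2" "a 3" "a 4"] n by linarith
        have "cn = of_bool (b 0 \<noteq> b 2) + of_bool (b 2 \<noteq> b 4) + of_bool (b 4 \<noteq> b 1) + of_bool (b 1 \<noteq> b 3) + of_bool (b 3 \<noteq> b 0)"
          unfolding cn_def sum_lessThan_5 mods by (simp only: add_ac)
        then have B: "b 0 = b 2 \<and> b 2 = b 4 \<and> b 4 = b 1 \<and> b 1 = b 3" using cycle5_boundary[of "b 0" "b 2" "b 4" "b 1" "b 3"] n by linarith
        have "s = 0 \<or> s = 5" unfolding s_def sum_lessThan_5 using A B by (cases "a 0"; cases "b 0") auto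
        then show False using True by simp
      qed
      then show ?thesis unfolding c True using r by auto
    next
      case False
      then have "3 \<le> s" using \<open>odd s\<close> by presburger
      then have "(r - 2) * 3 \<le> (r - 2) * s" by simp
      then show ?thesis unfolding c using r by linarith
    qed
  qed
  show "X = {} \<or> X = verts ?P" if X: "X \<subseteq> verts ?P" "cutset ?P X = {}" for X
  proof -
    have "card (cutset ?P X) = 0" using X(2) by simp
    moreover have *: "a = 0 \<and> c = 0" if "a + b + (r - 2) * c = 0" for a b c :: nat using that r by simp
    ultimately have "(\<Sum>i<5. of_bool (((True, i) \<in> X) \<noteq> ((True, (i + 1) mod 5) \<in> X)) :: nat) = 0 \<and>
      (\<Sum>i<5. of_bool (((True, i) \<in> X) \<noteq> ((False, i) \<in> X)) :: nat) = 0" unfolding card by (intro *)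
    then have z: "\<forall>i\<in>{..<5}. ((True, i) \<in> X) = ((True, (i + 1) mod 5) \<in> X)"
      "\<forall>i\<in>{..<5}. ((True, i) \<in> X) = ((False, i) \<in> X)"
      unfolding sum_eq_0_iff[OF finite_lessThan] of_bool_eq_0_iff not_not by (rule conjunct1, rule conjunct2)
    have z1: "((True, i) \<in> X) = ((True, (i + 1) mod 5) \<in> X)" if "i < 5" for i using z(1) that by blast
    have z2: "((True, i) \<in> X) = ((False, i) \<in> X)" if "i < 5" for i using z(2) that by blast
    have c: "((True, 0) \<in> X) = ((True, 1) \<in> X)" "((True, 1) \<in> X) = ((True, 2) \<in> X)"
      "((True, 2) \<in> X) = ((True, 3) \<in> X)" "((True, 3) \<in> X) = ((True, 4) \<in> X)"
      using z1[of 0] z1[of 1] z1[of 2] z1[of 3] by (simp_all add: numeral_2_eq_2)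
    have c0: "(True, i) \<in> X \<longleftrightarrow> (True, 0) \<in> X" if "i < 5" for i
    proof -
      have "i = 0 \<or> i = 1 \<or> i = 2 \<or> i = 3 \<or> i = 4" using that by auto
      then show ?thesis using c by (elim disjE) simp_all
    qed
    have all: "(b, i) \<in> X \<longleftrightarrow> (True, 0) \<in> X" if "i < 5" for b i
      by (cases b) (simp_all only: z2[OF that, symmetric] c0[OF that])
    show ?thesis
    proof (cases "(True, 0) \<in> X")
      case True
      have "v \<in> X" if "v \<in> UNIV \<times> {..<5}" for v
        using all[of "snd v" "fst v"] that True by (simp add: mem_Times_iff)
      then have "verts ?P \<subseteq> X" unfolding vP by (rule subsetI)
      then show ?thesis using X(1) by blast
    next
      case False
      have "v \<notin> X" for v
      proof
        assume "v \<in> X"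
        then show False using all[of "snd v" "fst v"] X(1) False unfolding vP by (auto simp: mem_Times_iff)
      qed
      then show ?thesis by blast
    qed
  qed
qed

lemma less_5_cases: "(i::nat) < 5 \<Longrightarrow> i = 0 \<or> i = 1 \<or> i = 2 \<or> i = 3 \<or> i = 4"
  by auto

text \<open>The residues \<open>i + 4\<close> and \<open>i + 3\<close> are \<open>i - 1\<close> and
  \<open>i - 2\<close> modulo 5: they name the cycle arcs that enter the vertex.\<close>

lemma fat_petersen_star:
  assumes "3 \<le> r" "i < 5"
  shows "cutset (fat_petersen r) {(True, i)} = {(i, 0), ((i + 4) mod 5, 0)} \<union> {i} \<times> {2..<r}"
    "cutset (fat_petersen r) {(False, i)} = {(i, 1), ((i + 3) mod 5, 1)} \<union> {i} \<times> {2..<r}"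
proof -
  have m: "(k + 1) mod 5 = i \<longleftrightarrow> k = (i + 4) mod 5" "(k + 2) mod 5 = i \<longleftrightarrow> k = (i + 3) mod 5" if "k < 5" for k
    using less_5_cases[OF that] less_5_cases[OF assms(2)] by (elim disjE; simp)+
  have n: "(i + 4) mod 5 \<noteq> i" "(i + 3) mod 5 \<noteq> i" "(i + 4) mod 5 < 5" "(i + 3) mod 5 < 5" 
    "(i + 1) mod 5 \<noteq> i" "(i + 2) mod 5 \<noteq> i" using less_5_cases[OF assms(2)] by (elim disjE; simp)+
  show "cutset (fat_petersen r) {(True, i)} = {(i, 0), ((i + 4) mod 5, 0)} \<union> {i} \<times> {2..<r}"
  proof (rule set_eqI)
    fix e :: "nat \<times> nat"
    obtain k j where e: "e = (k, j)" by fastforce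
    consider "j = 0" | "j = 1" | "j \<ge> 2" by linarith
    then show "e \<in> cutset (fat_petersen r) {(True, i)} \<longleftrightarrow> e \<in> {(i, 0), ((i + 4) mod 5, 0)} \<union> {i} \<times> {2..<r}"
    proof cases
      case 1
      then show ?thesis using assms m(1)[of k] n unfolding e by (auto simp: cutset_def fat_petersen_def)
    qed (use assms in \<open>auto simp: e cutset_def fat_petersen_def\<close>)
  qed
  show "cutset (fat_petersen r) {(False, i)} = {(i, 1), ((i + 3) mod 5, 1)} \<union> {i} \<times> {2..<r}"
  proof (rule set_eqI)
    fix e :: "nat \<times> nat"
    obtain k j where e: "e = (k, j)" by fastforce
    consider "j = 0" | "j = 1" | "j \<ge> 2" by linarith
    then show "e \<in> cutset (fat_petersen r) {(False, i)} \<longleftrightarrow> e \<in> {(i, 1), ((i + 3) mod 5, 1)} \<union> {i} \<times> {2..<r}"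
    proof cases
      case 2
      then show ?thesis using assms m(2)[of k] n unfolding e by (auto simp: cutset_def fat_petersen_def)
    qed (use assms in \<open>auto simp: e cutset_def fat_petersen_def\<close>)
  qed
qed

text \<open>The two colourings are of the pentagon and the pentagram, with the same two cycle
  colours at both ends of each spoke. No pair of vertices is adjacent in both cycles, so no colour
  can occur exactly once on either; a matching in a 5-cycle has at most two edges, so each occurs
  exactly twice, contradicting five edges.\<close>

lemma pentagram_colouring:
  assumes "{p0, p4} = {n0, n3} \<and> p0 \<noteq> p4 \<and> n0 \<noteq> n3" "{p1, p0} = {n1, n4} \<and> p1 \<noteq> p0 \<and> n1 \<noteq> n4"
    "{p2, p1} = {n2, n0} \<and> p2 \<noteq> p1 \<and> n2 \<noteq> n0" "{p3, p2} = {n3, n1} \<and> p3 \<noteq> p2 \<and> n3 \<noteq> n1"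
    "{p4, p3} = {n4, n2} \<and> p4 \<noteq> p3 \<and> n4 \<noteq> n2"
  shows False
  using assms unfolding doubleton_eq_iff by (elim conjE disjE; hypsubst?; simp)

text \<open>If both ends of each spoke see the same colours, each colour of the pentagram is used on the
  same vertices of the pentagon. So it is used twice on each, although the cycles have odd length.\<close>

lemma fat_petersen_spokes_rich:
  assumes r: "3 \<le> r" and inj: "\<And>v. v \<in> verts (fat_petersen r) \<Longrightarrow> inj_on f (cutset (fat_petersen r) {v})"
    and eq: "\<And>i. i < 5 \<Longrightarrow> f ` cutset (fat_petersen r) {(True, i)} = f ` cutset (fat_petersen r) {(False, i)}"
  shows False
proof -
  define p n where "p = (\<lambda>i. f (i, 0))" and "n = (\<lambda>i. f (i, 1))"
  have star: "{p i, p ((i + 4) mod 5)} = {n i, n ((i + 3) mod 5)} \<and> p i \<noteq> p ((i + 4) mod 5) \<and> n i \<noteq> n ((i + 3) mod 5)" if i: "i < 5" for i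
  proof -
    let ?S = "{i} \<times> {2..<r}"
    note s = fat_petersen_star[OF r i]
    have v: "(True, i) \<in> verts (fat_petersen r)" "(False, i) \<in> verts (fat_petersen r)" using i by (auto simp: fat_petersen_def)
    have ne: "(i + 4) mod 5 \<noteq> i" "(i + 3) mod 5 \<noteq> i" using i by presburger+
    have i1: "inj_on f ({(i, 0), ((i + 4) mod 5, 0)} \<union> ?S)" and i2: "inj_on f ({(i, 1), ((i + 3) mod 5, 1)} \<union> ?S)"
      using inj[OF v(1)] inj[OF v(2)] unfolding s by auto
    have d1: "f ` {(i, 0), ((i + 4) mod 5, 0)} \<inter> f ` ?S = {}"
      using inj_on_image_Int[OF i1, of "{(i, 0), ((i + 4) mod 5, 0)}" ?S] by auto
    have d2: "f ` {(i, 1), ((i + 3) mod 5, 1)} \<inter> f ` ?S = {}"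
      using inj_on_image_Int[OF i2, of "{(i, 1), ((i + 3) mod 5, 1)}" ?S] by auto
    have "f ` {(i, 0), ((i + 4) mod 5, 0)} \<union> f ` ?S = f ` {(i, 1), ((i + 3) mod 5, 1)} \<union> f ` ?S"
      using eq[OF i] unfolding s image_Un .
    then have "f ` {(i, 0), ((i + 4) mod 5, 0)} = f ` {(i, 1), ((i + 3) mod 5, 1)}" using d1 d2 by blast
    moreover have "f (i, 0) \<noteq> f ((i + 4) mod 5, 0)" using i1 ne by (auto simp: inj_on_def)
    moreover have "f (i, 1) \<noteq> f ((i + 3) mod 5, 1)" using i2 ne by (auto simp: inj_on_def)
    ultimately show ?thesis by (simp add: p_def n_def)
  qed
  have mods: "(0 + 4) mod 5 = (4::nat)" "(0 + 3) mod 5 = (3::nat)" "(1 + 4) mod 5 = (0::nat)" "(1 + 3) mod 5 = (4::nat)"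
    "(2 + 4) mod 5 = (1::nat)" "(2 + 3) mod 5 = (0::nat)" "(3 + 4) mod 5 = (2::nat)" "(3 + 3) mod 5 = (1::nat)"
    "(4 + 4) mod 5 = (3::nat)" "(4 + 3) mod 5 = (2::nat)" by simp_all
  have lt: "0 < (5::nat)" "1 < (5::nat)" "2 < (5::nat)" "3 < (5::nat)" "4 < (5::nat)" by simp_all
  show False
    by (rule pentagram_colouring[OF star[OF lt(1), unfolded mods] star[OF lt(2), unfolded mods]
      star[OF lt(3), unfolded mods] star[OF lt(4), unfolded mods] star[OF lt(5), unfolded mods]])
qed

text \<open>A graph with two vertices has a single tight cut. Every star of the Petersen graph with
  multiplied spokes would then receive the same colours, in particular the two ends of each
  spoke.\<close>

lemma minimal_simple:
  assumes r: "3 \<le> r" and m: "minimal_universal r K"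
  shows "parallel_arcs K = {}"
proof (rule ccontr)
  note K = minimal_rgraph[OF r m]
  assume "parallel_arcs K \<noteq> {}"
  then obtain a b where ab: "verts K = {a, b}" "a \<noteq> b" using minimal_parallel[OF r m] by blast
  have t: "S = cutset K {a}" if S: "tight r K S" for S
  proof -
    obtain X where X: "X \<subseteq> {a, b}" "odd (card X)" "S = cutset K X"
      using S unfolding rgraph_tight_iff[OF K] ab(1) by blast
    have "X = {} \<or> X = {a} \<or> X = {b} \<or> X = {a, b}" using X(1) by blast
    then have "X = {a} \<or> X = {b}" using X(2) ab(2) by auto
    moreover have "{b} = verts K - {a}" using ab by blast
    ultimately show ?thesis using X(3) cutset_compl[OF is_rgraphD(1)[OF K], of "{a}"] by metis
  qed
  obtain f where f: "cut_coloring r K (fat_petersen r) f"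
    using universal_covers[OF _ fat_petersen_rgraph[OF r]] m unfolding minimal_universal_def covers_def by blast
  show False
  proof (rule fat_petersen_spokes_rich[OF r])
    show "inj_on f (cutset (fat_petersen r) {v})" if "v \<in> verts (fat_petersen r)" for v
      using f that by (simp add: cut_coloring_def)
    show "f ` cutset (fat_petersen r) {(True, i)} = f ` cutset (fat_petersen r) {(False, i)}" if "i < 5" for i
    proof -
      have "(b, i) \<in> verts (fat_petersen r)" for b using that by (simp add: fat_petersen_def)
      then have "f ` cutset (fat_petersen r) {(b, i)} = cutset K {a}" for b using f t unfolding cut_coloring_def by blast
      then show ?thesis by metis
    qed
  qed
qed

lemma simple_stars:
  assumes K: "is_rgraph r K" and simple: "parallel_arcs K = {}"
    and d: "d \<in> cutset K {a}" "d \<in> cutset K {b}" and e: "e \<in> cutset K {a}" "e \<in> cutset K {b}" and ne: "d \<noteq> e"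
  shows "a = b"
proof (rule ccontr)
  assume ab: "a \<noteq> b"
  have "{src K x, tgt K x} = {a, b}" if "x \<in> cutset K {a}" "x \<in> cutset K {b}" for x
    using that ab by (auto simp: cutset_def)
  then have "{src K d, tgt K d} = {src K e, tgt K e}" using d e by simp
  moreover have "d \<in> arcs K" "e \<in> arcs K" using d e by (auto simp: cutset_def)
  ultimately have "e \<in> parallel_arcs K" using ne unfolding parallel_arcs_def by blast
  then show False using simple by simp
qed

text \<open>For \<open>r \<ge> 4\<close> each position carries two parallel spokes, numbered 2 and
  3. Their different colours lie in the image stars of both ends, and in a simple graph two distinct
  stars share at most one arc, so the two image stars coincide.\<close>

lemma no_minimal_universal:
  assumes r: "4 \<le> r" shows "\<not> minimal_universal r K"
proof
  assume m: "minimal_universal r K"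
  have r3: "3 \<le> r" using r by simp
  note K = minimal_rgraph[OF r3 m] and simple = minimal_simple[OF r3 m]
  let ?P = "fat_petersen r"
  obtain f where f: "cut_coloring r K ?P f"
    using universal_covers[OF _ fat_petersen_rgraph[OF r3]] m unfolding minimal_universal_def covers_def by blast
  show False
  proof (rule fat_petersen_spokes_rich[OF r3])
    show inj: "inj_on f (cutset ?P {v})" if "v \<in> verts ?P" for v
      using f that by (simp add: cut_coloring_def)
    show "f ` cutset ?P {(True, i)} = f ` cutset ?P {(False, i)}" if i: "i < 5" for i
    proof -
      have v: "(b, i) \<in> verts ?P" for b using i by (simp add: fat_petersen_def)
      then have "\<exists>u\<in>verts K. f ` cutset ?P {(b, i)} = cutset K {u}" for b
        using f minimal_tight_trivial[OF r3 m simple] unfolding cut_coloring_def by blast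
      then obtain u where u: "\<And>b. f ` cutset ?P {(b, i)} = cutset K {u b}" by metis
      have s: "(i, 2) \<in> cutset ?P {(b, i)}" "(i, 3) \<in> cutset ?P {(b, i)}" for b
        using fat_petersen_star[OF r3 i] r by (cases b; auto)+
      then have "f (i, 2) \<in> cutset K {u b}" "f (i, 3) \<in> cutset K {u b}" for b using u by blast+
      moreover have "f (i, 2) \<noteq> f (i, 3)" using inj_onD[OF inj[OF v[of True]] _ s[of True]] by auto
      ultimately have "u True = u False" using simple_stars[OF K simple] by blast
      then show ?thesis using u by simp
    qed
  qed
qed

subsection \<open>The Petersen graph\<close>

definition kneser_adj :: "nat set \<Rightarrow> nat set \<Rightarrow> bool" where
  "kneser_adj A B \<longleftrightarrow> A \<in> vertices petersen_graph \<and> B \<in> vertices petersen_graph \<and> A \<inter> B = {}"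

lemma petersen_vertices: "A \<in> vertices petersen_graph \<longleftrightarrow> A \<subseteq> {0..<5} \<and> card A = 2"
  by (simp add: petersen_graph_def)

lemma petersen_vertexD:
  assumes "A \<in> vertices petersen_graph" shows "A \<subseteq> {0..<5}" "card A = 2" "finite A"
  using assms finite_subset[of A "{0..<5}"] by (auto simp: petersen_vertices)

lemma kneser_adj_sym: "kneser_adj A B \<Longrightarrow> kneser_adj B A"
  by (auto simp: kneser_adj_def)

lemma kneser_adj_vertex: "kneser_adj A B \<Longrightarrow> A \<in> vertices petersen_graph" "kneser_adj A B \<Longrightarrow> B \<in> vertices petersen_graph"
  by (auto simp: kneser_adj_def)

lemma kneser_adj_neq: 
  assumes "kneser_adj A B" shows "A \<noteq> B"
proof
  assume "A = B"
  then have "A = {}" using assms by (simp add: kneser_adj_def)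
  moreover have "card A = 2" using assms by (simp add: kneser_adj_def petersen_vertices)
  ultimately show False by simp
qed

text \<open>Three pairwise disjoint pairs would need six points.\<close>

lemma kneser_triangle_free:
  assumes "kneser_adj A B" "kneser_adj B C" "kneser_adj A C" shows False
proof -
  have v: "A \<in> vertices petersen_graph" "B \<in> vertices petersen_graph" "C \<in> vertices petersen_graph"
    and d: "A \<inter> B = {}" "B \<inter> C = {}" "A \<inter> C = {}" using assms by (auto simp: kneser_adj_def)
  note a = petersen_vertexD[OF v(1)] and b = petersen_vertexD[OF v(2)] and c = petersen_vertexD[OF v(3)]
  have "card (A \<union> B) = 4" using card_Un_disjoint[OF a(3) b(3) d(1)] a(2) b(2) by simp
  moreover have "(A \<union> B) \<inter> C = {}" using d by blast
  ultimately have "card (A \<union> B \<union> C) = 6" using card_Un_disjoint[of "A \<union> B" C] a(3) b(3) c(2,3) by simp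
  moreover have "card (A \<union> B \<union> C) \<le> card {0..<5::nat}" using a(1) b(1) c(1) by (intro card_mono) auto
  ultimately show False by simp
qed

text \<open>Two different pairs that meet cover three points; the other two points form the common
  neighbour.\<close>

lemma kneser_common_ex:
  assumes v: "A \<in> vertices petersen_graph" "B \<in> vertices petersen_graph" and ne: "A \<noteq> B" "\<not> kneser_adj A B"
  shows "\<exists>C. kneser_adj A C \<and> kneser_adj B C"
proof -
  note a = petersen_vertexD[OF v(1)] and b = petersen_vertexD[OF v(2)]
  have "A \<inter> B \<noteq> {}" using v ne(2) by (simp add: kneser_adj_def)
  then have "card (A \<inter> B) \<noteq> 0" using a(3) by simp
  moreover have "card (A \<inter> B) \<noteq> 2"
  proof
    assume c: "card (A \<inter> B) = 2"
    have "A \<inter> B = A" by (rule card_subset_eq[OF a(3)]) (use c a in auto)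
    moreover have "A \<inter> B = B" by (rule card_subset_eq[OF b(3)]) (use c b in auto)
    ultimately show False using ne(1) by blast
  qed
  moreover have "card (A \<inter> B) \<le> 2" using card_mono[OF a(3), of "A \<inter> B"] a(2) by simp
  ultimately have "card (A \<inter> B) = 1" by linarith
  then have "card (A \<union> B) = 3" using card_Un_Int[OF a(3) b(3)] a(2) b(2) by simp
  then have "card ({0..<5} - (A \<union> B)) = 2" using a b by (subst card_Diff_subset) auto
  then have "kneser_adj A ({0..<5} - (A \<union> B)) \<and> kneser_adj B ({0..<5} - (A \<union> B))"
    using v unfolding kneser_adj_def petersen_vertices by blast
  then show ?thesis by blast
qed

text \<open>A common neighbour avoids the union of the two pairs, which leaves at most two
  points.\<close>

lemma kneser_common_unique:
  assumes ne: "A \<noteq> B" and C: "kneser_adj A C" "kneser_adj B C" and D: "kneser_adj A D" "kneser_adj B D"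
  shows "C = D"
proof -
  have v: "A \<in> vertices petersen_graph" "B \<in> vertices petersen_graph" using C by (auto simp: kneser_adj_def)
  note a = petersen_vertexD[OF v(1)] and b = petersen_vertexD[OF v(2)]
  have "card (A \<inter> B) < 2"
  proof (rule ccontr)
    assume "\<not> ?thesis"
    moreover have "card (A \<inter> B) \<le> 2" using card_mono[OF a(3), of "A \<inter> B"] a(2) by simp
    ultimately have c: "card (A \<inter> B) = 2" by simp
    have "A \<inter> B = A" by (rule card_subset_eq[OF a(3)]) (use c a in auto)
    moreover have "A \<inter> B = B" by (rule card_subset_eq[OF b(3)]) (use c b in auto)
    ultimately show False using ne(1) by blast
  qed
  then have "card (A \<union> B) \<ge> 3" using card_Un_Int[OF a(3) b(3)] a(2) b(2) by simp
  then have le: "card ({0..<5} - (A \<union> B)) \<le> 2" using a b by (subst card_Diff_subset) auto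
  have "E = {0..<5} - (A \<union> B)" if E: "kneser_adj A E" "kneser_adj B E" for E
  proof (rule card_seteq)
    have v: "E \<in> vertices petersen_graph" "A \<inter> E = {}" "B \<inter> E = {}" using E by (auto simp: kneser_adj_def)
    show "E \<subseteq> {0..<5} - (A \<union> B)" using petersen_vertexD(1)[OF v(1)] v(2,3) by blast
    show "card ({0..<5} - (A \<union> B)) \<le> card E" using le petersen_vertexD(2)[OF v(1)] by simp
  qed simp
  from this[OF C] this[OF D] show ?thesis by simp
qed

lemma kneser_degree:
  assumes v: "A \<in> vertices petersen_graph" shows "card {B. kneser_adj A B} = 3"
proof -
  note a = petersen_vertexD[OF v]
  have "{B. kneser_adj A B} = {B. B \<subseteq> {0..<5} - A \<and> card B = 2}"
    using v unfolding kneser_adj_def petersen_vertices by blast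
  moreover have "card ({0..<5} - A) = 3" using a by (simp add: card_Diff_subset)
  ultimately show ?thesis using n_subsets[of "{0..<5} - A" 2] by (simp add: choose_two)
qed

lemma kneser_other_neighbours:
  assumes "kneser_adj A B" obtains C D where "{X. kneser_adj A X} = {B, C, D}" "C \<noteq> D" "C \<noteq> B" "D \<noteq> B"
proof -
  have c: "card {X. kneser_adj A X} = 3" using kneser_degree assms by (simp add: kneser_adj_def)
  then have "card ({X. kneser_adj A X} - {B}) = 2" using assms by simp
  then obtain C D where CD: "{X. kneser_adj A X} - {B} = {C, D}" "C \<noteq> D" unfolding card_2_iff by blast
  have "{X. kneser_adj A X} = {B, C, D}" using CD(1) assms by blast
  moreover have "C \<noteq> B" "D \<noteq> B" using CD(1) by blast+
  ultimately show ?thesis using that CD(2) by blast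
qed

lemma petersen_edges: "edges petersen_graph = {{A, B} | A B. kneser_adj A B}"
  by (simp add: petersen_graph_def kneser_adj_def)

lemma petersen_wf: "wf_multigraph petersen_graph"
proof -
  have "vertices petersen_graph \<subseteq> Pow {0..<5}" using petersen_vertices by blast
  then have f: "finite (vertices petersen_graph)" by (rule finite_subset) simp
  have "edges petersen_graph \<subseteq> Pow (vertices petersen_graph)"
    unfolding petersen_edges using kneser_adj_vertex by blast
  then have "finite (edges petersen_graph)" by (rule finite_subset) (simp add: f)
  moreover have "ends petersen_graph e \<subseteq> vertices petersen_graph \<and> card (ends petersen_graph e) = 2"
    if e: "e \<in> edges petersen_graph" for e
  proof -
    obtain A B where "e = {A, B}" "kneser_adj A B" using e unfolding petersen_edges by blast
    moreover have "ends petersen_graph e = e" by (simp add: petersen_graph_def)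
    ultimately show ?thesis using kneser_adj_vertex kneser_adj_neq by auto
  qed
  ultimately show ?thesis using f by (simp add: wf_multigraph_def)
qed

abbreviation "petersen_graft \<equiv> graft_of petersen_graph"

lemma petersen_cutset:
  "{A, B} \<in> cutset petersen_graft X \<longleftrightarrow> kneser_adj A B \<and> (A \<in> X) \<noteq> (B \<in> X)"
proof -
  have e: "{A, B} \<in> edges petersen_graph \<longleftrightarrow> kneser_adj A B"
    unfolding petersen_edges using kneser_adj_sym by (auto simp: doubleton_eq_iff)
  have "{A, B} \<in> cutset petersen_graft X \<longleftrightarrow> kneser_adj A B \<and> card ({A, B} \<inter> X) = 1"
    unfolding graft_of_cutset[OF petersen_wf] edge_boundary_def using e by (simp add: petersen_graph_def)
  then show ?thesis using card_doubleton_Int kneser_adj_neq by metis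
qed

lemma petersen_star:
  "cutset petersen_graft {A} = (\<lambda>B. {A, B}) ` {B. kneser_adj A B}"
proof (rule set_eqI)
  fix e show "e \<in> cutset petersen_graft {A} \<longleftrightarrow> e \<in> (\<lambda>B. {A, B}) ` {B. kneser_adj A B}"
  proof
    assume e: "e \<in> cutset petersen_graft {A}"
    then have "e \<in> edges petersen_graph" by (simp add: cutset_def)
    then obtain C D where CD: "e = {C, D}" "kneser_adj C D" unfolding petersen_edges by blast
    then have "C = A \<or> D = A" using e petersen_cutset by auto
    then show "e \<in> (\<lambda>B. {A, B}) ` {B. kneser_adj A B}"
    proof
      assume "D = A" then show ?thesis using CD kneser_adj_sym[OF CD(2)] by (auto simp: insert_commute)
    qed (use CD in auto)
  next
    assume "e \<in> (\<lambda>B. {A, B}) ` {B. kneser_adj A B}"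
    then obtain B where B: "e = {A, B}" "kneser_adj A B" by blast
    then show "e \<in> cutset petersen_graft {A}"
      using petersen_cutset[of A B "{A}"] kneser_adj_neq[OF B(2)] by simp
  qed
qed

lemma petersen_degree:
  assumes "A \<in> vertices petersen_graph" shows "card (cutset petersen_graft {A}) = 3"
proof -
  have "inj_on (\<lambda>B. {A, B}) {B. kneser_adj A B}" by (auto simp: inj_on_def doubleton_eq_iff)
  then show ?thesis unfolding petersen_star using kneser_degree[OF assms] by (simp add: card_image)
qed

text \<open>In a cubic graph odd sets have cuts of odd size, so only a single cut edge has to be
  excluded. Further neighbours of its two ends are adjacent or have a common neighbour, which gives
  a path from one side to the other that avoids the edge.\<close>

lemma petersen_rgraph: "is_rgraph 3 petersen_graft"
proof (rule is_rgraphI)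
  let ?V = "vertices petersen_graph"
  have fin: "finite ?V" "finite (edges petersen_graph)" using petersen_wf by (simp_all add: wf_multigraph_def)
  have ne: "{0, 1} \<in> ?V" by (simp add: petersen_vertices)
  show "finite (verts petersen_graft)" "finite (arcs petersen_graft)" using fin by simp_all
  show "verts petersen_graft \<noteq> {}" "terminals petersen_graft = verts petersen_graft" using ne by auto
  show "card (cutset petersen_graft {v}) = 3" if "v \<in> verts petersen_graft" for v using that petersen_degree by simp
  show "src petersen_graft e \<in> verts petersen_graft \<and> tgt petersen_graft e \<in> verts petersen_graft \<and> src petersen_graft e \<noteq> tgt petersen_graft e"
    if e: "e \<in> arcs petersen_graft" for e
  proof -
    have "ends petersen_graph e \<subseteq> ?V" using e petersen_wf by (simp add: wf_multigraph_def)
    then show ?thesis using graft_of_ends[OF petersen_wf, of e] e by simp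
  qed
  show "3 \<le> card (cutset petersen_graft X)" if X: "X \<subseteq> verts petersen_graft" "odd (card X)" for X
  proof (rule ccontr)
    assume "\<not> 3 \<le> card (cutset petersen_graft X)"
    moreover have fX: "finite X" using X(1) fin(1) finite_subset by auto
    have "{x \<in> X. odd (card (cutset petersen_graft {x}))} = X" using X(1) petersen_degree by auto
    then have "odd (card (cutset petersen_graft X))" using odd_card_cutset[of petersen_graft X] fin fX X(2) by simp
    ultimately have "card (cutset petersen_graft X) = 1" by presburger
    then obtain e where e: "cutset petersen_graft X = {e}" by (rule card_1_singletonE)
    then have "e \<in> edges petersen_graph" using cutset_subset[of petersen_graft X] by simp
    then obtain A B where AB: "e = {A, B}" "kneser_adj A B" "A \<in> X" "B \<notin> X"
    proof -
      assume *: "\<And>A B. e = {A, B} \<Longrightarrow> kneser_adj A B \<Longrightarrow> A \<in> X \<Longrightarrow> B \<notin> X \<Longrightarrow> thesis"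
      obtain A B where AB: "e = {A, B}" "kneser_adj A B" using \<open>e \<in> edges petersen_graph\<close> unfolding petersen_edges by blast
      then have "(A \<in> X) \<noteq> (B \<in> X)" using e petersen_cutset[of A B X] by simp
      then show thesis using *[of A B] *[of B A] AB kneser_adj_sym[OF AB(2)] by (auto simp: insert_commute)
    qed
    have keep: "C \<in> X \<longleftrightarrow> D \<in> X" if "kneser_adj C D" "{C, D} \<noteq> {A, B}" for C D
      using petersen_cutset[of C D X] that e AB(1) by auto
    obtain a a' where a: "{X. kneser_adj A X} = {B, a, a'}" "a \<noteq> a'" "a \<noteq> B" "a' \<noteq> B" using kneser_other_neighbours[OF AB(2)] .
    obtain c c' where c: "{X. kneser_adj B X} = {A, c, c'}" "c \<noteq> c'" "c \<noteq> A" "c' \<noteq> A" using kneser_other_neighbours[OF kneser_adj_sym[OF AB(2)]] .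
    have Aa: "kneser_adj A a" and Bc: "kneser_adj B c" using a(1) c(1) by blast+
    have ne: "a \<noteq> A" "c \<noteq> B" using kneser_adj_neq Aa Bc by blast+
    have aX: "a \<in> X" using keep[OF Aa] a(3) AB(3) by (auto simp: doubleton_eq_iff)
    have cX: "c \<notin> X" using keep[OF Bc] c(3) AB(4) by (auto simp: doubleton_eq_iff)
    show False
    proof (cases "kneser_adj a c")
      case True
      then show False using keep[OF True] aX cX ne a(3) by (auto simp: doubleton_eq_iff)
    next
      case False
      then obtain p where p: "kneser_adj a p" "kneser_adj c p"
        using kneser_common_ex[of a c] kneser_adj_vertex Aa Bc aX cX by blast
      then show False using keep[OF p(1)] keep[OF p(2)] aX cX ne a(3) c(3) by (auto simp: doubleton_eq_iff)
    qed
  qed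
  show "X = {} \<or> X = verts petersen_graft" if X: "X \<subseteq> verts petersen_graft" "cutset petersen_graft X = {}" for X
  proof (rule ccontr)
    assume "\<not> ?thesis"
    then obtain A B where AB: "A \<in> X" "B \<notin> X" "A \<in> ?V" "B \<in> ?V" using X(1) by auto
    have keep: "C \<in> X \<longleftrightarrow> D \<in> X" if "kneser_adj C D" for C D using petersen_cutset[of C D X] that X(2) by auto
    show False
    proof (cases "kneser_adj A B")
      case True then show False using keep AB by blast
    next
      case False
      then obtain p where "kneser_adj A p" "kneser_adj B p" using kneser_common_ex AB by blast
      then show False using keep AB by blast
    qed
  qed
qed

text \<open>Give each edge of a triangle the colour of the arc that leaves the opposite corner. All
  three corners then see exactly the boundary of the triangle, which is a tight cut, so this is an
  endomorphism. It is not injective, contrary to minimality.\<close>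

lemma minimal_triangle_free:
  assumes m: "minimal_universal 3 K" and abc: "a \<in> verts K" "b \<in> verts K" "c \<in> verts K" "a \<noteq> b" "b \<noteq> c" "a \<noteq> c"
    and x: "x \<in> cutset K {a}" "x \<in> cutset K {b}" and y: "y \<in> cutset K {b}" "y \<in> cutset K {c}"
    and z: "z \<in> cutset K {a}" "z \<in> cutset K {c}"
  shows False
proof -
  have r: "3 \<le> (3::nat)" by simp
  note K = minimal_rgraph[OF r m]
  have two: "e \<notin> cutset K {w}" if "e \<in> cutset K {u}" "e \<in> cutset K {v}" "u \<noteq> v" "u \<noteq> w" "v \<noteq> w" for e u v w
    using that by (auto simp: cutset_def)
  have n: "x \<notin> cutset K {c}" "y \<notin> cutset K {a}" "z \<notin> cutset K {b}" using two x y z abc by metis+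
  then have d: "x \<noteq> y" "y \<noteq> z" "x \<noteq> z" using x y z by blast+
  have single: "\<exists>h. cutset K {u} = {p, q, h} \<and> h \<noteq> p \<and> h \<noteq> q" if "u \<in> verts K" "p \<in> cutset K {u}" "q \<in> cutset K {u}" "p \<noteq> q" for u p q
  proof -
    have "card (cutset K {u} - {p, q}) = 1"
      using that is_rgraphD(4)[OF K that(1)] by (simp add: card_Diff_subset)
    then obtain h where h: "cutset K {u} - {p, q} = {h}" by (rule card_1_singletonE)
    then have "cutset K {u} = {p, q, h}" "h \<noteq> p" "h \<noteq> q" using that(2,3) by blast+
    then show ?thesis by blast
  qed
  obtain p where p: "cutset K {a} = {x, z, p}" "p \<noteq> x" "p \<noteq> z" using single[OF abc(1) x(1) z(1) d(3)] by blast
  obtain q where q: "cutset K {b} = {x, y, q}" "q \<noteq> x" "q \<noteq> y" using single[OF abc(2) x(2) y(1) d(1)] by blast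
  obtain h where h: "cutset K {c} = {y, z, h}" "h \<noteq> y" "h \<noteq> z" using single[OF abc(3) y(2) z(2) d(2)] by blast
  let ?X = "{a, b, c}"
  have sub: "cutset K ?X \<subseteq> {p, q, h}"
  proof
    fix e assume e: "e \<in> cutset K ?X"
    then have "e \<in> cutset K {a} \<or> e \<in> cutset K {b} \<or> e \<in> cutset K {c}" by (auto simp: cutset_def)
    moreover have "e \<notin> cutset K ?X" if "e \<in> cutset K {u}" "e \<in> cutset K {v}" "u \<in> ?X" "v \<in> ?X" "u \<noteq> v" for u v
      using that by (auto simp: cutset_def)
    then have "e \<noteq> x" "e \<noteq> y" "e \<noteq> z" using e x y z abc(4-6) by blast+
    ultimately show "e \<in> {p, q, h}" using p(1) q(1) h(1) by blast
  qed
  have cX: "card ?X = 3" using abc by simp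
  \<comment> \<open>The triangle is an odd set, so its boundary has at least three arcs and the arcs
    leaving the three corners are distinct.\<close>
  then have ge: "3 \<le> card (cutset K ?X)" using is_rgraphD(11)[OF K, of ?X] abc by simp
  have le: "card {p, q, h} \<le> 3" by (simp add: card_insert_if)
  have eq: "cutset K ?X = {p, q, h}" using card_seteq[OF _ sub] ge le by simp
  then have c3: "card {p, q, h} = 3" using ge le by simp
  then have t: "tight 3 K {p, q, h}" unfolding rgraph_tight_iff[OF K] using eq cX abc
    by (intro exI[of _ ?X]) simp
  have pqh: "p \<noteq> q" "q \<noteq> h" "p \<noteq> h" using c3 by (auto simp: card_insert_if split: if_splits)
  have out: "p \<noteq> y" "q \<noteq> z" "h \<noteq> x" using n p(1) q(1) h(1) by blast+
  define g where "g = (\<lambda>e. if e = x then h else if e = y then p else if e = z then q else e)"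
  have g: "g x = h" "g y = p" "g z = q" "g p = p" "g q = q" "g h = h"
    using d p(2,3) q(2,3) h(2,3) out by (auto simp: g_def)
  have "cut_coloring 3 K K g" unfolding cut_coloring_def
  proof
    fix v assume v: "v \<in> verts K"
    consider "v = a" | "v = b" | "v = c" | "v \<notin> ?X" by blast
    then show "inj_on g (cutset K {v}) \<and> tight 3 K (g ` cutset K {v})"
    proof cases
      case 1
      have "inj_on g {x, z, p}" using g pqh by (auto simp: inj_on_def)
      moreover have "g ` {x, z, p} = {p, q, h}" using g by auto
      ultimately show ?thesis using 1 p(1) t by simp
    next
      case 2
      have "inj_on g {x, y, q}" using g pqh by (auto simp: inj_on_def)
      moreover have "g ` {x, y, q} = {p, q, h}" using g by auto
      ultimately show ?thesis using 2 q(1) t by simp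
    next
      case 3
      have "inj_on g {y, z, h}" using g pqh by (auto simp: inj_on_def)
      moreover have "g ` {y, z, h} = {p, q, h}" using g by auto
      ultimately show ?thesis using 3 h(1) t by simp
    next
      case 4
      then have "x \<notin> cutset K {v}" "y \<notin> cutset K {v}" "z \<notin> cutset K {v}" using two x y z abc(4-6) by (metis insertCI)+
      then have i: "g e = e" if "e \<in> cutset K {v}" for e using that by (auto simp: g_def)
      then have "g ` cutset K {v} = cutset K {v}" by (simp add: image_def)
      moreover have "inj_on g (cutset K {v})" using i by (simp add: inj_on_def)
      ultimately show ?thesis using star_tight[OF K v] by simp
    qed
  qed
  then have "inj_on g (arcs K)" using minimal_endo_surj[OF m K] by (auto simp: bij_betw_def)
  moreover have "x \<in> arcs K" "h \<in> arcs K" using x(1) h(1) cutset_subset[of K "{c}"] by (auto simp: cutset_def)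
  ultimately show False using g(1,6) out(3) by (auto dest: inj_onD)
qed

section \<open>Colourings of the Petersen graph by a minimal universal 3-graft\<close>

context
  fixes K :: "('w, 'c) graft" and f :: "nat set set \<Rightarrow> 'c" and u :: "nat set \<Rightarrow> 'w"
  assumes m: "minimal_universal 3 K" and f: "cut_coloring 3 K petersen_graft f"
    and u: "\<And>A. A \<in> vertices petersen_graph \<Longrightarrow> u A \<in> verts K \<and> f ` cutset petersen_graft {A} = cutset K {u A}"
begin

lemma petersen_target_rgraph: "is_rgraph 3 K"
  by (rule minimal_rgraph[OF _ m]) simp

lemma petersen_image_star_inj:
  assumes "kneser_adj A B" "kneser_adj A C" "B \<noteq> C" shows "f {A, B} \<noteq> f {A, C}"
proof -
  have "inj_on f (cutset petersen_graft {A})" using f assms(1) by (simp add: cut_coloring_def kneser_adj_def)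
  moreover have "{A, B} \<in> cutset petersen_graft {A}" "{A, C} \<in> cutset petersen_graft {A}"
    unfolding petersen_star using assms by blast+
  moreover have "{A, B} \<noteq> {A, C}" using assms(3) by (auto simp: doubleton_eq_iff)
  ultimately show ?thesis by (meson inj_onD)
qed

lemma petersen_image_star_mem:
  assumes "kneser_adj A B" shows "f {A, B} \<in> cutset K {u A}" "f {A, B} \<in> cutset K {u B}"
proof -
  have 1: "f {A, B} \<in> cutset K {u A}" if "kneser_adj A B" for A B
  proof -
    have "{A, B} \<in> cutset petersen_graft {A}" unfolding petersen_star using that by blast
    then show ?thesis using u[of A] that kneser_adj_vertex(1)[OF that] by blast
  qed
  show "f {A, B} \<in> cutset K {u A}" using 1[OF assms] .
  show "f {A, B} \<in> cutset K {u B}" using 1[OF kneser_adj_sym[OF assms]] by (simp add: insert_commute)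
qed

lemma petersen_image_star_ex:
  assumes "A \<in> vertices petersen_graph" "e \<in> cutset K {u A}" obtains B where "kneser_adj A B" "e = f {A, B}"
proof -
  have "e \<in> f ` cutset petersen_graft {A}" using u[OF assms(1)] assms(2) by simp
  then show ?thesis using that unfolding petersen_star by blast
qed

lemma petersen_image_verts: "A \<in> vertices petersen_graph \<Longrightarrow> u A \<in> verts K"
  using u by blast

lemma petersen_image_stars_eq: "d \<in> cutset K {a} \<Longrightarrow> d \<in> cutset K {b} \<Longrightarrow> e \<in> cutset K {a} \<Longrightarrow> e \<in> cutset K {b} \<Longrightarrow> d \<noteq> e \<Longrightarrow> a = b"
  by (rule simple_stars[OF petersen_target_rgraph minimal_simple[OF _ m]]) simp_all

text \<open>The path a, x, y, c closes to a 5-cycle through a common neighbour \<open>p\<close> of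
  \<open>a\<close> and \<open>c\<close>. Their image stars share the colour of
  \<open>{x, a}\<close>, and each shares an arc with the image star of \<open>p\<close>. Three
  different image vertices would form a triangle; hence all three coincide, and the third edge at
  \<open>p\<close> must take the remaining colour.\<close>

lemma petersen_poor_path:
  assumes xy: "kneser_adj x y" and xa: "kneser_adj x a" "a \<noteq> y" and yc: "kneser_adj y c" "c \<noteq> x"
    and e: "f {x, a} = f {y, c}"
  shows "\<exists>p. kneser_adj a p \<and> kneser_adj c p \<and> p \<noteq> x \<and> p \<noteq> y \<and> a \<noteq> c \<and>
    (\<forall>q. kneser_adj p q \<longrightarrow> q \<noteq> a \<longrightarrow> q \<noteq> c \<longrightarrow> f {p, q} = f {x, a})"
proof -
  note s = kneser_adj_sym
  have ac: "a \<noteq> c" using kneser_triangle_free[OF xy yc(1)] xa(1) by blast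
  have nadj: "\<not> kneser_adj a c"
  proof
    assume ac: "kneser_adj a c"
    have "a \<noteq> y" by fact
    then have "x = c" using kneser_common_unique[of a y x c] s[OF xa(1)] s[OF xy] ac yc(1) by blast
    then show False using yc(2) by blast
  qed
  obtain p where p: "kneser_adj a p" "kneser_adj c p"
    using kneser_common_ex[OF _ _ ac nadj] kneser_adj_vertex(2) xa(1) yc(1) by blast
  have px: "p \<noteq> x" using kneser_triangle_free[OF xy yc(1)] s[OF p(2)] by blast
  have py: "p \<noteq> y" using kneser_triangle_free[OF xy _ xa(1)] s[OF p(1)] by blast
  let ?e = "f {x, a}" and ?g = "f {a, p}" and ?h = "f {c, p}"
  have e1: "?e \<in> cutset K {u a}" "?e \<in> cutset K {u c}" using petersen_image_star_mem(2)[OF xa(1)] petersen_image_star_mem(2)[OF yc(1)] e by simp_all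
  have g: "?g \<in> cutset K {u a}" "?g \<in> cutset K {u p}" using petersen_image_star_mem[OF p(1)] by simp_all
  have h: "?h \<in> cutset K {u c}" "?h \<in> cutset K {u p}" using petersen_image_star_mem[OF p(2)] by simp_all
  have ge: "?g \<noteq> ?e" using petersen_image_star_inj[OF p(1) s[OF xa(1)] px] by (simp add: insert_commute)
  have he: "?h \<noteq> ?e" using petersen_image_star_inj[OF p(2) s[OF yc(1)] py] e by (simp add: insert_commute)
  have gh: "?g \<noteq> ?h" using petersen_image_star_inj[OF s[OF p(1)] s[OF p(2)] ac] by (simp add: insert_commute)
  have vs: "u a \<in> verts K" "u c \<in> verts K" "u p \<in> verts K"
    using petersen_image_verts kneser_adj_vertex p xa(1) yc(1) by blast+
  have uac: "u a = u c"
  proof (rule ccontr)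
    assume ne: "u a \<noteq> u c"
    have "u p \<noteq> u a"
    proof
      assume "u p = u a"
      then show False using petersen_image_stars_eq[OF _ h(1) e1 he] h(2) ne by simp
    qed
    moreover have "u p \<noteq> u c"
    proof
      assume "u p = u c"
      then show False using petersen_image_stars_eq[OF g(1) _ e1 ge] g(2) ne by simp
    qed
    ultimately show False
      using minimal_triangle_free[OF m vs(1,3,2) _ _ ne g h(2,1) e1] by metis
  qed
  have up: "u p = u a" using petersen_image_stars_eq[OF g(2,1) h(2) _ gh] h(1) uac by simp
  have pv: "p \<in> vertices petersen_graph" using kneser_adj_vertex(2)[OF p(1)] .
  obtain z where z: "kneser_adj p z" "?e = f {p, z}" using petersen_image_star_ex[OF pv] e1(1) up by metis
  have "z \<noteq> a" "z \<noteq> c" using z(2) ge he by (auto simp: insert_commute)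
  have "f {p, q} = ?e" if q: "kneser_adj p q" "q \<noteq> a" "q \<noteq> c" for q
  proof -
    have "card {a, c, q, z} \<le> card {X. kneser_adj p X}"
      using q(1) z(1) s[OF p(1)] s[OF p(2)] kneser_degree[OF pv] by (intro card_mono) (auto intro: card_ge_0_finite)
    then have "q = z" using kneser_degree[OF pv] ac q(2,3) \<open>z \<noteq> a\<close> \<open>z \<noteq> c\<close> by (auto simp: card_insert_if split: if_splits)
    then show ?thesis using z(2) by simp
  qed
  then show ?thesis using p px py ac by blast
qed

text \<open>Both pairs of equal colours close to 5-cycles, through \<open>p\<close> and through
  \<open>q\<close>. The third neighbour of \<open>p\<close> is adjacent to \<open>b\<close> and to
  \<open>d\<close>, since the Petersen graph has diameter two, so it is \<open>q\<close>. The edge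
  between \<open>p\<close> and \<open>q\<close> would then have the colours of both
  \<open>{x, a}\<close> and \<open>{x, b}\<close>.\<close>

lemma petersen_poor_edge:
  assumes xy: "kneser_adj x y" and xa: "kneser_adj x a" "a \<noteq> y" and xb: "kneser_adj x b" "b \<noteq> y" and ab: "a \<noteq> b"
    and yc: "kneser_adj y c" "c \<noteq> x" and yd: "kneser_adj y d" "d \<noteq> x" and cd: "c \<noteq> d"
    and e: "f {x, a} = f {y, c}" "f {x, b} = f {y, d}"
  shows False
proof -
  note s = kneser_adj_sym
  note tf = kneser_triangle_free and un = kneser_common_unique
  obtain p where p: "kneser_adj a p" "kneser_adj c p" "p \<noteq> x" "p \<noteq> y" "a \<noteq> c"
    "\<And>q. kneser_adj p q \<Longrightarrow> q \<noteq> a \<Longrightarrow> q \<noteq> c \<Longrightarrow> f {p, q} = f {x, a}" using petersen_poor_path[OF xy xa yc e(1)] by blast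
  obtain q where q: "kneser_adj b q" "kneser_adj d q" "q \<noteq> x" "q \<noteq> y" "b \<noteq> d"
    "\<And>z. kneser_adj q z \<Longrightarrow> z \<noteq> b \<Longrightarrow> z \<noteq> d \<Longrightarrow> f {q, z} = f {x, b}" using petersen_poor_path[OF xy xb yd e(2)] by blast
  have nab: "\<not> kneser_adj a b" using tf[OF xa(1) _ xb(1)] by blast
  have ncd: "\<not> kneser_adj c d" using tf[OF yc(1) _ yd(1)] by blast
  have ncb: "\<not> kneser_adj c b"
  proof
    assume "kneser_adj c b"
    then have "x = c" using un[of y b x c] s[OF xy] s[OF xb(1)] yc(1) s xb(2) by blast
    then show False using yc(2) by blast
  qed
  have nad: "\<not> kneser_adj a d"
  proof
    assume "kneser_adj a d"
    then have "x = d" using un[of y a x d] s[OF xy] s[OF xa(1)] yd(1) xa(2) by blast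
    then show False using yd(2) by blast
  qed
  have pb: "p \<noteq> b" using nab p(1) by blast
  have pd: "p \<noteq> d" using nad p(1) by blast
  have npb: "\<not> kneser_adj p b"
  proof
    assume "kneser_adj p b"
    then have "a = b" using un[of x p a b] xa(1) xb(1) s[OF p(1)] p(3) by blast
    then show False using ab by blast
  qed
  have npd: "\<not> kneser_adj p d"
  proof
    assume "kneser_adj p d"
    then have "c = d" using un[of y p c d] yc(1) yd(1) s[OF p(2)] p(4) by blast
    then show False using cd by blast
  qed
  have v: "p \<in> vertices petersen_graph" "b \<in> vertices petersen_graph" "d \<in> vertices petersen_graph"
    using kneser_adj_vertex(2) p(1) xb(1) yd(1) by blast+
  obtain z where z: "kneser_adj p z" "kneser_adj b z" using kneser_common_ex[OF v(1,2) pb npb] by blast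
  obtain z' where z': "kneser_adj p z'" "kneser_adj d z'" using kneser_common_ex[OF v(1,3) pd npd] by blast
  have za: "z \<noteq> a" "z \<noteq> c" "z' \<noteq> a" "z' \<noteq> c" using z(2) z'(2) s nab ncb nad ncd by blast+
  have "card {a, c, z, z'} \<le> card {X. kneser_adj p X}"
    using z(1) z'(1) s[OF p(1)] s[OF p(2)] kneser_degree[OF v(1)] by (intro card_mono) (auto intro: card_ge_0_finite)
  then have "z = z'" using kneser_degree[OF v(1)] p(5) za by (auto simp: card_insert_if split: if_splits)
  then have "z = q" using un[OF q(5) z(2) _ q(1,2)] z'(2) by simp
  then have "f {p, q} = f {x, a}" "f {q, p} = f {x, b}"
    using p(6)[OF z(1) za(1,2)] q(6)[of p] s[OF z(1)] pb pd by auto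
  then show False using petersen_image_star_inj[OF xa(1) xb(1) ab] by (simp add: insert_commute)
qed

text \<open>If both ends of an edge saw the same star, the colours of the other edges at its ends
  would match in one of two ways; both are excluded by \<open>petersen_poor_edge\<close>.\<close>

lemma petersen_rich:
  assumes xy: "kneser_adj x y" shows "u x \<noteq> u y"
proof
  assume eq: "u x = u y"
  obtain a b where ab: "{X. kneser_adj x X} = {y, a, b}" "a \<noteq> b" "a \<noteq> y" "b \<noteq> y" using kneser_other_neighbours[OF xy] .
  obtain c d where cd: "{X. kneser_adj y X} = {x, c, d}" "c \<noteq> d" "c \<noteq> x" "d \<noteq> x"
    using kneser_other_neighbours[OF kneser_adj_sym[OF xy]] .
  have a: "kneser_adj x a" "kneser_adj x b" and c: "kneser_adj y c" "kneser_adj y d" using ab(1) cd(1) by blast+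
  have "f ` cutset petersen_graft {x} = f ` cutset petersen_graft {y}"
    using u eq kneser_adj_vertex[OF xy] by metis
  then have eq: "{f {x, y}, f {x, a}, f {x, b}} = {f {x, y}, f {y, c}, f {y, d}}"
    unfolding petersen_star ab(1) cd(1) by (simp add: insert_commute)
  have 1: "f {x, y} \<notin> {f {x, a}, f {x, b}}" using petersen_image_star_inj[OF xy a(1)] petersen_image_star_inj[OF xy a(2)] ab by auto
  have 2: "f {x, y} \<notin> {f {y, c}, f {y, d}}"
    using petersen_image_star_inj[OF kneser_adj_sym[OF xy] c(1)] petersen_image_star_inj[OF kneser_adj_sym[OF xy] c(2)] cd by (auto simp: insert_commute)
  have "{f {x, a}, f {x, b}} = {f {y, c}, f {y, d}}" using eq unfolding insert_ident[OF 1 2] .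
  then have "(f {x, a} = f {y, c} \<and> f {x, b} = f {y, d}) \<or> (f {x, a} = f {y, d} \<and> f {x, b} = f {y, c})"
    by (simp add: doubleton_eq_iff)
  then show False
    using petersen_poor_edge[OF xy a(1) ab(3) a(2) ab(4,2) c(1) cd(3) c(2) cd(4,2)]
      petersen_poor_edge[OF xy a(1) ab(3) a(2) ab(4,2) c(2) cd(4) c(1) cd(3) cd(2)[symmetric]] by blast
qed

text \<open>Nonadjacent vertices with the same image have a common neighbour \<open>z\<close>. Its
  edges to them carry two different colours, which lie in the image star of \<open>z\<close> as well
  as in the common one, so \<open>z\<close> would have the same image as its neighbours.\<close>

lemma petersen_verts_inj: "inj_on u (vertices petersen_graph)"
proof (rule inj_onI, rule ccontr)
  fix x y assume xy: "x \<in> vertices petersen_graph" "y \<in> vertices petersen_graph" "u x = u y" "x \<noteq> y"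
  show False
  proof (cases "kneser_adj x y")
    case True
    then show False using petersen_rich xy(3) by blast
  next
    case False
    then obtain z where z: "kneser_adj x z" "kneser_adj y z" using kneser_common_ex xy by blast
    have "f {x, z} \<noteq> f {y, z}" using petersen_image_star_inj[OF kneser_adj_sym[OF z(1)] kneser_adj_sym[OF z(2)] xy(4)] by (simp add: insert_commute)
    then have "u x = u z" using petersen_image_stars_eq[OF petersen_image_star_mem[OF z(1)] _ petersen_image_star_mem(2)[OF z(2)]] petersen_image_star_mem(1)[OF z(2)] xy(3) by metis
    then show False using petersen_rich[OF z(1)] by blast
  qed
qed

lemma petersen_edges_inj: "inj_on f (edges petersen_graph)"
proof (rule inj_onI)
  fix d e assume de: "d \<in> edges petersen_graph" "e \<in> edges petersen_graph" "f d = f e"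
  obtain A B where AB: "d = {A, B}" "kneser_adj A B" using de(1) unfolding petersen_edges by blast
  obtain C D where CD: "e = {C, D}" "kneser_adj C D" using de(2) unfolding petersen_edges by blast
  have ends: "{src K (f {A, B}), tgt K (f {A, B})} = u ` {A, B}" if "kneser_adj A B" for A B
    using petersen_image_star_mem[OF that] petersen_rich[OF that] by (auto simp: cutset_def)
  have "u ` d = u ` e" using ends[OF AB(2)] ends[OF CD(2)] de(3) unfolding AB(1) CD(1) by simp
  moreover have "d \<subseteq> vertices petersen_graph" "e \<subseteq> vertices petersen_graph"
    using AB CD kneser_adj_vertex by auto
  ultimately show "d = e" using inj_on_image_eq_iff[OF petersen_verts_inj] by blast
qed

text \<open>Every arc at an image vertex is the colour of an edge, whose two ends have different
  images; so both ends of the arc are image vertices, no arc leaves the image, and connectedness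
  applies.\<close>

lemma petersen_verts_surj: "u ` vertices petersen_graph = verts K"
proof -
  let ?U = "u ` vertices petersen_graph"
  have "cutset K ?U = {}"
  proof (rule ccontr)
    assume "cutset K ?U \<noteq> {}"
    then obtain e where "e \<in> cutset K ?U" by blast
    then obtain p q where pq: "p \<in> ?U" "q \<notin> ?U" "{src K e, tgt K e} = {p, q}" "e \<in> arcs K"
      using cutset_adj[OF petersen_target_rgraph, of e ?U] by (metis cutset_subset subsetD)
    obtain A where A: "A \<in> vertices petersen_graph" "p = u A" using pq(1) by blast
    have "e \<in> cutset K {u A}" using pq A(2) by (auto simp: cutset_def doubleton_eq_iff)
    then obtain B where B: "kneser_adj A B" "e = f {A, B}" using petersen_image_star_ex[OF A(1)] by blast
    then have "e \<in> cutset K {u B}" using petersen_image_star_mem(2) by blast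
    then have "u B = p \<or> u B = q" using pq(3) by (auto simp: cutset_def doubleton_eq_iff)
    moreover have "u B \<in> ?U" using kneser_adj_vertex(2)[OF B(1)] by blast
    ultimately show False using petersen_rich[OF B(1)] A(2) pq(2) by metis
  qed
  moreover have "?U \<subseteq> verts K" using petersen_image_verts by blast
  moreover have "?U \<noteq> {}" using is_rgraphD(3)[OF petersen_rgraph] by simp
  ultimately show ?thesis using is_rgraphD(6)[OF petersen_target_rgraph] by blast
qed

end

text \<open>The proper notion of Petersen colouring: images are stars, not merely tight
  cuts.\<close>

definition petersen_stars :: "('v, 'e) graft \<Rightarrow> ('e \<Rightarrow> nat set set) \<Rightarrow> bool" where
  "petersen_stars G h \<longleftrightarrow> (\<forall>v\<in>verts G. inj_on h (cutset G {v}) \<and>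
     (\<exists>A\<in>vertices petersen_graph. h ` cutset G {v} = cutset petersen_graft {A}))"

text \<open>All tight cuts of K are stars, and each star of K is the image of a star of the Petersen
  graph under the injective colouring \<open>f\<close>. Undoing \<open>f\<close> turns a colouring
  by K into one by the Petersen graph.\<close>

lemma petersen_universal:
  assumes m: "minimal_universal 3 K" and G: "is_rgraph 3 G"
  shows "\<exists>h. petersen_stars G h"
proof -
  have r: "3 \<le> (3::nat)" by simp
  obtain f where f: "cut_coloring 3 K petersen_graft f"
    using m universal_covers[OF _ petersen_rgraph] unfolding minimal_universal_def covers_def by blast
  note trivial = minimal_tight_trivial[OF r m minimal_simple[OF r m]]
  have "\<exists>w\<in>verts K. f ` cutset petersen_graft {A} = cutset K {w}" if "A \<in> vertices petersen_graph" for A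
    using f trivial that by (simp add: cut_coloring_def)
  then obtain u where u: "\<And>A. A \<in> vertices petersen_graph \<Longrightarrow> u A \<in> verts K \<and> f ` cutset petersen_graft {A} = cutset K {u A}"
    by metis
  note fi = petersen_edges_inj[OF m f u] and us = petersen_verts_surj[OF m f u]
  obtain h where h: "cut_coloring 3 K G h" using m universal_covers[OF _ G] unfolding minimal_universal_def covers_def by blast
  let ?\<phi> = "inv_into (edges petersen_graph) f"
  have "petersen_stars G (?\<phi> \<circ> h)" unfolding petersen_stars_def
  proof
    fix v assume v: "v \<in> verts G"
    then have hv: "inj_on h (cutset G {v})" "tight 3 K (h ` cutset G {v})" using h by (simp_all add: cut_coloring_def)
    obtain w where w: "w \<in> verts K" "h ` cutset G {v} = cutset K {w}" using trivial[OF hv(2)] by blast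
    then obtain A where A: "A \<in> vertices petersen_graph" "w = u A" using us by blast
    have im: "h ` cutset G {v} = f ` cutset petersen_graft {A}" using w(2) A u by simp
    have sub: "cutset petersen_graft {A} \<subseteq> edges petersen_graph" using cutset_subset[of petersen_graft "{A}"] by simp
    have "?\<phi> ` f ` cutset petersen_graft {A} = cutset petersen_graft {A}"
      using inv_into_image_cancel[OF fi sub] .
    then have "(?\<phi> \<circ> h) ` cutset G {v} = cutset petersen_graft {A}" unfolding image_comp[symmetric] im .
    moreover have "inj_on ?\<phi> (h ` cutset G {v})" unfolding im by (rule inj_on_inv_into) (use sub in blast)
    then have "inj_on (?\<phi> \<circ> h) (cutset G {v})" using hv(1) by (rule comp_inj_on[rotated])
    ultimately show "inj_on (?\<phi> \<circ> h) (cutset G {v}) \<and> (\<exists>A\<in>vertices petersen_graph. (?\<phi> \<circ> h) ` cutset G {v} = cutset petersen_graft {A})"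
      using A(1) by blast
  qed
  then show ?thesis by blast
qed

text \<open>Needed because the conjecture does not require its graphs to be connected.\<close>

lemma petersen_disconnected:
  fixes G :: "('v, 'e) graft"
  assumes all: "\<And>G :: ('v, 'e) graft. is_rgraph 3 G \<Longrightarrow> \<exists>h. petersen_stars G h"
    and "finite (verts G)" "finite (arcs G)" "terminals G = verts G"
    and "\<And>e. e \<in> arcs G \<Longrightarrow> src G e \<in> verts G \<and> tgt G e \<in> verts G \<and> src G e \<noteq> tgt G e"
    and "\<And>v. v \<in> verts G \<Longrightarrow> card (cutset G {v}) = 3"
    and "\<And>X. X \<subseteq> verts G \<Longrightarrow> odd (card X) \<Longrightarrow> 3 \<le> card (cutset G X)"
  shows "\<exists>h. petersen_stars G h"
  using assms(2-)
proof (induction "card (verts G)" arbitrary: G rule: less_induct)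
  case less
  note G = less.prems
  consider "verts G = {}" | "is_rgraph 3 G" | X where "X \<subseteq> verts G" "X \<noteq> {}" "X \<noteq> verts G" "cutset G X = {}"
    using is_rgraphI[OF G(1,2) _ G(3-6)] by blast
  then show ?case
  proof cases
    case 1
    then show ?thesis by (auto simp: petersen_stars_def)
  next
    case 2
    then show ?thesis by (rule all)
  next
    case (3 X)
    \<comment> \<open>No arc leaves \<open>Z\<close>, so the source alone decides whether an arc
      belongs to this union of components.\<close>
    define R where "R = (\<lambda>Z. G\<lparr>verts := Z, arcs := {e \<in> arcs G. src G e \<in> Z}, terminals := Z\<rparr>)"
    have part: "\<exists>h. petersen_stars (R Z) h" and cZ: "\<And>Y. Y \<subseteq> Z \<Longrightarrow> cutset (R Z) Y = cutset G Y"
      if Z: "Z \<subseteq> verts G" "Z \<noteq> verts G" "cutset G Z = {}" for Z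
    proof -
      have in_Z: "src G e \<in> Z \<longleftrightarrow> tgt G e \<in> Z" if "e \<in> arcs G" for e using Z(3) that by (auto simp: cutset_def)
      show c: "cutset (R Z) Y = cutset G Y" if "Y \<subseteq> Z" for Y
        using that in_Z by (auto simp: cutset_def R_def)
      have lt: "card (verts (R Z)) < card (verts G)"
        using Z(1,2) G(1) by (auto simp: R_def intro!: psubset_card_mono)
      show "\<exists>h. petersen_stars (R Z) h"
      proof (rule less.hyps[OF lt])
        show "finite (verts (R Z))" "finite (arcs (R Z))" "terminals (R Z) = verts (R Z)"
          using Z(1) G(1,2) by (auto simp: R_def intro: finite_subset)
        show "src (R Z) e \<in> verts (R Z) \<and> tgt (R Z) e \<in> verts (R Z) \<and> src (R Z) e \<noteq> tgt (R Z) e" if "e \<in> arcs (R Z)" for e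
          using that in_Z[of e] G(4)[of e] by (auto simp: R_def)
        show "card (cutset (R Z) {v}) = 3" if "v \<in> verts (R Z)" for v
          using that c[of "{v}"] G(5)[of v] Z(1) by (auto simp: R_def)
        show "3 \<le> card (cutset (R Z) Y)" if "Y \<subseteq> verts (R Z)" "odd (card Y)" for Y
          using that c[of Y] G(6)[of Y] Z(1) by (auto simp: R_def)
      qed
    qed
    let ?Y = "verts G - X"
    have Y: "?Y \<subseteq> verts G" "?Y \<noteq> verts G" "cutset G ?Y = {}"
      using 3 G(4) by (auto simp: cutset_def)
    obtain h1 where h1: "petersen_stars (R X) h1" using part[OF 3(1,3,4)] by blast
    obtain h2 where h2: "petersen_stars (R ?Y) h2" using part[OF Y] by blast
    define h where "h = (\<lambda>e. if src G e \<in> X then h1 e else h2 e)"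
    have "petersen_stars G h" unfolding petersen_stars_def
    proof
      fix v assume v: "v \<in> verts G"
      have P: "inj_on h (cutset G {v}) \<and> (\<exists>A\<in>vertices petersen_graph. h ` cutset G {v} = cutset petersen_graft {A})"
        if k: "petersen_stars (R Z) k" "v \<in> Z" "cutset (R Z) {v} = cutset G {v}" "\<And>e. e \<in> cutset G {v} \<Longrightarrow> h e = k e" for Z k
      proof -
        have "v \<in> verts (R Z)" using k(2) by (simp add: R_def)
        then have "inj_on k (cutset G {v}) \<and> (\<exists>A\<in>vertices petersen_graph. k ` cutset G {v} = cutset petersen_graft {A})"
          using k(1,3) unfolding petersen_stars_def by metis
        moreover have "h ` cutset G {v} = k ` cutset G {v}" using k(4) by (rule image_cong[OF refl])
        moreover have "inj_on h (cutset G {v}) = inj_on k (cutset G {v})" using k(4) by (rule inj_on_cong)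
        ultimately show ?thesis by simp
      qed
      have ends: "src G e \<in> X \<longleftrightarrow> v \<in> X" if "e \<in> cutset G {v}" for e
        using 3(4) that by (auto simp: cutset_def)
      show "inj_on h (cutset G {v}) \<and> (\<exists>A\<in>vertices petersen_graph. h ` cutset G {v} = cutset petersen_graft {A})"
      proof (cases "v \<in> X")
        case True
        show ?thesis by (rule P[OF h1 True]) (use cZ[OF 3(1,3,4), of "{v}"] True ends in \<open>auto simp: h_def\<close>)
      next
        case False
        show ?thesis by (rule P[OF h2]) (use cZ[OF Y, of "{v}"] v False ends in \<open>auto simp: h_def\<close>)
      qed
    qed
    then show ?thesis by blast
  qed
qed

text \<open>In a cubic graph the cut of an odd set has odd size. A cut consisting of one edge would
  make it a bridge, since no walk leaves the set after its deletion.\<close>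

lemma bridgeless_odd_cut:
  assumes G: "regular_multigraph 3 G" and b: "bridgeless G" and X: "X \<subseteq> vertices G" "odd (card X)"
  shows "3 \<le> card (edge_boundary G X)"
proof (rule ccontr)
  assume "\<not> 3 \<le> card (edge_boundary G X)"
  have wf: "wf_multigraph G" using G by (simp add: regular_multigraph_def)
  have fin: "finite X" "finite (arcs (graft_of G))" using wf X(1) finite_subset by (auto simp: wf_multigraph_def)
  have "{x \<in> X. odd (card (cutset (graft_of G) {x}))} = X"
    using X(1) G unfolding graft_of_cutset[OF wf] by (auto simp: regular_multigraph_def)
  then have "odd (card (edge_boundary G X))"
    using odd_card_cutset[OF fin(2,1)] X(2) unfolding graft_of_cutset[OF wf] by simp
  then have "card (edge_boundary G X) = 1" using \<open>\<not> 3 \<le> _\<close> by presburger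
  then obtain e where e: "edge_boundary G X = {e}" by (rule card_1_singletonE)
  then have eE: "e \<in> edges G" by (auto simp: edge_boundary_def)
  have cross: "d = e" if "d \<in> edges G" "ends G d = {s, t}" "s \<in> X" "t \<notin> X" for d s t
  proof -
    have "card (ends G d \<inter> X) = 1" using card_doubleton_Int[of s t X] that by auto
    then have "d \<in> edge_boundary G X" using that(1) by (simp add: edge_boundary_def)
    then show ?thesis using e by simp
  qed
  have "e \<in> cutset (graft_of G) X" unfolding graft_of_cutset[OF wf] e by simp
  then have x: "(src (graft_of G) e \<in> X) \<noteq> (tgt (graft_of G) e \<in> X)" by (simp add: cutset_def)
  obtain s t where st: "ends G e = {s, t}" "s \<in> X" "t \<notin> X"
  proof (cases "src (graft_of G) e \<in> X")
    case True
    then show ?thesis using that graft_of_ends(1)[OF wf eE] x by blast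
  next
    case False
    have "ends G e = {tgt (graft_of G) e, src (graft_of G) e}" using graft_of_ends(1)[OF wf eE] by (simp add: insert_commute)
    then show ?thesis using that x False by blast
  qed
  have "v \<in> X" if "(s, v) \<in> (vertex_adjacency (delete_edge G e))\<^sup>*" for v
    using that
  proof (induction rule: rtrancl_induct)
    case (step y z)
    then obtain d where d: "d \<in> edges G" "d \<noteq> e" "ends G d = {y, z}"
      by (auto simp: vertex_adjacency_def delete_edge_def)
    then show ?case using cross[OF d(1,3)] step.IH by blast
  qed (use st in simp)
  then have "bridge G e" using st eE unfolding bridge_def by blast
  then show False using b by (simp add: bridgeless_def)
qed

lemma minimal_universal_petersen:
  assumes m: "minimal_universal 3 K" shows petersen_coloring_conjecture
  unfolding petersen_coloring_conjecture_def
proof (intro allI impI)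
  fix G :: "(nat, nat) multigraph" assume G: "regular_multigraph 3 G \<and> bridgeless G"
  then have wf: "wf_multigraph G" by (simp add: regular_multigraph_def)
  note c = graft_of_cutset[OF wf]
  have "\<exists>h. petersen_stars (graft_of G) h"
  proof (rule petersen_disconnected)
    show "\<exists>h. petersen_stars G h" if "is_rgraph 3 G" for G :: "(nat, nat) graft"
      using petersen_universal[OF m that] .
    show "finite (verts (graft_of G))" "finite (arcs (graft_of G))" using wf by (simp_all add: wf_multigraph_def)
    show "src (graft_of G) e \<in> verts (graft_of G) \<and> tgt (graft_of G) e \<in> verts (graft_of G) \<and> src (graft_of G) e \<noteq> tgt (graft_of G) e"
      if e: "e \<in> arcs (graft_of G)" for e
    proof -
      have "ends G e \<subseteq> vertices G" using e wf by (simp add: wf_multigraph_def)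
      then show ?thesis using graft_of_ends[OF wf, of e] e by simp
    qed
    show "card (cutset (graft_of G) {v}) = 3" if "v \<in> verts (graft_of G)" for v
      using that G unfolding c by (simp add: regular_multigraph_def)
    show "3 \<le> card (cutset (graft_of G) X)" if "X \<subseteq> verts (graft_of G)" "odd (card X)" for X
      using bridgeless_odd_cut[of G X] that G unfolding c by simp
  qed simp
  then obtain h where h: "\<And>v. v \<in> vertices G \<Longrightarrow> inj_on h (edge_boundary G {v}) \<and>
     (\<exists>A\<in>vertices petersen_graph. h ` edge_boundary G {v} = edge_boundary petersen_graph {A})"
    unfolding petersen_stars_def c graft_of_cutset[OF petersen_wf] by auto
  have at: "e \<in> edge_boundary G {v} \<and> v \<in> vertices G" if "e \<in> edges G" "v \<in> ends G e" for e v
  proof -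
    have "ends G e \<subseteq> vertices G" using wf that(1) by (simp add: wf_multigraph_def)
    moreover have "ends G e \<inter> {v} = {v}" using that(2) by blast
    ultimately show ?thesis using that by (auto simp: edge_boundary_def)
  qed
  have "multigraph_coloring petersen_graph G h" unfolding multigraph_coloring_def
  proof (intro conjI allI impI ballI)
    show "h ` edges G \<subseteq> edges petersen_graph"
    proof (rule image_subsetI)
      fix e assume e: "e \<in> edges G"
      then have "ends G e \<noteq> {}" using wf by (auto simp: wf_multigraph_def)
      then obtain v where "v \<in> ends G e" by blast
      then have v: "e \<in> edge_boundary G {v}" "v \<in> vertices G" using at[OF e] by blast+
      then obtain A where "h ` edge_boundary G {v} = edge_boundary petersen_graph {A}" using h by blast
      then have "h e \<in> edge_boundary petersen_graph {A}" using v(1) by blast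
      then show "h e \<in> edges petersen_graph" by (simp add: edge_boundary_def)
    qed
    fix e1 e2 assume a: "adjacent_edges G e1 e2"
    then obtain v where v: "v \<in> ends G e1" "v \<in> ends G e2" "e1 \<in> edges G" "e2 \<in> edges G" "e1 \<noteq> e2"
      by (auto simp: adjacent_edges_def)
    then have "e1 \<in> edge_boundary G {v}" "e2 \<in> edge_boundary G {v}" "v \<in> vertices G" using at by blast+
    then show "h e1 \<noteq> h e2" using h[of v] v(5) by (meson inj_onD)
  next
    fix v assume "v \<in> vertices G"
    then show "\<exists>u\<in>vertices petersen_graph. h ` edge_boundary G {v} = edge_boundary petersen_graph {u}" using h by blast
  qed
  then show "colors petersen_graph G" by (auto simp: colors_def)
qed

theorem corollary3p20:
  fixes r :: nat and \<H> :: "('v, 'e) multigraph set"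
  assumes "r \<ge> 3"
    and "\<And>H. H \<in> \<H> \<Longrightarrow> r_graph r H \<and> connected_multigraph H"
    and "\<And>G :: (nat, nat) multigraph.
           r_graph r G \<Longrightarrow> connected_multigraph G \<Longrightarrow> simple_multigraph G \<Longrightarrow>
           \<exists>H\<in>\<H>. colors H G"
  shows "(r = 3 \<and> \<not> petersen_coloring_conjecture \<longrightarrow> infinite (\<H> // multigraph_iso)) \<and>
         (r \<ge> 4 \<longrightarrow> infinite (\<H> // multigraph_iso))"
proof -
  have K: "\<exists>K :: ('v, 'e) graft. minimal_universal r K" if "finite (\<H> // multigraph_iso)"
    using universal_member[OF _ assms(2,3) that] assms(1) minimal_universal_exists by auto
  show ?thesis using K no_minimal_universal minimal_universal_petersen by blast
qed

end
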